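(* Let $D$ be a classifying space of graded-polarized mixed Hodge structures, let $f:\Delta\to D$, $s\mapsto F_s$, be a holomorphic horizontal map from a disk with coordinate $s$, and let $u=f_*(d/ds)_{F_s}\in\mathfrak q_{F_s}$. Let $n$ be the largest index with $\mathcal F^n\neq0$, so that the top Hodge bundle $\mathcal U^n\simeq\mathcal F^n$ is a holomorphic subbundle of the trivial bundle with fibre $V_{\mathbb C}$. Let $\alpha^{(n)}:\mathcal U^n\to\mathcal U^{n-1}$ be the restriction to $\mathcal U^n$ of the component of type $(-1,1)$ of $u$. Then the first Chern form of $\mathcal U^n$ (pulled back along $f$, with the mixed Hodge metric) is non-negative, namely $$c_1(\mathcal U^n)=\frac{\mathrm i}{2\pi}\,|||\alpha^{(n)}|||_{F_s}\,ds\wedge d\bar s\ \ge 0 .$$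
   Context: Classifying space: fix a finite-dimensional real vector space $V_{\mathbb R}$, an increasing (weight) filtration $W$, non-degenerate $(-1)^k$-symmetric real bilinear forms $Q_k$ on $\operatorname{gr}^W_k$, and numbers $h^{p,q}$. $D$ is the set of decreasing filtrations $F$ of $V_{\mathbb C}$ such that $(F,W)$ is a mixed Hodge structure, graded-polarized by $\{Q_k\}$, with Hodge numbers $h^{p,q}$. For $F\in D$ the Deligne bigrading is the unique functorial $V_{\mathbb C}=\bigoplus I^{p,q}$ with $F^p=\bigoplus_{a\ge p}I^{a,b}$, $W_k=\bigoplus_{a+b\le k}I^{a,b}$, $\overline{I^{p,q}}\equiv I^{q,p}$ mod $\bigoplus_{a<q,b<p}I^{a,b}$. The mixed Hodge metric $h_F$ on $V_{\mathbb C}$ makes the bigrading orthogonal with $h_F(u,v)=\mathrm i^{p-q}Q_{p+q}([u],[\bar v])$ for $u,v\in I^{p,q}$. $G_{\mathbb C}$ is the group of complex automorphisms of $V_{\mathbb C}$ preserving $W$ and inducing automorphisms of the $Q_k$; $\mathfrak g_{\mathbb C}$ its Lie algebra; $\mathfrak g^{r,s}$ (type $(r,s)$) is the set of elements of $\mathfrak g_{\mathbb C}$ mapping each $I^{p,q}$ to $I^{p+r,q+s}$; $\mathfrak q_F=\bigoplus_{r<0}\mathfrak g^{r,s}$, identified with $T_F^{1,0}D$ by $u\mapsto\frac{d}{dt}|_0e^{tu}\cdot F$. A tangent vector is horizontal if it lies in $\bigoplus_s\mathfrak g^{-1,s}$. $\mathcal F^p$ is the tautological Hodge bundle with fibre $F^p$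 over $D$; $\mathcal U^p$ is the bundle with fibre $\bigoplus_qI^{p,q}_{(F,W)}$, which is identified with $\mathcal F^p/\mathcal F^{p+1}$. $|||\alpha^{(n)}|||_{F_s}$ denotes $\operatorname{Tr}\big((\alpha^{(n)})^*\alpha^{(n)}\big)$, the trace of this endomorphism of $\mathcal U^n$, with adjoint for $h_{F_s}$. The first Chern form is $c_1=\frac{\mathrm i}{2\pi}\operatorname{tr}R$ with $R$ the curvature of the Chern connection. *)

theory Defs
  imports "HOL-Analysis.Analysis"
begin

text \<open>
  The real vector space is \<open>real ^ 'n\<close>, its complexification is \<open>complex ^ 'n\<close> with
  componentwise conjugation. Subspaces and spans in \<open>complex ^ 'n\<close> (\<open>vec.subspace\<close>,
  \<open>vec.span\<close>) are over the complex numbers. Sums of subspaces are written as spans of unions.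
\<close>

definition vcnj :: "complex ^ 'n \<Rightarrow> complex ^ 'n"
  where "vcnj v = (\<chi> i. cnj (v $ i))"

definition vRe :: "complex ^ 'n \<Rightarrow> real ^ 'n"
  where "vRe v = (\<chi> i. Re (v $ i))"

definition vIm :: "complex ^ 'n \<Rightarrow> real ^ 'n"
  where "vIm v = (\<chi> i. Im (v $ i))"

definition complexify :: "(real ^ 'n) set \<Rightarrow> (complex ^ 'n) set"
  where "complexify S = {v. vRe v \<in> S \<and> vIm v \<in> S}"

definition complexify_form ::
    "(real ^ 'n \<Rightarrow> real ^ 'n \<Rightarrow> real) \<Rightarrow> complex ^ 'n \<Rightarrow> complex ^ 'n \<Rightarrow> complex"
  where "complexify_form B u v =
    Complex (B (vRe u) (vRe v) - B (vIm u) (vIm v)) (B (vRe u) (vIm v) + B (vIm u) (vRe v))"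


section \<open>Weight filtration and forms on the graded pieces\<close>

definition weight_filtration :: "(int \<Rightarrow> (real ^ 'n) set) \<Rightarrow> bool"
  where "weight_filtration W \<longleftrightarrow>
    (\<forall>k. subspace (W k)) \<and> mono W \<and> (\<exists>k. W k = {0}) \<and> (\<exists>k. W k = UNIV)"

text \<open>
  A bilinear form on \<open>gr\<^sub>k = W\<^sub>k / W\<^sub>k\<^sub>-\<^sub>1\<close> is the same as a bilinear form on \<open>W\<^sub>k\<close> which vanishes
  when one argument is in \<open>W\<^sub>k\<^sub>-\<^sub>1\<close>; it is non-degenerate on the quotient iff its radical is
  exactly \<open>W\<^sub>k\<^sub>-\<^sub>1\<close>. The values of \<open>Q k\<close> outside \<open>W k\<close> carry no meaning.
  Linearity in the second argument follows from the symmetry.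
\<close>

definition graded_forms ::
    "(int \<Rightarrow> (real ^ 'n) set) \<Rightarrow> (int \<Rightarrow> real ^ 'n \<Rightarrow> real ^ 'n \<Rightarrow> real) \<Rightarrow> bool"
  where "graded_forms W Q \<longleftrightarrow> (\<forall>k.
    (\<forall>x\<in>W k. \<forall>x'\<in>W k. \<forall>y\<in>W k. Q k (x + x') y = Q k x y + Q k x' y) \<and>
    (\<forall>c. \<forall>x\<in>W k. \<forall>y\<in>W k. Q k (c *\<^sub>R x) y = c * Q k x y) \<and>
    (\<forall>x\<in>W k. \<forall>y\<in>W k. Q k y x = (- 1) powi k * Q k x y) \<and>
    (\<forall>x\<in>W k. (\<forall>y\<in>W k. Q k x y = 0) \<longleftrightarrow> x \<in> W (k - 1)))"


section \<open>Mixed Hodge structures and the classifying space\<close>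

type_synonym 'n filtration = "int \<Rightarrow> (complex ^ 'n) set"

definition hodge_filtration :: "('n::finite) filtration \<Rightarrow> bool"
  where "hodge_filtration F \<longleftrightarrow>
    (\<forall>p. vec.subspace (F p)) \<and> antimono F \<and> (\<exists>p. F p = UNIV) \<and> (\<exists>p. F p = {0})"

text \<open>
  The filtration induced by \<open>F\<close> on the complexified graded piece \<open>gr\<^sub>k\<close>, represented by its
  preimage \<open>F\<^sup>p \<inter> W\<^sub>k + W\<^sub>k\<^sub>-\<^sub>1\<close> in \<open>W\<^sub>k\<close>; likewise below for the Hodge decomposition
  \<open>H\<^sup>p\<^sup>,\<^sup>q = F\<^sup>p gr\<^sub>k \<inter> conj (F\<^sup>q gr\<^sub>k)\<close>, \<open>k = p + q\<close>.
\<close>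

definition gr_filtration ::
    "(int \<Rightarrow> (real ^ 'n) set) \<Rightarrow> 'n filtration \<Rightarrow> int \<Rightarrow> int \<Rightarrow> (complex ^ 'n) set"
  where "gr_filtration W F k p = vec.span (F p \<inter> complexify (W k) \<union> complexify (W (k - 1)))"

definition gr_hodge ::
    "(int \<Rightarrow> (real ^ 'n) set) \<Rightarrow> 'n filtration \<Rightarrow> int \<Rightarrow> int \<Rightarrow> (complex ^ 'n) set"
  where "gr_hodge W F p q = gr_filtration W F (p + q) p \<inter> vcnj ` gr_filtration W F (p + q) q"

text \<open>Each \<open>gr\<^sub>k\<close> carries a pure Hodge structure of weight \<open>k\<close>:
  \<open>gr\<^sub>k = F\<^sup>p gr\<^sub>k \<oplus> conj (F\<^sup>k\<^sup>+\<^sup>1\<^sup>-\<^sup>p gr\<^sub>k)\<close> for all \<open>p\<close>.\<close>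

definition mixed_hodge_structure :: "(int \<Rightarrow> (real ^ 'n) set) \<Rightarrow> 'n filtration \<Rightarrow> bool"
  where "mixed_hodge_structure W F \<longleftrightarrow> hodge_filtration F \<and>
    (\<forall>k p. vec.span (gr_filtration W F k p \<union> vcnj ` gr_filtration W F k (k + 1 - p))
             = complexify (W k) \<and>
           gr_filtration W F k p \<inter> vcnj ` gr_filtration W F k (k + 1 - p)
             = complexify (W (k - 1)))"

text \<open>Both Riemann bilinear relations on every graded piece.\<close>

definition graded_polarized ::
    "(int \<Rightarrow> (real ^ 'n) set) \<Rightarrow> (int \<Rightarrow> real ^ 'n \<Rightarrow> real ^ 'n \<Rightarrow> real) \<Rightarrow> 'n filtration \<Rightarrow> bool"
  where "graded_polarized W Q F \<longleftrightarrow>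
    (\<forall>k p. \<forall>u\<in>gr_filtration W F k p. \<forall>v\<in>gr_filtration W F k (k + 1 - p).
       complexify_form (Q k) u v = 0) \<and>
    (\<forall>p q. \<forall>u\<in>gr_hodge W F p q. u \<notin> complexify (W (p + q - 1)) \<longrightarrow>
       (\<exists>r>0. \<i> powi (p - q) * complexify_form (Q (p + q)) u (vcnj u) = complex_of_real r))"

text \<open>\<open>hn p q\<close> is the dimension of \<open>H\<^sup>p\<^sup>,\<^sup>q\<close>, a subspace of \<open>gr\<^sub>p\<^sub>+\<^sub>q\<close>.\<close>

definition classifying_space ::
    "(int \<Rightarrow> (real ^ 'n) set) \<Rightarrow> (int \<Rightarrow> real ^ 'n \<Rightarrow> real ^ 'n \<Rightarrow> real) \<Rightarrow>
     (int \<Rightarrow> int \<Rightarrow> nat) \<Rightarrow> 'n filtration set"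
  where "classifying_space W Q hn = {F. mixed_hodge_structure W F \<and> graded_polarized W Q F \<and>
    (\<forall>p q. vec.dim (gr_hodge W F p q) = hn p q + vec.dim (complexify (W (p + q - 1))))}"


section \<open>Deligne bigrading and mixed Hodge metric\<close>

definition is_decomposition :: "('i \<Rightarrow> 'a::comm_monoid_add set) \<Rightarrow> 'a \<Rightarrow> ('i \<Rightarrow> 'a) \<Rightarrow> bool"
  where "is_decomposition A v c \<longleftrightarrow>
    (\<forall>i. c i \<in> A i) \<and> finite {i. c i \<noteq> 0} \<and> v = (\<Sum>i | c i \<noteq> 0. c i)"

text \<open>The component in \<open>A i\<close> of an element of the internal direct sum of the family \<open>A\<close>.\<close>

definition component :: "('i \<Rightarrow> 'a::comm_monoid_add set) \<Rightarrow> 'i \<Rightarrow> 'a \<Rightarrow> 'a"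
  where "component A i v = (THE c. is_decomposition A v c) i"

definition is_deligne_bigrading ::
    "(int \<Rightarrow> (real ^ 'n) set) \<Rightarrow> 'n filtration \<Rightarrow> (int \<times> int \<Rightarrow> (complex ^ 'n) set) \<Rightarrow> bool"
  where "is_deligne_bigrading W F I \<longleftrightarrow>
    (\<forall>i. vec.subspace (I i)) \<and>
    (\<forall>v. \<exists>!c. is_decomposition I v c) \<and>
    (\<forall>p. F p = vec.span (\<Union>{I (a, b) |a b. a \<ge> p})) \<and>
    (\<forall>k. complexify (W k) = vec.span (\<Union>{I (a, b) |a b. a + b \<le> k})) \<and>
    (\<forall>p q. vec.span (vcnj ` I (p, q) \<union> \<Union>{I (a, b) |a b. a < q \<and> b < p}) =
           vec.span (I (q, p) \<union> \<Union>{I (a, b) |a b. a < q \<and> b < p}))"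

definition deligne ::
    "(int \<Rightarrow> (real ^ 'n) set) \<Rightarrow> 'n filtration \<Rightarrow> int \<times> int \<Rightarrow> (complex ^ 'n) set"
  where "deligne W F = (THE I. is_deligne_bigrading W F I)"

text \<open>The sesquilinear form for which the bigrading is orthogonal and which is
  \<open>\<i>\<^sup>p\<^sup>-\<^sup>q Q\<^sub>p\<^sub>+\<^sub>q([u], [conj v])\<close> on \<open>I\<^sup>p\<^sup>,\<^sup>q\<close>; the sum is restricted to the finitely many
  non-zero summands of the bigrading.\<close>

definition mixed_hodge_metric ::
    "(int \<Rightarrow> (real ^ 'n) set) \<Rightarrow> (int \<Rightarrow> real ^ 'n \<Rightarrow> real ^ 'n \<Rightarrow> real) \<Rightarrow> 'n filtration \<Rightarrow>
     complex ^ 'n \<Rightarrow> complex ^ 'n \<Rightarrow> complex"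
  where "mixed_hodge_metric W Q F u v =
    (\<Sum>(p, q) | deligne W F (p, q) \<noteq> {0}.
       \<i> powi (p - q) * complexify_form (Q (p + q))
         (component (deligne W F) (p, q) u) (vcnj (component (deligne W F) (p, q) v)))"

definition U_fibre :: "(int \<Rightarrow> (real ^ 'n) set) \<Rightarrow> 'n filtration \<Rightarrow> int \<Rightarrow> (complex ^ 'n) set"
  where "U_fibre W F p = vec.span (\<Union>q. deligne W F (p, q))"


section \<open>The group, its Lie algebra, and tangent vectors\<close>

definition G_C ::
    "(int \<Rightarrow> (real ^ 'n) set) \<Rightarrow> (int \<Rightarrow> real ^ 'n \<Rightarrow> real ^ 'n \<Rightarrow> real) \<Rightarrow> (complex ^ 'n ^ 'n) set"
  where "G_C W Q = {g. invertible g \<and> (\<forall>k. (*v) g ` complexify (W k) = complexify (W k)) \<and>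
    (\<forall>k. \<forall>x\<in>complexify (W k). \<forall>y\<in>complexify (W k).
       complexify_form (Q k) (g *v x) (g *v y) = complexify_form (Q k) x y)}"

text \<open>The Lie algebra of a closed linear group, as its tangent space at the identity.\<close>

definition lie_algebra :: "(complex ^ 'n ^ 'n) set \<Rightarrow> (complex ^ 'n ^ 'n) set"
  where "lie_algebra G = {X. \<exists>\<gamma> :: real \<Rightarrow> complex ^ 'n ^ 'n.
    (\<forall>t. \<gamma> t \<in> G) \<and> \<gamma> 0 = mat 1 \<and> (\<gamma> has_vector_derivative X) (at 0)}"

definition g_type ::
    "(int \<Rightarrow> (real ^ 'n) set) \<Rightarrow> (int \<Rightarrow> real ^ 'n \<Rightarrow> real ^ 'n \<Rightarrow> real) \<Rightarrow> 'n filtration \<Rightarrow>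
     int \<times> int \<Rightarrow> (complex ^ 'n ^ 'n) set"
  where "g_type W Q F = (\<lambda>(r, s). {X \<in> lie_algebra (G_C W Q).
    \<forall>p q. \<forall>v\<in>deligne W F (p, q). X *v v \<in> deligne W F (p + r, q + s)})"

text \<open>\<open>span\<close> is here over the reals; as the \<open>g_type\<close> spaces are complex subspaces, the span
  of their union is their sum.\<close>

definition q_F ::
    "(int \<Rightarrow> (real ^ 'n) set) \<Rightarrow> (int \<Rightarrow> real ^ 'n \<Rightarrow> real ^ 'n \<Rightarrow> real) \<Rightarrow> 'n filtration \<Rightarrow>
     (complex ^ 'n ^ 'n) set"
  where "q_F W Q F = span (\<Union>{g_type W Q F (r, s) |r s. r < 0})"

definition horizontal ::
    "(int \<Rightarrow> (real ^ 'n) set) \<Rightarrow> (int \<Rightarrow> real ^ 'n \<Rightarrow> real ^ 'n \<Rightarrow> real) \<Rightarrow> 'n filtration \<Rightarrow>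
     (complex ^ 'n ^ 'n) set"
  where "horizontal W Q F = span (\<Union>s. g_type W Q F (- 1, s))"


section \<open>Holomorphic maps into the classifying space\<close>

definition holomorphic_vec :: "(complex \<Rightarrow> complex ^ 'n) \<Rightarrow> complex set \<Rightarrow> bool"
  where "holomorphic_vec \<sigma> U \<longleftrightarrow> (\<forall>j. (\<lambda>z. \<sigma> z $ j) holomorphic_on U)"

definition is_holomorphic_frame ::
    "(complex \<Rightarrow> (complex ^ 'n) set) \<Rightarrow> complex set \<Rightarrow> nat \<Rightarrow> (nat \<Rightarrow> complex \<Rightarrow> complex ^ 'n) \<Rightarrow> bool"
  where "is_holomorphic_frame E U r e \<longleftrightarrow>
    (\<forall>i<r. holomorphic_vec (e i) U) \<and>
    (\<forall>z\<in>U. E z = vec.span {e i z |i. i < r} \<and>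
       (\<forall>c. (\<Sum>i<r. c i *s e i z) = 0 \<longrightarrow> (\<forall>i<r. c i = 0)))"

definition holomorphic_subbundle :: "complex set \<Rightarrow> (complex \<Rightarrow> (complex ^ 'n) set) \<Rightarrow> bool"
  where "holomorphic_subbundle S E \<longleftrightarrow>
    (\<forall>s\<in>S. \<exists>U r e. open U \<and> s \<in> U \<and> U \<subseteq> S \<and> is_holomorphic_frame E U r e)"

text \<open>
  The complex structure of \<open>D\<close> is that of a submanifold of a flag variety, so a map \<open>s \<mapsto> F\<^sub>s\<close>
  into \<open>D\<close> is holomorphic iff all the pulled back tautological bundles \<open>F\<^sup>p\<close> are holomorphic
  subbundles of the trivial bundle.
\<close>

definition holomorphic_map_to ::
    "('n::finite) filtration set \<Rightarrow> complex set \<Rightarrow> (complex \<Rightarrow> 'n filtration) \<Rightarrow> bool"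
  where "holomorphic_map_to D S F \<longleftrightarrow>
    (\<forall>s\<in>S. F s \<in> D) \<and> (\<forall>p. holomorphic_subbundle S (\<lambda>s. F s p))"

text \<open>
  The tangent vector \<open>d/dt (e\<^sup>t\<^sup>X F\<^sub>s)\<close> at \<open>t = 0\<close> is \<open>f\<^sub>*(d/ds)\<close>. In the tangent space of the
  flag variety, a subspace of the sum of the \<open>Hom(F\<^sup>p, V/F\<^sup>p)\<close>, the velocity of a family of flags
  sends \<open>\<sigma>(s)\<close> to \<open>\<sigma>'(s)\<close> modulo \<open>F\<^sup>p\<close>, for \<open>\<sigma>\<close> a local holomorphic section of \<open>F\<^sup>p\<close>; for the
  family \<open>e\<^sup>t\<^sup>X F\<^sub>s\<close> and its sections \<open>e\<^sup>t\<^sup>X v\<close> this is \<open>v \<mapsto> X v\<close>.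
\<close>

definition is_pushforward ::
    "complex set \<Rightarrow> (complex \<Rightarrow> 'n filtration) \<Rightarrow> complex \<Rightarrow> complex ^ 'n ^ 'n \<Rightarrow> bool"
  where "is_pushforward S F s X \<longleftrightarrow>
    (\<forall>p U \<sigma>. open U \<and> s \<in> U \<and> U \<subseteq> S \<and> holomorphic_vec \<sigma> U \<and> (\<forall>z\<in>U. \<sigma> z \<in> F z p) \<longrightarrow>
       (\<chi> j. deriv (\<lambda>z. \<sigma> z $ j) s) - X *v \<sigma> s \<in> F s p)"


section \<open>Chern connection and first Chern form of a holomorphic subbundle\<close>

text \<open>Differentiation is over the reals; \<open>a\<close> is a tangent vector of the disk, i.e. a complex
  number.\<close>

definition dir_deriv ::
    "complex \<Rightarrow> (complex \<Rightarrow> 'v::real_normed_vector) \<Rightarrow> complex \<Rightarrow> 'v"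
  where "dir_deriv a f z = frechet_derivative f (at z) a"

primrec C_k_on :: "nat \<Rightarrow> complex set \<Rightarrow> (complex \<Rightarrow> 'v::real_normed_vector) \<Rightarrow> bool"
  where
    "C_k_on 0 U f \<longleftrightarrow> continuous_on U f"
  | "C_k_on (Suc k) U f \<longleftrightarrow>
       (\<forall>z\<in>U. f differentiable at z) \<and> (\<forall>a. C_k_on k U (dir_deriv a f))"

definition smooth_fun_on :: "complex set \<Rightarrow> (complex \<Rightarrow> 'v::real_normed_vector) \<Rightarrow> bool"
  where "smooth_fun_on U f \<longleftrightarrow> (\<forall>k. C_k_on k U f)"

definition smooth_section ::
    "(complex \<Rightarrow> (complex ^ 'n) set) \<Rightarrow> complex set \<Rightarrow> (complex \<Rightarrow> complex ^ 'n) \<Rightarrow> bool"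
  where "smooth_section E U \<sigma> \<longleftrightarrow> smooth_fun_on U \<sigma> \<and> (\<forall>z\<in>U. \<sigma> z \<in> E z)"

text \<open>\<open>N a \<sigma>\<close> is the covariant derivative of the local section \<open>\<sigma>\<close> along the constant vector field
  \<open>a\<close>. A section over \<open>U\<close> is a total function of which only the values on \<open>U\<close> matter.\<close>

definition is_connection ::
    "complex set \<Rightarrow> (complex \<Rightarrow> (complex ^ 'n) set) \<Rightarrow>
     (complex \<Rightarrow> (complex \<Rightarrow> complex ^ 'n) \<Rightarrow> complex \<Rightarrow> complex ^ 'n) \<Rightarrow> bool"
  where "is_connection S E N \<longleftrightarrow> (\<forall>U. open U \<and> U \<subseteq> S \<longrightarrow>
    (\<forall>\<sigma>. smooth_section E U \<sigma> \<longrightarrow>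
      (\<forall>a. smooth_section E U (N a \<sigma>)) \<and>
      (\<forall>a b x y. \<forall>z\<in>U. N (complex_of_real x * a + complex_of_real y * b) \<sigma> z
                        = x *\<^sub>R N a \<sigma> z + y *\<^sub>R N b \<sigma> z) \<and>
      (\<forall>\<tau>. smooth_section E U \<tau> \<longrightarrow> (\<forall>a. \<forall>z\<in>U. N a (\<lambda>w. \<sigma> w + \<tau> w) z = N a \<sigma> z + N a \<tau> z)) \<and>
      (\<forall>\<tau>. (\<forall>z\<in>U. \<tau> z = \<sigma> z) \<longrightarrow> (\<forall>a. \<forall>z\<in>U. N a \<tau> z = N a \<sigma> z)) \<and>
      (\<forall>\<phi> :: complex \<Rightarrow> complex. smooth_fun_on U \<phi> \<longrightarrow>
         (\<forall>a. \<forall>z\<in>U. N a (\<lambda>w. \<phi> w *s \<sigma> w) z = dir_deriv a \<phi> z *s \<sigma> z + \<phi> z *s N a \<sigma> z))))"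

text \<open>The connection is compatible with the metric \<open>h\<close>, and its (0,1)-part (the conjugate-linear
  part in \<open>a\<close>, on both sides multiplied by 2) is the Cauchy-Riemann operator of the trivial bundle,
  of which \<open>E\<close> is a holomorphic subbundle.\<close>

definition is_chern_connection ::
    "complex set \<Rightarrow> (complex \<Rightarrow> (complex ^ 'n) set) \<Rightarrow>
     (complex \<Rightarrow> complex ^ 'n \<Rightarrow> complex ^ 'n \<Rightarrow> complex) \<Rightarrow>
     (complex \<Rightarrow> (complex \<Rightarrow> complex ^ 'n) \<Rightarrow> complex \<Rightarrow> complex ^ 'n) \<Rightarrow> bool"
  where "is_chern_connection S E h N \<longleftrightarrow> is_connection S E N \<and>
    (\<forall>U. open U \<and> U \<subseteq> S \<longrightarrow>
      (\<forall>\<sigma> \<tau>. smooth_section E U \<sigma> \<and> smooth_section E U \<tau> \<longrightarrow>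
        (\<forall>a. \<forall>z\<in>U. dir_deriv a (\<lambda>w. h w (\<sigma> w) (\<tau> w)) z
                    = h z (N a \<sigma> z) (\<tau> z) + h z (\<sigma> z) (N a \<tau> z))) \<and>
      (\<forall>\<sigma>. smooth_section E U \<sigma> \<longrightarrow>
        (\<forall>a. \<forall>z\<in>U. N a \<sigma> z + \<i> *s N (\<i> * a) \<sigma> z
                    = dir_deriv a \<sigma> z + \<i> *s dir_deriv (\<i> * a) \<sigma> z)))"

definition chern_connection ::
    "complex set \<Rightarrow> (complex \<Rightarrow> (complex ^ 'n) set) \<Rightarrow>
     (complex \<Rightarrow> complex ^ 'n \<Rightarrow> complex ^ 'n \<Rightarrow> complex) \<Rightarrow>
     complex \<Rightarrow> (complex \<Rightarrow> complex ^ 'n) \<Rightarrow> complex \<Rightarrow> complex ^ 'n"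
  where "chern_connection S E h = (SOME N. is_chern_connection S E h N)"

text \<open>The curvature endomorphism \<open>R(a, b)\<close> of the fibre \<open>E s\<close>, computed on any local section through
  the given vector; constant vector fields commute, so there is no bracket term.\<close>

definition curvature ::
    "complex set \<Rightarrow> (complex \<Rightarrow> (complex ^ 'n) set) \<Rightarrow>
     (complex \<Rightarrow> (complex \<Rightarrow> complex ^ 'n) \<Rightarrow> complex \<Rightarrow> complex ^ 'n) \<Rightarrow>
     complex \<Rightarrow> complex \<Rightarrow> complex \<Rightarrow> complex ^ 'n \<Rightarrow> complex ^ 'n"
  where "curvature S E N s a b v = (SOME w. \<exists>U \<sigma>. open U \<and> s \<in> U \<and> U \<subseteq> S \<and>
    smooth_section E U \<sigma> \<and> \<sigma> s = v \<and> w = N a (N b \<sigma>) s - N b (N a \<sigma>) s)"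

text \<open>Trace of an endomorphism \<open>L\<close> of the subspace \<open>A\<close>.\<close>

definition trace_on ::
    "(complex ^ 'n) set \<Rightarrow> (complex ^ 'n \<Rightarrow> complex ^ 'n) \<Rightarrow> complex"
  where "trace_on A L =
    (let B = (SOME B. vec.independent B \<and> vec.span B = A)
     in \<Sum>b\<in>B. vec.representation B (L b) b)"

definition first_chern_form ::
    "complex set \<Rightarrow> (complex \<Rightarrow> (complex ^ 'n) set) \<Rightarrow>
     (complex \<Rightarrow> complex ^ 'n \<Rightarrow> complex ^ 'n \<Rightarrow> complex) \<Rightarrow>
     complex \<Rightarrow> complex \<Rightarrow> complex \<Rightarrow> complex"
  where "first_chern_form S E h s a b =
    \<i> / (2 * complex_of_real pi) * trace_on (E s) (curvature S E (chern_connection S E h) s a b)"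

text \<open>The 2-form \<open>ds \<and> d(conj s)\<close> on the pair of tangent vectors \<open>a\<close>, \<open>b\<close>.\<close>

definition ds_dsbar :: "complex \<Rightarrow> complex \<Rightarrow> complex"
  where "ds_dsbar a b = a * cnj b - b * cnj a"


section \<open>The second fundamental form\<close>

text \<open>Adjoint, with values in \<open>A\<close>, of a linear map \<open>f\<close> defined on \<open>A\<close>.\<close>

definition adjoint_on ::
    "(complex ^ 'n \<Rightarrow> complex ^ 'n \<Rightarrow> complex) \<Rightarrow> (complex ^ 'n) set \<Rightarrow>
     (complex ^ 'n \<Rightarrow> complex ^ 'n) \<Rightarrow> complex ^ 'n \<Rightarrow> complex ^ 'n"
  where "adjoint_on h A f y = (THE x. x \<in> A \<and> (\<forall>v\<in>A. h (f v) y = h v x))"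

definition alpha ::
    "(int \<Rightarrow> (real ^ 'n) set) \<Rightarrow> (int \<Rightarrow> real ^ 'n \<Rightarrow> real ^ 'n \<Rightarrow> real) \<Rightarrow> 'n filtration \<Rightarrow>
     complex ^ 'n ^ 'n \<Rightarrow> complex ^ 'n \<Rightarrow> complex ^ 'n"
  where "alpha W Q F X v = component (g_type W Q F) (- 1, 1) X *v v"

text \<open>\<open>Tr(\<alpha>\<^sup>* \<alpha>)\<close> for \<open>\<alpha> : U\<^sup>n \<rightarrow> U\<^sup>n\<^sup>-\<^sup>1\<close>.\<close>

definition alpha_norm ::
    "(int \<Rightarrow> (real ^ 'n) set) \<Rightarrow> (int \<Rightarrow> real ^ 'n \<Rightarrow> real ^ 'n \<Rightarrow> real) \<Rightarrow> 'n filtration \<Rightarrow>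
     complex ^ 'n ^ 'n \<Rightarrow> int \<Rightarrow> complex"
  where "alpha_norm W Q F X n = trace_on (U_fibre W F n)
    (\<lambda>v. adjoint_on (mixed_hodge_metric W Q F) (U_fibre W F n) (alpha W Q F X) (alpha W Q F X v))"

end

theory Submission
  imports Defs "HOL-Complex_Analysis.Cauchy_Integral_Formula"
begin

text \<open>The bundle \<open>\<F>\<^sup>n\<close> is filtered by the holomorphic subbundles \<open>\<F>\<^sup>n \<inter> W\<^sub>k\<close>, and for the mixed Hodge
  metric it is the orthogonal sum of the smooth subbundles \<open>I\<^sup>n\<^sup>,\<^sup>q\<close>, each isometric to the top Hodge
  bundle of a variation of pure Hodge structure. Let \<open>p\<^sub>q\<close> be the projection onto \<open>I\<^sup>n\<^sup>,\<^sup>q\<close> along the other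
  summands of the Deligne bigrading, and compare the Chern connection \<open>N\<close> with the sum \<open>M\<close> of the
  connections \<open>p\<^sub>q d\<close> on \<open>I\<^sup>n\<^sup>,\<^sup>q\<close>. On a diagonal block both are metric with the same (0,1)-part, so \<open>N - M\<close>
  has no diagonal blocks and the two curvatures have the same trace. The curvature of \<open>M\<close> on \<open>I\<^sup>n\<^sup>,\<^sup>q\<close> is
  \<open>p\<^sub>q [D\<^sub>a p\<^sub>q, D\<^sub>b p\<^sub>q]\<close>. Horizontality gives \<open>(D\<^sub>a p\<^sub>q) v = a \<alpha>(v)\<close> modulo \<open>W\<^sub>n\<^sub>+\<^sub>q\<^sub>-\<^sub>1\<close>, and since \<open>Q\<close> is constant,
  \<open>h((D\<^sub>a p\<^sub>q) x, t) = - conj a h(x, \<alpha>(t))\<close> for \<open>x\<close> of type \<open>(n-1, q+1)\<close>, where the sign is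
  \<open>\<i>\<^sup>2\<close> from the change of Hodge type. Hence the curvature of \<open>M\<close> is \<open>\<alpha>\<^sup>* \<alpha> ds \<and> d(conj s)\<close>.
  The smoothness of \<open>p\<^sub>q\<close> follows from Deligne's formula for \<open>I\<^sup>p\<^sup>,\<^sup>q\<close>, as all dimensions are constant.\<close>

section \<open>Internal direct sums of complex subspaces\<close>

text \<open>\<open>chern_connection\<close> and \<open>curvature\<close> are given by choice
  operators. Existence of a Chern connection is therefore shown by an explicit formula,
  \<open>D0\<close>, and everything else is derived for an arbitrary connection \<open>N\<close>
  with the defining properties, written as \<open>P d\<close> plus a matrix valued form, where
  \<open>P\<close> projects onto the bundle. The obstacle is that the splitting into the
  \<open>I (n, q)\<close> is only smooth: derivatives of a section of one summand may have
  components in other summands, so neither \<open>N\<close> nor its curvature need be block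
  diagonal, and only traces can be compared. The trace is blind to the off-diagonal part: for every
  form \<open>C\<close> of trace zero, the curvature of \<open>P d + C\<close> has the same trace as
  that of \<open>P d\<close>. The types \<open>(-1, s)\<close> of the tangent vector with
  \<open>s\<close> different from 1 drop out for reasons of weight: those with \<open>s > 1\<close>
  vanish since the group preserves \<open>W\<close>, and those with \<open>s < 1\<close> move
  vectors of \<open>W k\<close> into \<open>W (k - 1)\<close>, the radical of
  \<open>Q k\<close>.\<close>

lemma is_decompositionI:
  assumes "\<And>i. c i \<in> A i" and J: "finite J" "\<And>i. i \<notin> J \<Longrightarrow> c i = 0" and "v = sum c J"
  shows "is_decomposition A v c"
proof -
  have sub: "{i. c i \<noteq> 0} \<subseteq> J" using J(2) by auto
  have "sum c J = (\<Sum>i | c i \<noteq> 0. c i)"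
    by (rule sum.mono_neutral_right) (use J sub in auto)
  thus ?thesis using assms sub unfolding is_decomposition_def by (auto intro: finite_subset)
qed

lemma is_decomposition_sum:
  assumes "is_decomposition A v c" "finite J" "\<And>i. i \<notin> J \<Longrightarrow> c i = 0"
  shows "v = sum c J"
proof -
  have "sum c J = (\<Sum>i | c i \<noteq> 0. c i)"
    by (rule sum.mono_neutral_right) (use assms in auto)
  thus ?thesis using assms(1) by (simp add: is_decomposition_def)
qed

lemma is_decomposition_add:
  assumes "is_decomposition A v c" "is_decomposition A w d"
    and "\<And>i x y. x \<in> A i \<Longrightarrow> y \<in> A i \<Longrightarrow> x + y \<in> A i"
  shows "is_decomposition A (v + w) (\<lambda>i. c i + d i)"
proof (rule is_decompositionI)
  let ?J = "{i. c i \<noteq> 0} \<union> {i. d i \<noteq> 0}"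
  show fin: "finite ?J" using assms(1,2) by (simp add: is_decomposition_def)
  have "v = sum c ?J" "w = sum d ?J"
    by (rule is_decomposition_sum[OF assms(1) fin], blast, rule is_decomposition_sum[OF assms(2) fin], blast)
  thus "v + w = (\<Sum>i\<in>?J. c i + d i)" by (simp only: sum.distrib)
qed (use assms in \<open>auto simp: is_decomposition_def\<close>)

locale direct_family =
  fixes A :: "'i \<Rightarrow> (complex ^ 'n) set"
  assumes subspace: "vec.subspace (A i)"
    and ex1: "\<exists>!c. is_decomposition A v c"
begin

abbreviation comp :: "'i \<Rightarrow> complex ^ 'n \<Rightarrow> complex ^ 'n" where "comp i v \<equiv> component A i v"

lemma decomposition: "is_decomposition A v (\<lambda>i. comp i v)"
  using theI'[OF ex1[of v]] unfolding component_def .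

lemma comp_eq: "is_decomposition A v c \<Longrightarrow> comp i v = c i"
  using ex1 decomposition by metis

lemma comp_in: "comp i v \<in> A i"
  using decomposition unfolding is_decomposition_def by blast

lemma zero_in: "0 \<in> A i"
  using vec.subspace_0[OF subspace] .

lemma comp_add: "comp i (v + w) = comp i v + comp i w"
  by (rule comp_eq[OF is_decomposition_add[OF decomposition decomposition]])
    (rule vec.subspace_add[OF subspace])

lemma comp_scale: "comp i (a *s v) = a *s comp i v"
proof (rule comp_eq)
  have fin: "finite {i. comp i v \<noteq> 0}"
    using decomposition[of v] by (simp add: is_decomposition_def)
  show "is_decomposition A (a *s v) (\<lambda>i. a *s comp i v)"
  proof (rule is_decompositionI[OF _ fin])
    show "a *s v = (\<Sum>i | comp i v \<noteq> 0. a *s comp i v)"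
      using decomposition[of v] by (simp add: is_decomposition_def vec.scale_sum_right[symmetric] sum_negf)
  qed (auto intro: vec.subspace_scale[OF subspace] comp_in)
qed

lemma comp_same: "v \<in> A i \<Longrightarrow> comp j v = (if j = i then v else 0)"
  by (rule comp_eq[OF is_decompositionI[where J = "{i}"]]) (auto intro: zero_in)

lemma comp_linear: "Vector_Spaces.linear (*s) (*s) (comp i)"
  by (simp add: Vector_Spaces.linear_iff vec.vector_space_axioms comp_add comp_scale)

lemma comp_zero: "comp i 0 = 0"
  using comp_scale[of i 0 0] by simp

lemma comp_diff: "comp i (v - w) = comp i v - comp i w"
  by (metis add_diff_cancel_right' comp_add diff_add_cancel)

lemma comp_sum: "comp i (sum f S) = (\<Sum>x\<in>S. comp i (f x))"
  by (induction S rule: infinite_finite_induct) (auto simp: comp_zero comp_add)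

abbreviation "support \<equiv> {i. A i \<noteq> {0}}"

text \<open>A nonzero vector of \<open>A i\<close> is a combination of standard basis vectors, so
  one of these has a nonzero component of index \<open>i\<close>; there are finitely many of them,
  each with finitely many nonzero components.\<close>

lemma finite_support: "finite support"
proof (rule finite_subset)
  let ?f = "\<lambda>j. {i. comp i (axis j 1) \<noteq> 0}"
  show "finite (\<Union>j. ?f j)"
    using decomposition by (auto simp: is_decomposition_def)
  show "support \<subseteq> (\<Union>j. ?f j)"
  proof (rule ccontr)
    assume "\<not> support \<subseteq> (\<Union>j. ?f j)"
    then obtain i where i: "A i \<noteq> {0}" and z: "\<And>j. comp i (axis j 1) = 0" by blast
    then obtain v where v: "v \<in> A i" "v \<noteq> 0" using zero_in by blast
    have "comp i (\<Sum>j\<in>UNIV. v $ j *s axis j 1) = 0"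
      by (simp only: comp_sum comp_scale z) simp
    thus False using v comp_same[OF v(1), of i] by (simp add: basis_expansion)
  qed
qed

lemma comp_zero_outside: "i \<notin> support \<Longrightarrow> comp i v = 0"
  using comp_in[of i v] by auto

lemma sum_comp:
  assumes "finite J" "\<And>i. i \<notin> J \<Longrightarrow> comp i v = 0" shows "(\<Sum>i\<in>J. comp i v) = v"
  using is_decomposition_sum[OF decomposition assms] by simp

lemma sum_comp_support: "(\<Sum>i\<in>support. comp i v) = v"
  by (rule sum_comp) (auto simp: finite_support intro: comp_zero_outside)

lemma eq_zeroI: "(\<And>i. comp i v = 0) \<Longrightarrow> v = 0"
  using sum_comp_support[of v] by simp

lemma comp_comp: "comp j (comp i v) = (if j = i then comp i v else 0)"
  using comp_same[OF comp_in] .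

text \<open>Turns membership in a partial sum into vanishing of components. The filtrations
  \<open>F\<close> and \<open>W\<close> are read off the bigrading in this form.\<close>

lemma span_eq: "vec.span (\<Union>i\<in>S. A i) = {v. \<forall>i. i \<notin> S \<longrightarrow> comp i v = 0}" (is "?L = ?R")
proof
  have "vec.subspace ?R" 
    by (auto simp: vec.subspace_def comp_zero comp_add comp_scale)
  moreover have "(\<Union>i\<in>S. A i) \<subseteq> ?R" using comp_same by auto
  ultimately show "?L \<subseteq> ?R" by (rule vec.span_minimal[rotated])
  show "?R \<subseteq> ?L"
  proof
    fix v assume v: "v \<in> ?R"
    have "v = (\<Sum>i\<in>support. comp i v)" by (simp add: sum_comp_support)
    also have "\<dots> \<in> ?L"
    proof (rule vec.span_sum)
      fix i show "comp i v \<in> ?L"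
        using v comp_in[of i v] by (cases "i \<in> S") (auto simp: vec.span_zero intro!: vec.span_base)
    qed
    finally show "v \<in> ?L" .
  qed
qed

lemma in_spanD: "v \<in> vec.span (\<Union>i\<in>S. A i) \<Longrightarrow> i \<notin> S \<Longrightarrow> comp i v = 0"
  by (simp add: span_eq)

text \<open>Summands are added one at a time, each meeting the span of the previous ones in 0. In a
  family of Hodge structures this makes the dimensions of such spans depend only on the Hodge
  numbers.\<close>

lemma dim_span: "vec.dim (vec.span (\<Union>i\<in>S. A i)) = (\<Sum>i\<in>S \<inter> support. vec.dim (A i))"
proof -
  have *: "vec.dim (vec.span (\<Union>i\<in>T. A i)) = (\<Sum>i\<in>T. vec.dim (A i))" if "finite T" for T
    using that
  proof (induction T rule: finite_induct)
    case (insert j T)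
    let ?U = "vec.span (\<Union>i\<in>T. A i)"
    have int: "A j \<inter> ?U = {0}"
    proof -
      have "v = 0" if "v \<in> A j" "v \<in> ?U" for v
        using comp_same[OF that(1), of j] in_spanD[OF that(2) insert(2)] by simp
      thus ?thesis using zero_in vec.span_zero by blast
    qed
    have "vec.span (\<Union>i\<in>insert j T. A i) = {x + y |x y. x \<in> A j \<and> y \<in> ?U}"
      using vec.span_Un[of "A j" "\<Union>i\<in>T. A i"] vec.span_eq_iff[THEN iffD2, OF subspace, of j] by simp
    moreover have "vec.dim {x + y |x y. x \<in> A j \<and> y \<in> ?U} + vec.dim (A j \<inter> ?U)
        = vec.dim (A j) + vec.dim ?U"
      by (rule vec.dim_sums_Int) (auto simp: subspace)
    ultimately show ?case using int insert by simp
  qed simp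
  have "vec.span (\<Union>i\<in>S. A i) = vec.span (\<Union>i\<in>S \<inter> support. A i)"
    unfolding span_eq using comp_zero_outside by blast
  thus ?thesis using *[of "S \<inter> support"] finite_support by simp
qed

end

lemma direct_familyI:
  fixes A :: "'i \<Rightarrow> (complex ^ 'n) set"
  assumes sub: "\<And>i. vec.subspace (A i)" and span: "vec.span (\<Union>i. A i) = UNIV"
    and ind: "\<And>c. (\<And>i. c i \<in> A i) \<Longrightarrow> finite {i. c i \<noteq> 0} \<Longrightarrow> (\<Sum>i | c i \<noteq> 0. c i) = 0 \<Longrightarrow> c = (\<lambda>_. 0)"
  shows "direct_family A"
proof
  fix v
  have 0: "0 \<in> A i" for i using vec.subspace_0[OF sub] .
  have add: "x + y \<in> A i" if "x \<in> A i" "y \<in> A i" for x y i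
    using vec.subspace_add[OF sub that] .
  have "v \<in> vec.span (\<Union>i. A i)" using span by simp
  hence "\<exists>c. is_decomposition A v c"
  proof (induction v rule: vec.span_induct_alt)
    case base
    have "is_decomposition A 0 (\<lambda>_. 0)" by (rule is_decompositionI[where J = "{}"]) (auto simp: 0)
    thus ?case by blast
  next
    case (step a x y)
    then obtain i c where x: "x \<in> A i" and c: "is_decomposition A y c" by blast
    have "is_decomposition A (a *s x) (\<lambda>j. if j = i then a *s x else 0)"
      by (rule is_decompositionI[where J = "{i}"]) (auto simp: 0 intro: vec.subspace_scale[OF sub x])
    from is_decomposition_add[OF this c add] show ?case by blast
  qed
  moreover have "c = d" if c: "is_decomposition A v c" and d: "is_decomposition A v d" for c d
  proof -
    have "is_decomposition A (v + (-1) *s v) (\<lambda>i. c i + (-1) *s d i)"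
    proof (rule is_decomposition_add[OF c _ add])
      have fin: "finite {i. d i \<noteq> 0}" using d by (simp add: is_decomposition_def)
      show "is_decomposition A ((-1) *s v) (\<lambda>i. (-1) *s d i)"
      proof (rule is_decompositionI[OF _ fin])
        show "(-1) *s v = (\<Sum>i | d i \<noteq> 0. (-1) *s d i)"
          using d by (simp add: is_decomposition_def vec.scale_sum_right[symmetric] sum_negf)
      qed (use d in \<open>auto simp: is_decomposition_def intro: vec.subspace_neg[OF sub]\<close>)
    qed
    hence "(\<lambda>i. c i + (-1) *s d i) = (\<lambda>_. 0)"
      by (intro ind) (auto simp: is_decomposition_def)
    hence "c i + (-1) *s d i = 0" for i by meson
    hence "c i = d i" for i by (simp add: vec.scale_minus_left)
    thus ?thesis by blast
  qed
  ultimately show "\<exists>!c. is_decomposition A v c" by blast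
qed (rule sub)

section \<open>The Deligne bigrading\<close>

lemma vcnj_nth [simp]: "vcnj v $ i = cnj (v $ i)"
  by (simp add: vcnj_def)

lemma vcnj_add [simp]: "vcnj (v + w) = vcnj v + vcnj w"
  by (simp add: vec_eq_iff)

lemma vcnj_diff [simp]: "vcnj (v - w) = vcnj v - vcnj w"
  by (simp add: vec_eq_iff)

lemma vcnj_scale [simp]: "vcnj (a *s v) = cnj a *s vcnj v"
  by (simp add: vec_eq_iff)

lemma vcnj_vcnj [simp]: "vcnj (vcnj v) = v"
  by (simp add: vec_eq_iff)

lemma vcnj_zero [simp]: "vcnj 0 = 0"
  by (simp add: vec_eq_iff)

lemma mem_vcnj_image: "v \<in> vcnj ` S \<longleftrightarrow> vcnj v \<in> S"
  by (metis image_iff vcnj_vcnj)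

lemma subspace_vcnj_image: "vec.subspace S \<Longrightarrow> vec.subspace (vcnj ` S)"
  by (auto simp: vec.subspace_def mem_vcnj_image)

lemma vcnj_span: "vcnj ` vec.span S = vec.span (vcnj ` S)"
proof
  show "vec.span (vcnj ` S) \<subseteq> vcnj ` vec.span S"
    by (rule vec.span_minimal[OF image_mono]) (auto intro: vec.span_base subspace_vcnj_image)
  have "vec.span S \<subseteq> vcnj ` vec.span (vcnj ` S)"
    by (rule vec.span_minimal) (auto simp: mem_vcnj_image intro!: vec.span_base subspace_vcnj_image)
  thus "vcnj ` vec.span S \<subseteq> vec.span (vcnj ` S)"
    by (auto simp: mem_vcnj_image)
qed

text \<open>Conjugation is only conjugate-linear, so facts about linear maps do not apply. It maps
  spanning sets to spanning sets, which gives one inequality, and being an involution gives the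
  other.\<close>

lemma dim_vcnj_image: "vec.dim (vcnj ` S) = vec.dim S"
proof -
  have le: "vec.dim (vcnj ` S) \<le> vec.dim S" for S :: "(complex ^ 'n) set"
  proof -
    obtain B where B: "B \<subseteq> S" "vec.independent B" "S \<subseteq> vec.span B" "card B = vec.dim S"
      using vec.basis_exists by blast
    have fin: "finite B" using B(2) vec.independent_bound_general by blast
    have "vcnj ` S \<subseteq> vec.span (vcnj ` B)"
      using B(3) vcnj_span by blast
    hence "vec.dim (vcnj ` S) \<le> card (vcnj ` B)"
      using fin by (intro vec.dim_le_card) auto
    thus ?thesis using B(4) card_image_le[OF fin, of vcnj] by linarith
  qed
  have "vec.dim S = vec.dim (vcnj ` (vcnj ` S))" by (simp add: image_image)
  thus ?thesis using le[of S] le[of "vcnj ` S"] by simp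
qed

lemma in_spanUnE:
  assumes "v \<in> vec.span (A \<union> B)" "vec.subspace A"
  obtains x y where "x \<in> A" "y \<in> vec.span B" "v = x + y"
  using assms unfolding vec.span_Un by (auto simp: vec.span_eq_iff[THEN iffD2])

lemma in_spanUnE2:
  assumes "v \<in> vec.span (A \<union> B)" "vec.subspace A" "vec.subspace B"
  obtains x y where "x \<in> A" "y \<in> B" "v = x + y"
  using assms unfolding vec.span_Un by (auto simp: vec.span_eq_iff[THEN iffD2])

lemma span_UnI: "x \<in> A \<Longrightarrow> y \<in> B \<Longrightarrow> x + y \<in> vec.span (A \<union> B)"
  by (intro vec.span_add vec.span_base) auto

lemma vcnj_complexify:
  fixes S :: "(real ^ 'n) set"
  assumes "real_vector.subspace S" shows "vcnj v \<in> complexify S \<longleftrightarrow> v \<in> complexify S"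
proof -
  have "vRe (vcnj v) = vRe v" "vIm (vcnj v) = - vIm v"
    by (simp_all add: vRe_def vIm_def vec_eq_iff)
  thus ?thesis
    unfolding complexify_def using real_vector.subspace_neg[OF assms] by force
qed

lemma subspace_complexify:
  fixes S :: "(real ^ 'n) set"
  assumes "real_vector.subspace S" shows "vec.subspace (complexify S)"
proof -
  have "vRe (v + w) = vRe v + vRe w" "vIm (v + w) = vIm v + vIm w"
    "vRe (c *s v) = Re c *\<^sub>R vRe v - Im c *\<^sub>R vIm v"
    "vIm (c *s v) = Re c *\<^sub>R vIm v + Im c *\<^sub>R vRe v"
    "vRe (0 :: complex ^ 'n) = 0" "vIm (0 :: complex ^ 'n) = 0" for v w :: "complex ^ 'n" and c
    by (simp_all add: vRe_def vIm_def vec_eq_iff)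
  thus ?thesis using assms
    by (auto simp: vec.subspace_def complexify_def real_vector.subspace_0 real_vector.subspace_add
        real_vector.subspace_diff real_vector.subspace_scale)
qed

section \<open>Opposed filtrations, with vectors of the weight filtration instead of classes in its
  quotients\<close>

locale weight_hodge =
  fixes W :: "int \<Rightarrow> (real ^ 'n) set" and F :: "'n filtration"
  assumes W: "weight_filtration W" and MHS: "mixed_hodge_structure W F"
begin

abbreviation Wc :: "int \<Rightarrow> (complex ^ 'n) set" where "Wc k \<equiv> complexify (W k)"
abbreviation cF :: "int \<Rightarrow> (complex ^ 'n) set" where "cF q \<equiv> vcnj ` F q"

lemma subspace_Wc: "vec.subspace (Wc k)"
  using W by (intro subspace_complexify) (simp add: weight_filtration_def)

lemma vcnj_Wc: "vcnj v \<in> Wc k \<longleftrightarrow> v \<in> Wc k"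
  using W by (intro vcnj_complexify) (simp add: weight_filtration_def)

lemma Wc_mono: "k \<le> l \<Longrightarrow> Wc k \<subseteq> Wc l"
  using W unfolding weight_filtration_def complexify_def mono_def by fast

lemma Wc_bot: "\<exists>k0. \<forall>k\<le>k0. Wc k = {0}"
proof -
  obtain k0 where "W k0 = {0}" using W by (auto simp: weight_filtration_def)
  have "v = 0" if "v \<in> Wc k0" for v
  proof -
    have "vRe v = 0" "vIm v = 0" using that \<open>W k0 = {0}\<close> by (simp_all add: complexify_def)
    hence "Re (v $ i) = 0" "Im (v $ i) = 0" for i
      by (metis vRe_def vec_lambda_beta zero_index, metis vIm_def vec_lambda_beta zero_index)
    thus ?thesis by (simp add: vec_eq_iff complex_eq_iff)
  qed
  hence "Wc k0 = {0}" using vec.subspace_0[OF subspace_Wc] by blast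
  thus ?thesis using Wc_mono vec.subspace_0[OF subspace_Wc] by blast
qed

lemma Wc_top: "\<exists>k1. Wc k1 = UNIV"
proof -
  obtain k1 where "W k1 = UNIV" using W by (auto simp: weight_filtration_def)
  thus ?thesis by (auto simp: complexify_def)
qed

lemma subspace_F: "vec.subspace (F p)"
  and F_anti: "p \<le> p' \<Longrightarrow> F p' \<subseteq> F p"
  using MHS by (auto simp: mixed_hodge_structure_def hodge_filtration_def antimono_def)

lemma F_top: "\<exists>p. F p = UNIV"
  using MHS by (auto simp: mixed_hodge_structure_def hodge_filtration_def)

lemma F_bot: "\<exists>p0. \<forall>p\<ge>p0. F p = {0}"
proof -
  obtain p0 where "F p0 = {0}"
    using MHS by (auto simp: mixed_hodge_structure_def hodge_filtration_def)
  thus ?thesis using F_anti vec.subspace_0[OF subspace_F] by blast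
qed

lemma subspace_cF: "vec.subspace (cF p)"
  using subspace_F by (rule subspace_vcnj_image)

lemma cF_anti: "p \<le> p' \<Longrightarrow> cF p' \<subseteq> cF p"
  using F_anti by blast

lemmas W_intros = vec.subspace_add[OF subspace_Wc] vec.subspace_diff[OF subspace_Wc]
  vec.subspace_scale[OF subspace_Wc] vec.subspace_0[OF subspace_Wc]
lemmas F_intros = vec.subspace_add[OF subspace_F] vec.subspace_diff[OF subspace_F]
  vec.subspace_scale[OF subspace_F] vec.subspace_0[OF subspace_F]
lemmas cF_intros = vec.subspace_add[OF subspace_cF] vec.subspace_diff[OF subspace_cF]
  vec.subspace_scale[OF subspace_cF] vec.subspace_0[OF subspace_cF]

lemma Wc_pred: "v \<in> Wc (k - 1) \<Longrightarrow> v \<in> Wc k"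
  using Wc_mono[of "k - 1" k] by auto

lemma gr_filtration_iff:
  "v \<in> gr_filtration W F k p \<longleftrightarrow> (\<exists>f w. f \<in> F p \<and> f \<in> Wc k \<and> w \<in> Wc (k - 1) \<and> v = f + w)"
proof
  assume "v \<in> gr_filtration W F k p"
  thus "\<exists>f w. f \<in> F p \<and> f \<in> Wc k \<and> w \<in> Wc (k - 1) \<and> v = f + w"
    unfolding gr_filtration_def
    by (rule in_spanUnE2) (auto intro: vec.subspace_inter subspace_F subspace_Wc)
qed (auto simp: gr_filtration_def intro!: span_UnI)

lemma vcnj_gr_filtration_iff:
  "v \<in> vcnj ` gr_filtration W F k p \<longleftrightarrow>
    (\<exists>f w. f \<in> cF p \<and> f \<in> Wc k \<and> w \<in> Wc (k - 1) \<and> v = f + w)" (is "_ \<longleftrightarrow> ?R")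
proof
  assume "v \<in> vcnj ` gr_filtration W F k p"
  then obtain f w where "f \<in> F p" "f \<in> Wc k" "w \<in> Wc (k - 1)" "vcnj v = f + w"
    by (auto simp: mem_vcnj_image gr_filtration_iff)
  hence "vcnj f \<in> cF p" "vcnj f \<in> Wc k" "vcnj w \<in> Wc (k - 1)" "v = vcnj f + vcnj w"
    by (simp_all add: vcnj_Wc) (metis vcnj_add vcnj_vcnj)
  thus ?R by blast
next
  assume ?R
  then obtain f w where "f \<in> cF p" "f \<in> Wc k" "w \<in> Wc (k - 1)" "v = f + w" by blast
  hence "vcnj f \<in> F p" "vcnj f \<in> Wc k" "vcnj w \<in> Wc (k - 1)" "vcnj v = vcnj f + vcnj w"
    by (auto simp: mem_vcnj_image vcnj_Wc)
  thus "v \<in> vcnj ` gr_filtration W F k p"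
    unfolding mem_vcnj_image gr_filtration_iff by blast
qed

lemma subspace_gr_filtration: "vec.subspace (gr_filtration W F k p)"
  by (simp add: gr_filtration_def)

text \<open>Opposedness on \<open>gr_k\<close> is lifted to vectors: the equation in the quotient
  becomes one with an error term \<open>w\<close> of lower weight.\<close>

lemma opposed_split:
  assumes "x \<in> Wc k"
  obtains f g w where "f \<in> F p" "f \<in> Wc k" "g \<in> cF (k + 1 - p)" "g \<in> Wc k" "w \<in> Wc (k - 1)"
    "x = f + g + w"
proof -
  have "x \<in> vec.span (gr_filtration W F k p \<union> vcnj ` gr_filtration W F k (k + 1 - p))"
    using assms MHS unfolding mixed_hodge_structure_def by auto
  then obtain a b where a: "a \<in> gr_filtration W F k p"
    and b: "b \<in> vcnj ` gr_filtration W F k (k + 1 - p)" and x: "x = a + b"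
    by (rule in_spanUnE2) (auto intro: subspace_gr_filtration subspace_vcnj_image)
  from a obtain f w where 1: "f \<in> F p" "f \<in> Wc k" "w \<in> Wc (k - 1)" "a = f + w"
    by (auto simp: gr_filtration_iff)
  from b obtain g w' where 2: "g \<in> cF (k + 1 - p)" "g \<in> Wc k" "w' \<in> Wc (k - 1)" "b = g + w'"
    unfolding vcnj_gr_filtration_iff by blast
  show thesis
    by (rule that[OF 1(1,2) 2(1,2) W_intros(1)[OF 1(3) 2(3)]]) (simp add: x 1 2)
qed

lemma opposed_disjoint:
  assumes "f \<in> F p" "f \<in> Wc k" "g \<in> cF q" "g \<in> Wc k" "f - g \<in> Wc (k - 1)" "p + q = k + 1"
  shows "f \<in> Wc (k - 1)"
proof -
  have q: "q = k + 1 - p" using assms(6) by simp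
  have "f \<in> gr_filtration W F k p"
    unfolding gr_filtration_iff using assms(1,2) W_intros(4) by (intro exI[of _ f] exI[of _ 0]) auto
  moreover have "f \<in> vcnj ` gr_filtration W F k (k + 1 - p)"
    unfolding vcnj_gr_filtration_iff using assms(3,4,5) q by (intro exI[of _ g] exI[of _ "f - g"]) auto
  ultimately show ?thesis
    using MHS unfolding mixed_hodge_structure_def by blast
qed

text \<open>\<open>R r m\<close> is a complement of \<open>F p \<inter> Wc m\<close> in \<open>Wc m\<close> when \<open>p + r = m + 1\<close>; the corrections
  in Deligne's formula for \<open>I\<^sup>p\<^sup>,\<^sup>q\<close> are taken from such a space.\<close>

definition R :: "int \<Rightarrow> int \<Rightarrow> (complex ^ 'n) set"
  where "R r m = vec.span (\<Union>j::nat. cF (r - int j) \<inter> Wc (m - int j))"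

lemma subspace_R: "vec.subspace (R r m)"
  by (simp add: R_def)

lemma R_incl:
  assumes "0 \<le> j" "r - j \<le> b" "l \<le> m - j" shows "cF b \<inter> Wc l \<subseteq> R r m"
proof -
  have "cF b \<inter> Wc l \<subseteq> cF (r - int (nat j)) \<inter> Wc (m - int (nat j))"
    using assms cF_anti[of "r - j" b] Wc_mono[of l "m - j"] by auto
  also have "\<dots> \<subseteq> (\<Union>j::nat. cF (r - int j) \<inter> Wc (m - int j))"
    by (rule UN_upper) simp
  also have "\<dots> \<subseteq> R r m" unfolding R_def by (rule vec.span_superset)
  finally show ?thesis .
qed

lemma R_mono:
  assumes "0 \<le> j" "r - j \<le> b" "l \<le> m - j" shows "R b l \<subseteq> R r m"
  unfolding R_def[of b l]
proof (rule vec.span_minimal)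
  show "(\<Union>i. cF (b - int i) \<inter> Wc (l - int i)) \<subseteq> R r m"
  proof (rule UN_least)
    fix i show "cF (b - int i) \<inter> Wc (l - int i) \<subseteq> R r m"
      by (rule R_incl[of "j + int i"]) (use assms in auto)
  qed
qed (rule subspace_R)

lemma R_Wc: "R r m \<subseteq> Wc m"
  unfolding R_def
proof (rule vec.span_minimal[OF UN_least])
  fix j show "cF (r - int j) \<inter> Wc (m - int j) \<subseteq> Wc m"
    using Wc_mono[of "m - int j" m] by auto
qed (rule subspace_Wc)

text \<open>Separating the term \<open>j = 0\<close> of the defining sum gives a recursion in which
  both indices drop by one; the inductions over the weight rest on it.\<close>

lemma R_split:
  assumes "x \<in> R r m"
  obtains y z where "y \<in> cF r" "y \<in> Wc m" "z \<in> R (r - 1) (m - 1)" "x = y + z"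
proof -
  have "(\<Union>j::nat. cF (r - int j) \<inter> Wc (m - int j)) = (cF r \<inter> Wc m) \<union>
    (\<Union>j::nat. cF (r - 1 - int j) \<inter> Wc (m - 1 - int j))" (is "?A = ?B")
  proof
    show "?A \<subseteq> ?B"
    proof (rule UN_least)
      fix j :: nat
      show "cF (r - int j) \<inter> Wc (m - int j) \<subseteq> ?B"
      proof (cases j)
        case (Suc i)
        have eq: "r - int j = r - 1 - int i" "m - int j = m - 1 - int i" using Suc by auto
        show ?thesis unfolding eq
          using UN_upper[of i UNIV "\<lambda>i. cF (r - 1 - int i) \<inter> Wc (m - 1 - int i)"] by blast
      qed auto
    qed
    have 1: "cF (r - 1 - int j) \<inter> Wc (m - 1 - int j) \<subseteq> ?A" for j :: nat
    proof -
      have eq: "r - int (Suc j) = r - 1 - int j" "m - int (Suc j) = m - 1 - int j" by auto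
      show ?thesis
        using UN_upper[of "Suc j" UNIV "\<lambda>j. cF (r - int j) \<inter> Wc (m - int j)"]
        unfolding eq by blast
    qed
    have 2: "cF r \<inter> Wc m \<subseteq> ?A" using UN_upper[of 0 UNIV "\<lambda>j. cF (r - int j) \<inter> Wc (m - int j)"] by simp
    show "?B \<subseteq> ?A" by (intro Un_least UN_least 1 2)
  qed
  hence "x \<in> vec.span ((cF r \<inter> Wc m) \<union> (\<Union>j::nat. cF (r - 1 - int j) \<inter> Wc (m - 1 - int j)))"
    using assms by (simp add: R_def)
  then obtain y z where "y \<in> cF r \<inter> Wc m" "z \<in> R (r - 1) (m - 1)" "x = y + z"
    by (rule in_spanUnE) (auto simp: R_def intro: vec.subspace_inter subspace_cF subspace_Wc)
  thus thesis using that by blast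
qed

text \<open>Induction over the weight with \<open>p\<close> fixed, so that \<open>r\<close> drops
  together with \<open>m\<close>. On the top graded piece \<open>F p\<close> and \<open>cF r\<close>
  are complementary because \<open>p + r = m + 1\<close>; below it, \<open>R (r - 1) (m - 1)\<close>
  is a complement by induction. For the trivial intersection, opposedness lowers the weight of the
  \<open>cF r\<close> part by one, and that part is then absorbed by
  \<open>R (r - 1) (m - 1)\<close>.\<close>

lemma F_R_complement:
  assumes "p + r = m + 1"
  shows "(\<forall>x\<in>Wc m. \<exists>f\<in>F p \<inter> Wc m. x - f \<in> R r m) \<and> F p \<inter> R r m \<subseteq> {0}"
proof -
  obtain k0 where k0: "\<And>k. k \<le> k0 \<Longrightarrow> Wc k = {0}" using Wc_bot by blast
  have triv: "(\<forall>x\<in>Wc m. \<exists>f\<in>F p \<inter> Wc m. x - f \<in> R r m) \<and> F p \<inter> R r m \<subseteq> {0}" if "m \<le> k0" for m r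
    using k0[OF that] R_Wc[of r m] F_intros(4) vec.subspace_0[OF subspace_R] by auto
  show ?thesis
  proof (cases "m \<le> k0")
    case False
    hence "k0 \<le> m" by simp
    thus ?thesis using assms
    proof (induction m arbitrary: r rule: int_ge_induct)
      case base
      show ?case by (rule triv) simp
    next
      case (step m)
      have IH: "(\<forall>x\<in>Wc m. \<exists>f\<in>F p \<inter> Wc m. x - f \<in> R (r - 1) m) \<and> F p \<inter> R (r - 1) m \<subseteq> {0}"
        using step by auto
      have sub: "R (r - 1) m \<subseteq> R r (m + 1)" by (rule R_mono[of 1]) auto
      have base: "cF r \<inter> Wc (m + 1) \<subseteq> R r (m + 1)" by (rule R_incl[of 0]) auto
      have r: "m + 1 + 1 - p = r" using step by simp
      show ?case
      proof (intro conjI ballI subsetI)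
        fix x assume "x \<in> Wc (m + 1)"
        then obtain f g w where *: "f \<in> F p" "f \<in> Wc (m + 1)" "g \<in> cF (m + 1 + 1 - p)"
          "g \<in> Wc (m + 1)" "w \<in> Wc (m + 1 - 1)" "x = f + g + w"
          by (rule opposed_split)
        then obtain f' where f': "f' \<in> F p" "f' \<in> Wc m" "w - f' \<in> R (r - 1) m" using IH by auto
        have "f' \<in> Wc (m + 1)" using f'(2) Wc_mono[of m "m + 1"] by auto
        moreover have "x - (f + f') = g + (w - f')" using * by simp
        moreover have "g + (w - f') \<in> R r (m + 1)"
          using base sub * f' r by (intro vec.subspace_add[OF subspace_R]) auto
        ultimately show "\<exists>f\<in>F p \<inter> Wc (m + 1). x - f \<in> R r (m + 1)"
          using * f' by (intro bexI[of _ "f + f'"]) (auto intro: F_intros W_intros)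
      next
        fix x assume x: "x \<in> F p \<inter> R r (m + 1)"
        then obtain y z where yz: "y \<in> cF r" "y \<in> Wc (m + 1)" "z \<in> R (r - 1) m" "x = y + z"
          using R_split[of x r "m + 1"] by auto
        have z: "z \<in> Wc m" using R_Wc yz by auto
        have "x \<in> Wc (m + 1 - 1)"
        proof (rule opposed_disjoint)
          show "x \<in> F p" using x by simp
          show "x \<in> Wc (m + 1)" using x R_Wc by blast
          show "y \<in> cF r" "y \<in> Wc (m + 1)" by fact+
        qed (use yz z step in auto)
        hence "y \<in> Wc m" using yz(4) z W_intros(2)[of x m z] by simp
        hence "y \<in> R (r - 1) m"
          using R_incl[of 0 "r - 1" r m m] yz(1) by auto
        hence "x \<in> R (r - 1) m" using yz vec.subspace_add[OF subspace_R] by blast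
        thus "x \<in> {0}" using IH x by blast
      qed
    qed
  qed (rule triv)
qed

text \<open>Deligne's formula. The corrections, usually written as the sum over
  \<open>j >= 1\<close> of \<open>cF (q - j)\<close> intersected with
  \<open>Wc (p + q - j - 1)\<close>, are \<open>R (q - 1) (p + q - 2)\<close>.\<close>

definition I :: "int \<times> int \<Rightarrow> (complex ^ 'n) set"
  where "I = (\<lambda>(p, q). F p \<inter> Wc (p + q) \<inter> vec.span (cF q \<inter> Wc (p + q) \<union> R (q - 1) (p + q - 2)))"

lemma I_F: "x \<in> I (p, q) \<Longrightarrow> x \<in> F p" and I_Wc: "x \<in> I (p, q) \<Longrightarrow> x \<in> Wc (p + q)"
  by (auto simp: I_def)

lemma I_cF:
  assumes "x \<in> I (p, q)"
  obtains y z where "y \<in> cF q" "y \<in> Wc (p + q)" "z \<in> R (q - 1) (p + q - 2)" "x = y + z"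
proof -
  have "x \<in> vec.span (cF q \<inter> Wc (p + q) \<union> R (q - 1) (p + q - 2))"
    using assms by (simp add: I_def)
  then obtain y z where "y \<in> cF q \<inter> Wc (p + q)" "z \<in> R (q - 1) (p + q - 2)" "x = y + z"
    by (rule in_spanUnE2) (auto intro: vec.subspace_inter subspace_cF subspace_Wc subspace_R)
  thus thesis using that by blast
qed

lemma I_I:
  assumes "x \<in> F p" "x \<in> Wc (p + q)" "y \<in> cF q" "y \<in> Wc (p + q)" "z \<in> R (q - 1) (p + q - 2)" "x = y + z"
  shows "x \<in> I (p, q)"
  using assms span_UnI[of y "cF q \<inter> Wc (p + q)" z] by (auto simp: I_def)

lemma subspace_I: "vec.subspace (I i)"
  by (cases i) (auto simp: I_def intro!: vec.subspace_inter subspace_F subspace_Wc)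

text \<open>Injectivity of \<open>I (p, q)\<close> into the graded piece: for a vector of weight
  below \<open>p + q\<close>, both terms of Deligne's formula fall into
  \<open>R q (p + q - 1)\<close>, which is a complement of \<open>F p\<close> in that
  weight.\<close>

lemma I_zero: assumes x: "x \<in> I (p, q)" and w: "x \<in> Wc (p + q - 1)" shows "x = 0"
proof -
  obtain y z where yz: "y \<in> cF q" "y \<in> Wc (p + q)" "z \<in> R (q - 1) (p + q - 2)" "x = y + z"
    using I_cF[OF x] .
  have "z \<in> Wc (p + q - 1)" using yz(3) R_Wc[of "q - 1" "p + q - 2"] Wc_mono[of "p + q - 2" "p + q - 1"] by auto
  hence "y \<in> Wc (p + q - 1)" using yz(4) w W_intros(2)[of x _ z] by simp
  hence "y \<in> R q (p + q - 1)" using yz(1) R_incl[of 0 q q "p + q - 1" "p + q - 1"] by auto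
  moreover have "z \<in> R q (p + q - 1)" using yz(3) R_mono[of 1 q "q - 1" "p + q - 2" "p + q - 1"] by auto
  ultimately have "x \<in> R q (p + q - 1)" using yz(4) vec.subspace_add[OF subspace_R] by blast
  thus ?thesis using I_F[OF x] F_R_complement[of p q "p + q - 1"] by auto
qed

text \<open>Every class of type \<open>(p, q)\<close> has a representative in
  \<open>I (p, q)\<close>. The discrepancy \<open>f - g\<close> is cut into a part \<open>f1\<close>
  of \<open>F p\<close> and a part of \<open>R q (p + q - 1)\<close>; by \<open>R_split\<close> the
  latter is a vector of \<open>cF q\<close>, which is added to \<open>g\<close>, and a correction
  permitted by Deligne's formula.\<close>

lemma I_lift:
  assumes "f \<in> F p" "f \<in> Wc (p + q)" "g \<in> cF q" "g \<in> Wc (p + q)" "f - g \<in> Wc (p + q - 1)"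
  obtains x where "x \<in> I (p, q)" "x - f \<in> F p" "x - f \<in> Wc (p + q - 1)"
proof -
  obtain f1 where f1: "f1 \<in> F p" "f1 \<in> Wc (p + q - 1)" and r: "f - g - f1 \<in> R q (p + q - 1)"
    using F_R_complement[of p q "p + q - 1"] assms(5) by auto
  obtain y z where yz: "y \<in> cF q" "y \<in> Wc (p + q - 1)" "z \<in> R (q - 1) (p + q - 1 - 1)"
    "f - g - f1 = y + z" using R_split[OF r] .
  have "f - f1 \<in> I (p, q)"
  proof (rule I_I)
    show "f - f1 \<in> F p" using assms f1 by (intro F_intros)
    show "f - f1 \<in> Wc (p + q)" using assms f1 by (intro W_intros) (auto intro: Wc_pred)
    show "g + y \<in> cF q" using assms yz by (intro cF_intros)
    show "g + y \<in> Wc (p + q)" using assms yz by (intro W_intros) (auto intro: Wc_pred)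
    show "z \<in> R (q - 1) (p + q - 2)" using yz(3) by (simp add: algebra_simps)
    show "f - f1 = g + y + z" using yz(4) by (simp add: algebra_simps)
  qed
  moreover have "f - f1 - f = - f1" by simp
  ultimately show thesis
    using that f1 vec.subspace_neg[OF subspace_F] vec.subspace_neg[OF subspace_Wc] by metis
qed

end

section \<open>The summands generate both filtrations and are independent\<close>

lemma Union_pairs: "\<Union>{A (a, b) |a b. P a b} = (\<Union>i\<in>{(a, b). P a b}. A i)"
  by blast

context weight_hodge begin

text \<open>Opposedness for \<open>p + 1\<close> removes a vector \<open>f\<close> of
  \<open>F (p + 1)\<close> from \<open>x\<close>. What is left lies in \<open>F p\<close> and is
  congruent to a vector of \<open>cF (k - p)\<close>, so it has type \<open>(p, k - p)\<close> and
  is lifted by \<open>I_lift\<close>.\<close>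

lemma F_W_step:
  assumes "x \<in> F p" "x \<in> Wc k"
  obtains a f w where "a \<in> I (p, k - p)" "f \<in> F (p + 1)" "f \<in> Wc k" "w \<in> F p" "w \<in> Wc (k - 1)"
    "x = a + f + w"
proof -
  obtain f g w where *: "f \<in> F (p + 1)" "f \<in> Wc k" "g \<in> cF (k + 1 - (p + 1))" "g \<in> Wc k"
    "w \<in> Wc (k - 1)" "x = f + g + w" using opposed_split[OF assms(2), of "p + 1"] .
  have f: "f \<in> F p" using *(1) F_anti[of p "p + 1"] by auto
  obtain a where a: "a \<in> I (p, k - p)" "a - (x - f) \<in> F p" "a - (x - f) \<in> Wc (p + (k - p) - 1)"
  proof (rule I_lift[of "x - f" p "k - p" g])
    show "x - f \<in> F p" "x - f \<in> Wc (p + (k - p))" using assms f *(2) by (auto intro: F_intros W_intros)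
    show "g \<in> cF (k - p)" "g \<in> Wc (p + (k - p))" using *(3,4) by auto
    show "x - f - g \<in> Wc (p + (k - p) - 1)" using *(5,6) by simp
  qed auto
  show thesis
  proof (rule that[of a f "- (a - (x - f))"])
    show "- (a - (x - f)) \<in> F p" using a(2) by (rule vec.subspace_neg[OF subspace_F])
    show "- (a - (x - f)) \<in> Wc (k - 1)" using vec.subspace_neg[OF subspace_Wc a(3)] by simp
  qed (use a * in auto)
qed

text \<open>Double induction, upwards over the weight and downwards over \<open>p\<close>: of the
  two remainders in \<open>F_W_step\<close> one has a larger \<open>p\<close> and the other a
  smaller weight.\<close>

lemma F_W_subset_span: "F p \<inter> Wc k \<subseteq> vec.span (\<Union>i\<in>{(a, b). p \<le> a \<and> a + b \<le> k}. I i)"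
proof -
  let ?T = "\<lambda>p k. vec.span (\<Union>i\<in>{(a, b). p \<le> a \<and> a + b \<le> k}. I i)"
  obtain k0 where k0: "\<And>k. k \<le> k0 \<Longrightarrow> Wc k = {0}" using Wc_bot by blast
  obtain p0 where p0: "\<And>p. p0 \<le> p \<Longrightarrow> F p = {0}" using F_bot by blast
  have triv: "F p \<inter> Wc k \<subseteq> ?T p k" if "k \<le> k0 \<or> p0 \<le> p" for k p
    using that k0 p0 vec.span_zero by auto
  show ?thesis
  proof (cases "k \<le> k0")
    case False
    hence "k0 \<le> k" by simp
    thus ?thesis
    proof (induction k arbitrary: p rule: int_ge_induct)
      case base
      show ?case by (rule triv) simp
    next
      case (step k)
      show ?case
      proof (cases "p0 \<le> p")
        case False
        hence "p \<le> p0" by simp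
        thus ?thesis
        proof (induction p rule: int_le_induct)
          case base
          show ?case by (rule triv) simp
        next
          case (step p)
          show ?case
          proof
            fix x assume "x \<in> F (p - 1) \<inter> Wc (k + 1)"
            then obtain a f w where *: "a \<in> I (p - 1, k + 1 - (p - 1))" "f \<in> F p" "f \<in> Wc (k + 1)"
              "w \<in> F (p - 1)" "w \<in> Wc k" "x = a + f + w"
              using F_W_step[of x "p - 1" "k + 1"] by auto
            have "?T p (k + 1) \<subseteq> ?T (p - 1) (k + 1)" "?T (p - 1) k \<subseteq> ?T (p - 1) (k + 1)"
              by (rule vec.span_mono, rule UN_mono, (auto)[2])+
            moreover have "f \<in> ?T p (k + 1)" using step.IH * by blast
            moreover have "w \<in> ?T (p - 1) k" using \<open>\<And>p. F p \<inter> Wc k \<subseteq> ?T p k\<close> * by blast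
            moreover have "a \<in> ?T (p - 1) (k + 1)" by (rule vec.span_base) (use * in force)
            ultimately show "x \<in> ?T (p - 1) (k + 1)"
              unfolding *(6) by (intro vec.span_add) auto
          qed
        qed
      qed (rule triv, simp)
    qed
  qed (rule triv, simp)
qed

lemma I_subset_F_W: "p \<le> a \<Longrightarrow> a + b \<le> k \<Longrightarrow> I (a, b) \<subseteq> F p \<inter> Wc k"
  using I_F I_Wc F_anti[of p a] Wc_mono[of "a + b" k] by blast

lemma F_W_eq: "F p \<inter> Wc k = vec.span (\<Union>i\<in>{(a, b). p \<le> a \<and> a + b \<le> k}. I i)"
proof
  show "vec.span (\<Union>i\<in>{(a, b). p \<le> a \<and> a + b \<le> k}. I i) \<subseteq> F p \<inter> Wc k"
  proof (rule vec.span_minimal[OF UN_least])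
    fix i :: "int \<times> int" assume "i \<in> {(a, b). p \<le> a \<and> a + b \<le> k}"
    then obtain a b where "i = (a, b)" "p \<le> a" "a + b \<le> k" by blast
    thus "I i \<subseteq> F p \<inter> Wc k" using I_subset_F_W by blast
  qed (auto intro: vec.subspace_inter subspace_F subspace_Wc)
qed (rule F_W_subset_span)

lemma F_eq: "F p = vec.span (\<Union>i\<in>{(a, b). p \<le> a}. I i)"
proof
  obtain k1 where "Wc k1 = UNIV" using Wc_top by blast
  hence "F p = F p \<inter> Wc k1" by simp
  also have "\<dots> \<subseteq> vec.span (\<Union>i\<in>{(a, b). p \<le> a}. I i)"
    unfolding F_W_eq by (rule vec.span_mono) auto
  finally show "F p \<subseteq> vec.span (\<Union>i\<in>{(a, b). p \<le> a}. I i)" .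
  show "vec.span (\<Union>i\<in>{(a, b). p \<le> a}. I i) \<subseteq> F p"
  proof (rule vec.span_minimal[OF UN_least])
    fix i :: "int \<times> int" assume "i \<in> {(a, b). p \<le> a}"
    then obtain a b where "i = (a, b)" "p \<le> a" by blast
    thus "I i \<subseteq> F p" using I_F F_anti[of p a] by blast
  qed (rule subspace_F)
qed

lemma Wc_eq: "Wc k = vec.span (\<Union>i\<in>{(a, b). a + b \<le> k}. I i)"
proof
  obtain p where "F p = UNIV" using F_top by blast
  hence "Wc k = F p \<inter> Wc k" by simp
  also have "\<dots> \<subseteq> vec.span (\<Union>i\<in>{(a, b). a + b \<le> k}. I i)"
    unfolding F_W_eq by (rule vec.span_mono) auto
  finally show "Wc k \<subseteq> vec.span (\<Union>i\<in>{(a, b). a + b \<le> k}. I i)" .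
  show "vec.span (\<Union>i\<in>{(a, b). a + b \<le> k}. I i) \<subseteq> Wc k"
  proof (rule vec.span_minimal[OF UN_least])
    fix i :: "int \<times> int" assume "i \<in> {(a, b). a + b \<le> k}"
    then obtain a b where "i = (a, b)" "a + b \<le> k" by blast
    thus "I i \<subseteq> Wc k" using I_Wc Wc_mono[of "a + b" k] by blast
  qed (rule subspace_Wc)
qed

text \<open>In a nontrivial relation take, among the nonzero terms of highest weight
  \<open>k\<close>, the one with the least \<open>p\<close>. Modulo lower weight it lies in
  \<open>cF q\<close>, while the other terms of weight \<open>k\<close> lie in
  \<open>F (p + 1)\<close>. As \<open>(p + 1) + q = k + 1\<close>, opposedness pushes them into
  \<open>Wc (k - 1)\<close>, hence also the chosen term, and \<open>I_zero\<close> makes it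
  vanish.\<close>

lemma I_independent:
  assumes c: "\<And>i. c i \<in> I i" and fin: "finite {i. c i \<noteq> 0}" and sum: "(\<Sum>i | c i \<noteq> 0. c i) = 0"
  shows "c = (\<lambda>_. 0)"
proof (rule ccontr)
  define S where "S = {i. c i \<noteq> 0}"
  assume "c \<noteq> (\<lambda>_. 0)"
  hence ne: "S \<noteq> {}" by (auto simp: S_def)
  have fS: "finite S" using fin by (simp add: S_def)
  define k where "k = Max ((\<lambda>(a, b). a + b) ` S)"
  have k: "a + b \<le> k" if "(a, b) \<in> S" for a b
    unfolding k_def using that fS by (intro Max_ge) force+
  define S' where "S' = {(a, b) \<in> S. a + b = k}"
  have "k \<in> (\<lambda>(a, b). a + b) ` S" unfolding k_def using fS ne by (intro Max_in) auto
  hence ne': "S' \<noteq> {}" by (auto simp: S'_def)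
  have fS': "finite S'" using fS by (simp add: S'_def case_prod_unfold)
  define p where "p = Min (fst ` S')"
  have p: "p \<le> a" if "(a, b) \<in> S'" for a b
    unfolding p_def using that fS' by (intro Min_le) force+
  have "p \<in> fst ` S'" unfolding p_def using fS' ne' by (intro Min_in) auto
  then obtain q where pq: "(p, q) \<in> S'" by auto
  have kpq: "k = p + q" using pq by (simp add: S'_def)
  define f where "f = (\<Sum>i\<in>S' - {(p, q)}. c i)"
  define w where "w = (\<Sum>i\<in>S - S'. c i)"
  have "0 = (\<Sum>i\<in>S'. c i) + w"
    unfolding w_def using sum.subset_diff[of S' S c] sum fS by (auto simp: S'_def S_def add.commute)
  also have "(\<Sum>i\<in>S'. c i) = c (p, q) + f"
    unfolding f_def using pq fS' by (simp add: sum.remove)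
  finally have eq: "c (p, q) + f + w = 0" by simp
  have f: "f \<in> F (p + 1) \<inter> Wc k"
    unfolding f_def
  proof (rule vec.subspace_sum)
    fix i assume i: "i \<in> S' - {(p, q)}"
    then obtain a b where ab: "i = (a, b)" "a + b = k" by (auto simp: S'_def)
    hence "a \<noteq> p" using i kpq by auto
    moreover have "p \<le> a" using p i ab by blast
    ultimately show "c i \<in> F (p + 1) \<inter> Wc k" using c[of i] I_subset_F_W[of "p + 1" a b k] ab by auto
  qed (auto intro: vec.subspace_inter subspace_F subspace_Wc)
  have w: "w \<in> Wc (k - 1)" unfolding w_def
  proof (rule vec.subspace_sum[OF subspace_Wc])
    fix i assume i: "i \<in> S - S'"
    obtain a b where ab: "i = (a, b)" by (cases i)
    hence "a + b \<le> k - 1" using i k[of a b] by (auto simp: S'_def)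
    thus "c i \<in> Wc (k - 1)" using c[of i] I_Wc[of "c i" a b] Wc_mono[of "a + b" "k - 1"] ab by auto
  qed
  obtain y z where yz: "y \<in> cF q" "y \<in> Wc (p + q)" "z \<in> R (q - 1) (p + q - 2)" "c (p, q) = y + z"
    using I_cF[OF c] .
  have z: "z \<in> Wc (k - 1)"
    using yz(3) R_Wc[of "q - 1" "p + q - 2"] Wc_mono[of "p + q - 2" "k - 1"] kpq by auto
  have "f \<in> Wc (k - 1)"
  proof (rule opposed_disjoint)
    show "- y \<in> cF q" "- y \<in> Wc k"
      using yz kpq vec.subspace_neg[OF subspace_cF] vec.subspace_neg[OF subspace_Wc] by auto
    have "f - - y = - (w + z)" using eq yz(4) by (simp add: algebra_simps eq_neg_iff_add_eq_0)
    thus "f - - y \<in> Wc (k - 1)" using vec.subspace_neg[OF subspace_Wc W_intros(1)[OF w z]] by simp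
  qed (use f kpq in auto)
  moreover have "c (p, q) = - (f + w)" using eq by (simp add: eq_neg_iff_add_eq_0 algebra_simps)
  ultimately have "c (p, q) \<in> Wc (p + q - 1)"
    using vec.subspace_neg[OF subspace_Wc W_intros(1)[OF _ w]] kpq by simp
  hence "c (p, q) = 0" using I_zero[OF c] by simp
  thus False using pq by (simp add: S'_def S_def)
qed

sublocale direct_family I
proof (rule direct_familyI[OF subspace_I _ I_independent])
  obtain p where "F p = UNIV" using F_top by blast
  hence "UNIV \<subseteq> vec.span (\<Union>i\<in>{(a, b). p \<le> a}. I i)" using F_eq by simp
  also have "\<dots> \<subseteq> vec.span (\<Union>i. I i)" by (rule vec.span_mono) auto
  finally show "vec.span (\<Union>i. I i) = UNIV" by blast
qed auto

section \<open>Conjugation of the bigrading, and its uniqueness\<close>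

lemma span_pair_Un:
  "vec.span (\<Union>i\<in>{(a, b). P a b \<or> P' a b}. I i)
    = vec.span ((\<Union>i\<in>{(a, b). P a b}. I i) \<union> (\<Union>i\<in>{(a, b). P' a b}. I i))"
  by (rule arg_cong[of _ _ vec.span]) blast

text \<open>Expresses the conjugate of the last factor of Deligne's formula by the summands
  themselves, over an index set that does not depend on \<open>F\<close>. The congruence between
  conjugate summands needs this, and so does the constancy of the dimension of that factor in a
  family.\<close>

lemma vcnj_correction_eq:
  "vcnj ` vec.span (cF q \<inter> Wc (p + q) \<union> R (q - 1) (p + q - 2)) =
   vec.span (\<Union>i\<in>{(a, b). q \<le> a \<and> a + b \<le> p + q \<or> a < q \<and> b < p}. I i)" (is "?L = vec.span (\<Union>i\<in>?S. I i)")
proof -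
  have FW: "vcnj ` (cF r \<inter> Wc m) = F r \<inter> Wc m" for r m
    by (auto simp: mem_vcnj_image vcnj_Wc)
  have L: "?L = vec.span (F q \<inter> Wc (p + q) \<union>
      vec.span (\<Union>j. F (q - 1 - int j) \<inter> Wc (p + q - 2 - int j)))"
    unfolding vcnj_span image_Un FW R_def image_UN ..
  show ?thesis
  proof
    have sub: "F r \<inter> Wc m \<subseteq> vec.span (\<Union>i\<in>?S. I i)"
      if "\<And>a b. r \<le> a \<Longrightarrow> a + b \<le> m \<Longrightarrow> q \<le> a \<and> a + b \<le> p + q \<or> a < q \<and> b < p" for r m
      unfolding F_W_eq by (rule vec.span_mono, rule UN_mono) (use that in auto)
    have "F (q - 1 - int j) \<inter> Wc (p + q - 2 - int j) \<subseteq> vec.span (\<Union>i\<in>?S. I i)" for j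
      by (rule sub) auto
    moreover have "F q \<inter> Wc (p + q) \<subseteq> vec.span (\<Union>i\<in>?S. I i)"
      by (rule sub) auto
    ultimately show "?L \<subseteq> vec.span (\<Union>i\<in>?S. I i)"
      unfolding L by (intro vec.span_minimal Un_least UN_least vec.subspace_span)
    show "vec.span (\<Union>i\<in>?S. I i) \<subseteq> ?L"
    proof (rule vec.span_minimal[OF UN_least])
      fix i assume "i \<in> ?S"
      then obtain a b where ab: "i = (a, b)" "q \<le> a \<and> a + b \<le> p + q \<or> a < q \<and> b < p" by blast
      show "I i \<subseteq> ?L"
      proof (cases "q \<le> a")
        case True
        hence "I i \<subseteq> F q \<inter> Wc (p + q)" using ab I_subset_F_W by auto
        thus ?thesis unfolding L using vec.span_superset by blast
      next
        case False
        \<comment> \<open>A pair with \<open>a < q\<close> and \<open>b < p\<close> occurs in the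
          term \<open>j = q - 1 - a\<close> of the sum.\<close>
        hence "q - 1 - int (nat (q - 1 - a)) = a" "p + q - 2 - int (nat (q - 1 - a)) = p - 1 + a"
          by auto
        hence "I i \<subseteq> F (q - 1 - int (nat (q - 1 - a))) \<inter> Wc (p + q - 2 - int (nat (q - 1 - a)))"
          using ab False I_subset_F_W[of a a b "p - 1 + a"] by (simp only:) auto
        also have "\<dots> \<subseteq> (\<Union>j. F (q - 1 - int j) \<inter> Wc (p + q - 2 - int j))"
          by (rule UN_upper) simp
        also have "\<dots> \<subseteq> ?L" unfolding L
          by (rule order.trans[OF vec.span_superset order.trans[OF Un_upper2 vec.span_superset]])
        finally show ?thesis .
      qed
    qed (simp add: subspace_vcnj_image)
  qed
qed

text \<open>The conjugate of Deligne's formula splits the vector as \<open>u + w\<close> with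
  \<open>w\<close> in the lower summands and \<open>u\<close> in \<open>F q\<close> and
  \<open>Wc (p + q)\<close>. That \<open>u\<close> also satisfies the last condition for
  \<open>I (q, p)\<close> holds because both \<open>x'\<close> and \<open>w\<close> do:
  \<open>x'\<close> lies in \<open>cF p\<close>, and the lower summands lie in
  \<open>R (p - 1) (p + q - 2)\<close>.\<close>

lemma vcnj_I_subset:
  "vcnj ` I (p, q) \<subseteq> vec.span (I (q, p) \<union> (\<Union>i\<in>{(a, b). a < q \<and> b < p}. I i))"
proof
  fix x' assume "x' \<in> vcnj ` I (p, q)"
  then obtain x where x: "x \<in> I (p, q)" "x' = vcnj x" by blast
  let ?A = "\<Union>i\<in>{(a, b). q \<le> a \<and> a + b \<le> p + q}. I i"
  let ?J = "\<Union>i\<in>{(a, b). a < q \<and> b < p}. I i"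
  have "x' \<in> vcnj ` vec.span (cF q \<inter> Wc (p + q) \<union> R (q - 1) (p + q - 2))"
    using x by (simp add: I_def)
  hence "x' \<in> vec.span (?A \<union> ?J)" unfolding vcnj_correction_eq span_pair_Un .
  then obtain u w where u: "u \<in> vec.span ?A" and w: "w \<in> vec.span ?J" and x': "x' = u + w"
    unfolding vec.span_Un by blast
  have "?J \<subseteq> vcnj ` vec.span (F p \<inter> Wc (p + q) \<union> vcnj ` R (p - 1) (p + q - 2))"
    (is "_ \<subseteq> vcnj ` ?P")
  proof safe
    fix a b v assume ab: "a < q" "b < p" and v: "v \<in> I (a, b)"
    obtain y z where yz: "y \<in> cF b" "y \<in> Wc (a + b)" "z \<in> R (b - 1) (a + b - 2)" "v = y + z"
      using I_cF[OF v] .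
    have "y \<in> R (p - 1) (p + q - 2)"
      using R_incl[of "p - 1 - b" "p - 1" b "a + b" "p + q - 2"] ab yz by auto
    moreover have "z \<in> R (p - 1) (p + q - 2)"
      using R_mono[of "p - b" "p - 1" "b - 1" "a + b - 2" "p + q - 2"] ab yz by auto
    ultimately have "v \<in> R (p - 1) (p + q - 2)" using yz vec.subspace_add[OF subspace_R] by blast
    thus "v \<in> vcnj ` ?P" by (auto simp: mem_vcnj_image intro!: vec.span_base)
  qed
  hence "vec.span ?J \<subseteq> vcnj ` ?P"
    by (rule vec.span_minimal) (simp add: subspace_vcnj_image)
  hence "w \<in> vcnj ` ?P" using w by blast
  moreover have "x' \<in> vcnj ` ?P"
    using x I_F I_Wc by (auto simp: mem_vcnj_image intro!: vec.span_base)
  ultimately have "u \<in> vcnj ` ?P"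
    using x' vec.subspace_diff[of "vcnj ` ?P" x' w] by (simp add: subspace_vcnj_image)
  hence "u \<in> vec.span (vcnj ` (F p \<inter> Wc (p + q)) \<union> R (p - 1) (p + q - 2))"
    unfolding vcnj_span image_Un by (simp add: image_image)
  also have "vcnj ` (F p \<inter> Wc (p + q)) = cF p \<inter> Wc (q + p)"
    by (auto simp: mem_vcnj_image vcnj_Wc add.commute)
  finally have "u \<in> I (q, p)"
    using u unfolding F_W_eq[symmetric] by (simp add: I_def add.commute)
  thus "x' \<in> vec.span (I (q, p) \<union> ?J)"
    unfolding x' vec.span_Un using w vec.span_base by blast
qed

text \<open>For the second inclusion the first one, with \<open>p\<close> and \<open>q\<close>
  exchanged, is conjugated. The conjugated lower summands which then appear are treated by the first
  inclusion again: exchanging the indices turns pairs below \<open>(p, q)\<close> into pairs below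
  \<open>(q, p)\<close>.\<close>

lemma span_vcnj_I:
  "vec.span (vcnj ` I (p, q) \<union> (\<Union>i\<in>{(a, b). a < q \<and> b < p}. I i)) =
   vec.span (I (q, p) \<union> (\<Union>i\<in>{(a, b). a < q \<and> b < p}. I i))" (is "vec.span (_ \<union> ?J) = ?R")
proof
  show "vec.span (vcnj ` I (p, q) \<union> ?J) \<subseteq> ?R"
  proof (rule vec.span_minimal[OF Un_least[OF vcnj_I_subset]])
    show "?J \<subseteq> ?R"
      by (rule order.trans[OF Un_upper2 vec.span_superset])
  qed (rule vec.subspace_span)
  have "I (q, p) = vcnj ` vcnj ` I (q, p)" by (simp add: image_image)
  also have "\<dots> \<subseteq> vcnj ` vec.span (I (p, q) \<union> (\<Union>i\<in>{(a, b). a < p \<and> b < q}. I i))"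
    using vcnj_I_subset[of q p] by (rule image_mono)
  also have "\<dots> = vec.span (vcnj ` I (p, q) \<union> (\<Union>i\<in>{(a, b). a < p \<and> b < q}. vcnj ` I i))"
    by (simp add: vcnj_span image_Un image_UN)
  also have "\<dots> \<subseteq> vec.span (vcnj ` I (p, q) \<union> ?J)"
  proof (rule vec.span_minimal)
    have "vcnj ` I i \<subseteq> vec.span (vcnj ` I (p, q) \<union> ?J)" if i: "i \<in> {(a, b). a < p \<and> b < q}" for i
    proof -
      obtain a b where ab: "i = (a, b)" "a < p" "b < q" using i by blast
      have "vcnj ` I i \<subseteq> vec.span (I (b, a) \<union> (\<Union>i\<in>{(a', b'). a' < b \<and> b' < a}. I i))"
        unfolding ab by (rule vcnj_I_subset)
      also have "\<dots> \<subseteq> vec.span (vcnj ` I (p, q) \<union> ?J)"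
      proof (rule vec.span_mono)
        have "{(a', b'). a' < b \<and> b' < a} \<subseteq> {(a, b). a < q \<and> b < p}" "(b, a) \<in> {(a, b). a < q \<and> b < p}"
          using ab by auto
        thus "I (b, a) \<union> (\<Union>i\<in>{(a', b'). a' < b \<and> b' < a}. I i) \<subseteq> vcnj ` I (p, q) \<union> ?J"
          by blast
      qed
      finally show ?thesis .
    qed
    thus "vcnj ` I (p, q) \<union> (\<Union>i\<in>{(a, b). a < p \<and> b < q}. vcnj ` I i)
        \<subseteq> vec.span (vcnj ` I (p, q) \<union> ?J)"
      using vec.span_superset[of "vcnj ` I (p, q) \<union> ?J"] by blast
  qed simp
  finally show "?R \<subseteq> vec.span (vcnj ` I (p, q) \<union> ?J)"
    by (intro vec.span_minimal[OF Un_least] vec.subspace_span order.trans[OF Un_upper2 vec.span_superset])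
qed

lemma is_deligne_bigrading_I: "is_deligne_bigrading W F I"
  unfolding is_deligne_bigrading_def Union_pairs[of I]
  using subspace_I ex1 F_eq Wc_eq span_vcnj_I by blast

text \<open>Induction over the weight: the conjugation congruence and the inclusion in lower weights
  put \<open>I' (p, q)\<close> inside Deligne's formula. Two direct decompositions of the same
  space, one contained termwise in the other, are equal.\<close>

lemma deligne_bigrading_unique:
  assumes "is_deligne_bigrading W F I'"
  shows "I' = I"
proof -
  have sub: "vec.subspace (I' i)" and dec: "\<exists>!c. is_decomposition I' v c"
    and F': "F p = vec.span (\<Union>i\<in>{(a, b). p \<le> a}. I' i)"
    and W': "Wc k = vec.span (\<Union>i\<in>{(a, b). a + b \<le> k}. I' i)"
    and C: "vec.span (vcnj ` I' (p, q) \<union> (\<Union>i\<in>{(a, b). a < q \<and> b < p}. I' i)) =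
           vec.span (I' (q, p) \<union> (\<Union>i\<in>{(a, b). a < q \<and> b < p}. I' i))" for i v p q k
    using assms unfolding is_deligne_bigrading_def Union_pairs[of I'] by blast+
  interpret I': direct_family I' by unfold_locales (fact sub dec)+
  have inF: "I' (p, q) \<subseteq> F p" and inW: "I' (p, q) \<subseteq> Wc (p + q)" for p q
    unfolding F' W' by (rule subsetI, rule vec.span_base, blast)+
  obtain k0 where k0: "\<And>k. k \<le> k0 \<Longrightarrow> Wc k = {0}" using Wc_bot by blast
  have le: "I' (p, q) \<subseteq> I (p, q)" for p q
  proof (induction "nat (p + q - k0)" arbitrary: p q rule: less_induct)
    case less
    show ?case
    proof (cases "p + q \<le> k0")
      case True
      thus ?thesis using inW[of p q] k0[OF True] zero_in[of "(p, q)"] by auto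
    next
      case False
      let ?J = "\<Union>i\<in>{(a, b). a < p \<and> b < q}. I' i"
      have "?J \<subseteq> R (q - 1) (p + q - 2)"
      proof safe
        fix a b v assume ab: "a < p" "b < q" and v: "v \<in> I' (a, b)"
        have v: "v \<in> I (a, b)" using less[of a b] ab False v by auto
        obtain y z where yz: "y \<in> cF b" "y \<in> Wc (a + b)" "z \<in> R (b - 1) (a + b - 2)" "v = y + z"
          using I_cF[OF v] .
        have "y \<in> R (q - 1) (p + q - 2)"
          using R_incl[of "q - 1 - b" "q - 1" b "a + b" "p + q - 2"] ab yz by auto
        moreover have "z \<in> R (q - 1) (p + q - 2)"
          using R_mono[of "q - b" "q - 1" "b - 1" "a + b - 2" "p + q - 2"] ab yz by auto
        ultimately show "v \<in> R (q - 1) (p + q - 2)" using yz vec.subspace_add[OF subspace_R] by blast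
      qed
      moreover have "vcnj ` I' (q, p) \<subseteq> cF q \<inter> Wc (p + q)"
        using inF[of q p] inW[of q p] by (auto simp: vcnj_Wc add.commute)
      ultimately have "vec.span (vcnj ` I' (q, p) \<union> ?J)
          \<subseteq> vec.span (cF q \<inter> Wc (p + q) \<union> R (q - 1) (p + q - 2))"
        by (intro vec.span_mono) blast
      moreover have "I' (p, q) \<subseteq> vec.span (vcnj ` I' (q, p) \<union> ?J)"
        unfolding C by (auto intro: vec.span_base)
      ultimately show ?thesis using inF[of p q] inW[of p q] by (auto simp: I_def)
    qed
  qed
  show ?thesis
  proof
    fix i :: "int \<times> int"
    have "I i \<subseteq> I' i"
    proof
      fix x assume x: "x \<in> I i"
      have "is_decomposition I x (\<lambda>j. component I' j x)"
        using I'.decomposition[of x] le unfolding is_decomposition_def by (metis subsetD surj_pair)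
      hence "component I i x = component I' i x" by (rule comp_eq)
      thus "x \<in> I' i" using comp_same[OF x, of i] I'.comp_in[of i x] by simp
    qed
    thus "I' i = I i" using le by (cases i) auto
  qed
qed

lemma deligne_eq: "deligne W F = I"
  unfolding deligne_def using is_deligne_bigrading_I deligne_bigrading_unique by (rule the_equality)

end

section \<open>Calculus of smooth functions\<close>

lemma dir_deriv_eq: "(f has_derivative D) (at z) \<Longrightarrow> dir_deriv a f z = D a"
  by (simp add: dir_deriv_def frechet_derivative_at[symmetric])

lemma has_derivative_dir_deriv:
  "f differentiable at z \<Longrightarrow> (f has_derivative (\<lambda>a. dir_deriv a f z)) (at z)"
  unfolding dir_deriv_def frechet_derivative_works by simp

lemma has_derivative_cong_open:
  assumes "open U" "z \<in> U" "\<And>w. w \<in> U \<Longrightarrow> f w = g w"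
  shows "(f has_derivative D) (at z) \<longleftrightarrow> (g has_derivative D) (at z)"
  using has_derivative_transform_within_open[of f D z UNIV U g]
    has_derivative_transform_within_open[of g D z UNIV U f] assms by auto

lemma dir_deriv_cong:
  assumes "open U" "z \<in> U" "\<And>w. w \<in> U \<Longrightarrow> f w = g w"
  shows "dir_deriv a f z = dir_deriv a g z"
  unfolding dir_deriv_def frechet_derivative_def using has_derivative_cong_open[OF assms] by simp

lemma C_k_on_cong:
  assumes "open U" "\<And>w. w \<in> U \<Longrightarrow> f w = g w"
  shows "C_k_on k U f \<longleftrightarrow> C_k_on k U g"
  using assms(2)
proof (induction k arbitrary: f g)
  case (Suc k)
  have "f differentiable at z \<longleftrightarrow> g differentiable at z" if "z \<in> U" for z
    unfolding differentiable_def using has_derivative_cong_open[OF assms(1) that Suc.prems] by simp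
  moreover have "C_k_on k U (dir_deriv a f) \<longleftrightarrow> C_k_on k U (dir_deriv a g)" for a
    by (rule Suc.IH) (rule dir_deriv_cong[OF assms(1)], use Suc.prems in auto)
  ultimately show ?case by auto
qed (auto cong: continuous_on_cong)

lemma C_k_on_Suc_imp: "C_k_on (Suc k) U f \<Longrightarrow> C_k_on k U f"
proof (induction k arbitrary: f)
  case 0
  thus ?case by (auto intro!: continuous_at_imp_continuous_on differentiable_imp_continuous_within)
qed auto

lemma C_k_on_const: "C_k_on k U (\<lambda>_. c)"
proof (induction k arbitrary: c)
  case (Suc k)
  have "dir_deriv a (\<lambda>_. c) = (\<lambda>_. 0)" for a
    using dir_deriv_eq[OF has_derivative_const] by blast
  thus ?case using Suc by simp
qed simp

lemma C_k_on_add: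
  assumes "open U" "C_k_on k U f" "C_k_on k U g" shows "C_k_on k U (\<lambda>z. f z + g z)"
  using assms(2,3)
proof (induction k arbitrary: f g)
  case (Suc k)
  show ?case unfolding C_k_on.simps
  proof (intro conjI ballI allI)
    fix a
    have "dir_deriv a (\<lambda>z. f z + g z) w = dir_deriv a f w + dir_deriv a g w" if "w \<in> U" for w
      by (rule dir_deriv_eq[OF has_derivative_add[OF has_derivative_dir_deriv has_derivative_dir_deriv]])
        (use Suc.prems that in auto)
    moreover have "C_k_on k U (\<lambda>w. dir_deriv a f w + dir_deriv a g w)"
      using Suc by auto
    ultimately show "C_k_on k U (dir_deriv a (\<lambda>z. f z + g z))"
      using C_k_on_cong[OF assms(1)] by (metis (mono_tags, lifting))
  qed (use Suc.prems in auto)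
qed (auto intro: continuous_intros)

lemma C_k_on_bounded_linear:
  assumes "open U" "bounded_linear L" "C_k_on k U f" shows "C_k_on k U (\<lambda>z. L (f z))"
  using assms(3)
proof (induction k arbitrary: f)
  case 0
  thus ?case using bounded_linear.continuous_on[OF assms(2)] by simp
next
  case (Suc k)
  have d: "((\<lambda>z. L (f z)) has_derivative (\<lambda>a. L (dir_deriv a f w))) (at w)" if "w \<in> U" for w
    by (rule bounded_linear.has_derivative[OF assms(2) has_derivative_dir_deriv])
      (use Suc.prems that in auto)
  have "C_k_on k U (dir_deriv a (\<lambda>z. L (f z)))" for a
    using C_k_on_cong[OF assms(1), of "dir_deriv a (\<lambda>z. L (f z))" "\<lambda>w. L (dir_deriv a f w)" k]
      dir_deriv_eq[OF d] Suc by auto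
  thus ?case using d by (auto simp: differentiable_def)
qed

lemma C_k_on_bounded_bilinear:
  assumes "open U" "bounded_bilinear pr" "C_k_on k U f" "C_k_on k U g"
  shows "C_k_on k U (\<lambda>z. pr (f z) (g z))"
  using assms(3,4)
proof (induction k arbitrary: f g)
  case 0
  thus ?case using bounded_bilinear.continuous_on[OF assms(2)] by simp
next
  case (Suc k)
  have d: "((\<lambda>z. pr (f z) (g z)) has_derivative
      (\<lambda>a. pr (f w) (dir_deriv a g w) + pr (dir_deriv a f w) (g w))) (at w)" if "w \<in> U" for w
    by (rule bounded_bilinear.FDERIV[OF assms(2) has_derivative_dir_deriv has_derivative_dir_deriv])
      (use Suc.prems that in auto)
  have "C_k_on k U (\<lambda>w. pr (f w) (dir_deriv a g w) + pr (dir_deriv a f w) (g w))" for a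
    using Suc C_k_on_Suc_imp[OF Suc.prems(1)] C_k_on_Suc_imp[OF Suc.prems(2)]
    by (intro C_k_on_add[OF assms(1)] Suc.IH) auto
  hence "C_k_on k U (dir_deriv a (\<lambda>z. pr (f z) (g z)))" for a
    using C_k_on_cong[OF assms(1), of "dir_deriv a (\<lambda>z. pr (f z) (g z))"
        "\<lambda>w. pr (f w) (dir_deriv a g w) + pr (dir_deriv a f w) (g w)" k]
      dir_deriv_eq[OF d] by auto
  thus ?case using d by (auto simp: differentiable_def)
qed

lemma C_k_on_inverse:
  fixes f :: "complex \<Rightarrow> complex"
  assumes "open U" "C_k_on k U f" "\<And>z. z \<in> U \<Longrightarrow> f z \<noteq> 0"
  shows "C_k_on k U (\<lambda>z. inverse (f z))"
  using assms(2)
proof (induction k)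
  case 0
  thus ?case using assms(3) by (auto intro!: continuous_intros)
next
  case (Suc k)
  have d: "((\<lambda>z. inverse (f z)) has_derivative
      (\<lambda>a. - (inverse (f w) * dir_deriv a f w * inverse (f w)))) (at w)" if "w \<in> U" for w
    by (rule Deriv.has_derivative_inverse[where f = f and x = w, OF assms(3)[OF that] has_derivative_dir_deriv])
      (use Suc.prems that in auto)
  have i: "C_k_on k U (\<lambda>z. inverse (f z))" using Suc C_k_on_Suc_imp by blast
  have "C_k_on k U (\<lambda>w. - (inverse (f w) * dir_deriv a f w * inverse (f w)))" for a
    by (intro C_k_on_bounded_linear[OF assms(1) bounded_linear_minus[OF bounded_linear_ident]]
        C_k_on_bounded_bilinear[OF assms(1) bounded_bilinear_mult] i)
      (use Suc.prems in auto)
  hence "C_k_on k U (dir_deriv a (\<lambda>z. inverse (f z)))" for a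
    using C_k_on_cong[OF assms(1), of "dir_deriv a (\<lambda>z. inverse (f z))"
        "\<lambda>w. - (inverse (f w) * dir_deriv a f w * inverse (f w))" k] dir_deriv_eq[OF d] by auto
  thus ?case using d by (auto simp: differentiable_def)
qed

lemma C_k_on_local:
  assumes "\<And>z. z \<in> S \<Longrightarrow> \<exists>U. open U \<and> z \<in> U \<and> C_k_on k U f"
  shows "C_k_on k S f"
  using assms
proof (induction k arbitrary: f)
  case 0
  thus ?case unfolding C_k_on.simps
    by (metis continuous_at_imp_continuous_on continuous_on_eq_continuous_at)
next
  case (Suc k)
  show ?case unfolding C_k_on.simps
  proof (intro conjI ballI allI)
    fix z assume "z \<in> S"
    thus "f differentiable at z" using Suc.prems by fastforce
  next
    fix a show "C_k_on k S (dir_deriv a f)"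
      by (rule Suc.IH) (use Suc.prems in fastforce)
  qed
qed

lemma C_k_on_subset: "C_k_on k U f \<Longrightarrow> V \<subseteq> U \<Longrightarrow> C_k_on k V f"
  by (induction k arbitrary: f) (auto intro: continuous_on_subset)

lemma smooth_cong:
  "open U \<Longrightarrow> (\<And>w. w \<in> U \<Longrightarrow> f w = g w) \<Longrightarrow> smooth_fun_on U f \<longleftrightarrow> smooth_fun_on U g"
  unfolding smooth_fun_on_def using C_k_on_cong by blast

lemma smooth_const: "smooth_fun_on U (\<lambda>_. c)"
  by (simp add: smooth_fun_on_def C_k_on_const)

lemma smooth_add:
  "open U \<Longrightarrow> smooth_fun_on U f \<Longrightarrow> smooth_fun_on U g \<Longrightarrow> smooth_fun_on U (\<lambda>z. f z + g z)"
  by (simp add: smooth_fun_on_def C_k_on_add)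

lemma smooth_bounded_linear:
  "open U \<Longrightarrow> bounded_linear L \<Longrightarrow> smooth_fun_on U f \<Longrightarrow> smooth_fun_on U (\<lambda>z. L (f z))"
  by (simp add: smooth_fun_on_def C_k_on_bounded_linear)

lemma smooth_bounded_bilinear:
  "open U \<Longrightarrow> bounded_bilinear pr \<Longrightarrow> smooth_fun_on U f \<Longrightarrow> smooth_fun_on U g \<Longrightarrow>
    smooth_fun_on U (\<lambda>z. pr (f z) (g z))"
  by (simp add: smooth_fun_on_def C_k_on_bounded_bilinear)

lemma smooth_inverse:
  fixes f :: "complex \<Rightarrow> complex"
  shows "open U \<Longrightarrow> smooth_fun_on U f \<Longrightarrow> (\<And>z. z \<in> U \<Longrightarrow> f z \<noteq> 0) \<Longrightarrow>
    smooth_fun_on U (\<lambda>z. inverse (f z))"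
  by (simp add: smooth_fun_on_def C_k_on_inverse)

lemma smooth_local:
  assumes "\<And>z. z \<in> S \<Longrightarrow> \<exists>U. open U \<and> z \<in> U \<and> smooth_fun_on U f"
  shows "smooth_fun_on S f"
  unfolding smooth_fun_on_def
proof
  fix k show "C_k_on k S f"
    by (rule C_k_on_local) (use assms in \<open>unfold smooth_fun_on_def, blast\<close>)
qed

lemma smooth_subset: "smooth_fun_on U f \<Longrightarrow> V \<subseteq> U \<Longrightarrow> smooth_fun_on V f"
  unfolding smooth_fun_on_def by (blast intro: C_k_on_subset)

lemma smooth_dir_deriv: "smooth_fun_on U f \<Longrightarrow> smooth_fun_on U (dir_deriv a f)"
  unfolding smooth_fun_on_def by (metis C_k_on.simps(2))

lemma smooth_differentiable: "smooth_fun_on U f \<Longrightarrow> z \<in> U \<Longrightarrow> f differentiable at z"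
  unfolding smooth_fun_on_def by (metis C_k_on.simps(2))

lemma smooth_continuous_on: "smooth_fun_on U f \<Longrightarrow> continuous_on U f"
  unfolding smooth_fun_on_def by (metis C_k_on.simps(1))

lemma smooth_has_derivative:
  "smooth_fun_on U f \<Longrightarrow> z \<in> U \<Longrightarrow> (f has_derivative (\<lambda>a. dir_deriv a f z)) (at z)"
  by (rule has_derivative_dir_deriv[OF smooth_differentiable])

lemma smooth_sum:
  "open U \<Longrightarrow> (\<And>i. i \<in> J \<Longrightarrow> smooth_fun_on U (f i)) \<Longrightarrow> smooth_fun_on U (\<lambda>z. \<Sum>i\<in>J. f i z)"
  by (induction J rule: infinite_finite_induct) (auto intro: smooth_const smooth_add)

lemma smooth_prod:
  fixes f :: "'i \<Rightarrow> complex \<Rightarrow> complex"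
  shows "open U \<Longrightarrow> (\<And>i. i \<in> J \<Longrightarrow> smooth_fun_on U (f i)) \<Longrightarrow> smooth_fun_on U (\<lambda>z. \<Prod>i\<in>J. f i z)"
  by (induction J rule: infinite_finite_induct)
    (auto intro: smooth_const smooth_bounded_bilinear[OF _ bounded_bilinear_mult])

lemma smooth_mult:
  fixes f g :: "complex \<Rightarrow> complex"
  shows "open U \<Longrightarrow> smooth_fun_on U f \<Longrightarrow> smooth_fun_on U g \<Longrightarrow> smooth_fun_on U (\<lambda>z. f z * g z)"
  by (rule smooth_bounded_bilinear[OF _ bounded_bilinear_mult])

lemma smooth_diff:
  assumes "open U" "smooth_fun_on U f" "smooth_fun_on U g"
  shows "smooth_fun_on U (\<lambda>z. f z - g z)"
  using smooth_add[OF assms(1,2) smooth_bounded_linear[OF assms(1)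
    bounded_linear_minus[OF bounded_linear_ident] assms(3)]] by simp

lemma smooth_holomorphic:
  assumes "open U" "f holomorphic_on U" shows "smooth_fun_on U f"
  unfolding smooth_fun_on_def
proof
  fix k show "C_k_on k U f"
    using assms(2)
  proof (induction k arbitrary: f)
    case 0
    thus ?case by (simp add: holomorphic_on_imp_continuous_on)
  next
    case (Suc k)
    have d: "(f has_derivative (\<lambda>a. a * deriv f w)) (at w)" if "w \<in> U" for w
      using holomorphic_derivI[OF Suc.prems assms(1) that]
      by (simp add: has_field_derivative_def mult.commute[of _ "deriv f w"])
    have "C_k_on k U (\<lambda>w. a * deriv f w)" for a
      by (rule C_k_on_bounded_linear[OF assms(1) bounded_linear_mult_right])
        (rule Suc.IH[OF holomorphic_deriv[OF Suc.prems assms(1)]])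
    hence "C_k_on k U (dir_deriv a f)" for a
      using C_k_on_cong[OF assms(1), of "dir_deriv a f" "\<lambda>w. a * deriv f w" k] dir_deriv_eq[OF d] by auto
    thus ?case using d by (auto simp: differentiable_def)
  qed
qed

section \<open>Smooth vector and matrix valued functions\<close>

lemma bounded_linear_axis: "bounded_linear (axis i :: 'a::real_normed_vector \<Rightarrow> 'a ^ 'n)"
proof (rule bounded_linear_intro[where K = 1])
  fix x :: 'a
  have "(norm (axis i x $ j :: 'a))\<^sup>2 = (if j = i then (norm x)\<^sup>2 else 0)" for j :: 'n
    by (simp add: axis_def)
  thus "norm (axis i x :: 'a ^ 'n) \<le> norm x * 1"
    by (simp add: norm_vec_def L2_set_def)
qed (auto simp: axis_def vec_eq_iff)

lemma smooth_vec_iff: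
  fixes f :: "complex \<Rightarrow> 'a::real_normed_vector ^ 'n"
  assumes "open U"
  shows "smooth_fun_on U f \<longleftrightarrow> (\<forall>i. smooth_fun_on U (\<lambda>z. f z $ i))"
proof
  assume "\<forall>i. smooth_fun_on U (\<lambda>z. f z $ i)"
  hence "smooth_fun_on U (\<lambda>z. \<Sum>i\<in>UNIV. axis i (f z $ i))"
    by (intro smooth_sum[OF assms] smooth_bounded_linear[OF assms bounded_linear_axis]) auto
  moreover have "(\<Sum>i\<in>UNIV. axis i (x $ i)) = x" for x :: "'a ^ 'n"
    by (simp add: vec_eq_iff axis_def)
  ultimately show "smooth_fun_on U f" by simp
qed (auto intro: smooth_bounded_linear[OF assms bounded_linear_vec_nth])

lemma smooth_holomorphic_vec: "open U \<Longrightarrow> holomorphic_vec f U \<Longrightarrow> smooth_fun_on U f"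
  by (simp add: smooth_vec_iff holomorphic_vec_def smooth_holomorphic)

lemma bounded_bilinear_matrix_vector:
  "bounded_bilinear ((*v) :: complex ^ 'n ^ 'm \<Rightarrow> complex ^ 'n \<Rightarrow> complex ^ 'm)"
  unfolding bilinear_conv_bounded_bilinear[symmetric] bilinear_def
  by (auto intro!: linearI simp: vec_eq_iff matrix_vector_mult_def algebra_simps sum.distrib scaleR_sum_right)

lemma bounded_bilinear_matrix_matrix:
  "bounded_bilinear ((**) :: complex ^ 'n ^ 'm \<Rightarrow> complex ^ 'k ^ 'n \<Rightarrow> complex ^ 'k ^ 'm)"
  unfolding bilinear_conv_bounded_bilinear[symmetric] bilinear_def
  by (auto intro!: linearI simp: vec_eq_iff matrix_matrix_mult_def algebra_simps sum.distrib scaleR_sum_right)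

lemma bounded_bilinear_vec_scale:
  "bounded_bilinear ((*s) :: complex \<Rightarrow> complex ^ 'n \<Rightarrow> complex ^ 'n)"
  unfolding bilinear_conv_bounded_bilinear[symmetric] bilinear_def
  by (auto intro!: linearI simp: vec_eq_iff algebra_simps)

lemma bounded_linear_vcnj: "bounded_linear (vcnj :: complex ^ 'n \<Rightarrow> complex ^ 'n)"
  unfolding linear_conv_bounded_linear[symmetric]
  by (auto intro!: linearI simp: vec_eq_iff)

lemma smooth_det:
  fixes M :: "complex \<Rightarrow> complex ^ 'n ^ 'n"
  assumes "open U" "\<And>i j. smooth_fun_on U (\<lambda>z. M z $ i $ j)"
  shows "smooth_fun_on U (\<lambda>z. det (M z))"
  unfolding det_def
  by (intro smooth_sum smooth_mult smooth_const smooth_prod assms)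

lemma matrix_inv_right: "invertible A \<Longrightarrow> A ** matrix_inv A = mat 1"
  and matrix_inv_left: "invertible A \<Longrightarrow> matrix_inv A ** A = mat 1"
  for A :: "'a::semiring_1 ^ 'n ^ 'm"
  unfolding invertible_def matrix_inv_def by (rule someI2_ex; blast)+

lemma matrix_vector_axis: "(A *v axis j 1) $ i = A $ i $ j" for A :: "'a::semiring_1 ^ 'n ^ 'm"
  by (simp add: matrix_vector_mult_def axis_def if_distrib cong: if_cong)

text \<open>By Cramer's rule the entries of the inverse are quotients of determinants.\<close>

lemma smooth_matrix_inv:
  fixes M :: "complex \<Rightarrow> complex ^ 'n ^ 'n"
  assumes U: "open U" and M: "smooth_fun_on U M" and inv: "\<And>z. z \<in> U \<Longrightarrow> invertible (M z)"
  shows "smooth_fun_on U (\<lambda>z. matrix_inv (M z))"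
proof -
  have Mij: "smooth_fun_on U (\<lambda>z. M z $ i $ j)" for i j
    using M by (simp add: smooth_vec_iff[OF U])
  have "smooth_fun_on U (\<lambda>z. matrix_inv (M z) $ i $ j)" for i j
  proof -
    let ?N = "\<lambda>z. \<chi> r s. if s = i then axis j 1 $ r else M z $ r $ s"
    have eq: "matrix_inv (M z) $ i $ j = det (?N z) * inverse (det (M z))" if z: "z \<in> U" for z
    proof -
      have "det (M z) \<noteq> 0" using inv[OF z] by (simp add: invertible_det_nz)
      moreover have "M z *v (matrix_inv (M z) *v axis j 1) = axis j 1"
        using matrix_inv_right[OF inv[OF z]] by (simp add: matrix_vector_mul_assoc)
      ultimately have "matrix_inv (M z) *v axis j 1
          = (\<chi> k. det (\<chi> r s. if s = k then axis j 1 $ r else M z $ r $ s) / det (M z))"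
        using cramer by blast
      moreover have "(matrix_inv (M z) *v axis j 1) $ i = matrix_inv (M z) $ i $ j"
        by (rule matrix_vector_axis)
      ultimately show ?thesis by (simp add: divide_inverse)
    qed
    have "smooth_fun_on U (\<lambda>z. if s = i then axis j 1 $ r else M z $ r $ s)" for r s
      using Mij smooth_const by (cases "s = i") auto
    hence "smooth_fun_on U (\<lambda>z. det (?N z) * inverse (det (M z)))"
      using inv by (intro smooth_mult[OF U] smooth_inverse[OF U] smooth_det[OF U] Mij)
        (auto simp: invertible_det_nz)
    thus ?thesis using smooth_cong[OF U eq] by simp
  qed
  thus ?thesis by (simp add: smooth_vec_iff[OF U])
qed

text \<open>Schwarz's theorem. The second difference of \<open>g\<close> over the parallelogram with
  sides \<open>t a\<close> and \<open>t b\<close> is symmetric in \<open>a\<close> and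
  \<open>b\<close>; two applications of the mean value theorem make it \<open>t * t\<close> times
  either mixed derivative at some nearby point. For small \<open>t\<close>, continuity of the mixed
  derivatives excludes different values at \<open>z\<close>.\<close>

lemma dir_deriv_commute_real:
  fixes g :: "complex \<Rightarrow> real"
  assumes U: "open U" and g: "smooth_fun_on U g" and z: "z \<in> U"
  shows "dir_deriv a (dir_deriv b g) z = dir_deriv b (dir_deriv a g) z"
proof -
  have key: "\<exists>p. dist p z \<le> t * (norm a + norm b) \<and>
      g (z + of_real t * a + of_real t * b) - g (z + of_real t * a) - g (z + of_real t * b) + g z
        = t * t * dir_deriv b (dir_deriv a g) p"
    if t: "0 < t" and ball: "cball z (t * (norm a + norm b)) \<subseteq> U" for t a b
  proof -
    have inU: "z + of_real s * a + of_real r * b \<in> U"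
      and dst: "dist (z + of_real s * a + of_real r * b) z \<le> t * (norm a + norm b)"
      if "0 \<le> s" "s \<le> t" "0 \<le> r" "r \<le> t" for s r
    proof -
      have "dist (z + of_real s * a + of_real r * b) z = norm (of_real s * a + of_real r * b)"
        by (simp add: dist_norm algebra_simps)
      also have "\<dots> \<le> norm (of_real s * a) + norm (of_real r * b)" by (rule norm_triangle_ineq)
      also have "\<dots> = s * norm a + r * norm b" using that by (simp add: norm_mult)
      also have "\<dots> \<le> t * norm a + t * norm b" using that by (intro add_mono mult_right_mono) auto
      finally show *: "dist (z + of_real s * a + of_real r * b) z \<le> t * (norm a + norm b)"
        by (simp add: algebra_simps)
      show "z + of_real s * a + of_real r * b \<in> U" using ball * by (auto simp: dist_commute)
    qed
    have dr: "((\<lambda>s. h (w + of_real s * c)) has_real_derivative dir_deriv c h (w + of_real s * c)) (at s)"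
      if "smooth_fun_on U h" "w + of_real s * c \<in> U" for h :: "complex \<Rightarrow> real" and w c s
    proof -
      have 1: "((\<lambda>s. w + of_real s * c) has_derivative (\<lambda>r. of_real r * c)) (at s)"
        by (auto intro!: derivative_eq_intros)
      have lin: "bounded_linear (\<lambda>a. dir_deriv a h (w + of_real s * c))"
        by (rule has_derivative_bounded_linear[OF smooth_has_derivative[OF that]])
      have "dir_deriv (of_real r * c) h (w + of_real s * c) = r * dir_deriv c h (w + of_real s * c)" for r
        using linear_cmul[OF bounded_linear.linear[OF lin], of r c] by (simp add: scaleR_conv_of_real)
      thus ?thesis
        using has_derivative_compose[OF 1 smooth_has_derivative[OF that]]
        by (simp add: has_field_derivative_def mult.commute[of _ "dir_deriv c h _"])
    qed
    define \<phi> where "\<phi> s = g (z + of_real t * b + of_real s * a) - g (z + of_real s * a)" for s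
    have "\<exists>s. 0 < s \<and> s < t \<and> \<phi> t - \<phi> 0 = (t - 0) *
        (dir_deriv a g (z + of_real t * b + of_real s * a) - dir_deriv a g (z + of_real s * a))"
    proof (rule MVT2[OF t])
      fix s assume s: "0 \<le> s" "s \<le> t"
      show "(\<phi> has_real_derivative
          dir_deriv a g (z + of_real t * b + of_real s * a) - dir_deriv a g (z + of_real s * a)) (at s)"
        unfolding \<phi>_def
      proof (intro DERIV_diff dr g)
        show "z + of_real t * b + of_real s * a \<in> U" using inU[of s t] s t by (simp add: ac_simps)
        show "z + of_real s * a \<in> U" using inU[of s 0] s t by simp
      qed
    qed
    then obtain s where s: "0 < s" "s < t" and e1: "\<phi> t - \<phi> 0 = t *
        (dir_deriv a g (z + of_real t * b + of_real s * a) - dir_deriv a g (z + of_real s * a))" by auto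
    have "\<exists>r. 0 < r \<and> r < t \<and> dir_deriv a g (z + of_real s * a + of_real t * b)
        - dir_deriv a g (z + of_real s * a + of_real 0 * b)
        = (t - 0) * dir_deriv b (dir_deriv a g) (z + of_real s * a + of_real r * b)"
    proof (rule MVT2[OF t])
      fix r assume r: "0 \<le> r" "r \<le> t"
      show "((\<lambda>r. dir_deriv a g (z + of_real s * a + of_real r * b)) has_real_derivative
          dir_deriv b (dir_deriv a g) (z + of_real s * a + of_real r * b)) (at r)"
        by (intro dr smooth_dir_deriv g inU) (use s r in auto)
    qed
    then obtain r where r: "0 < r" "r < t" and e2: "dir_deriv a g (z + of_real s * a + of_real t * b)
        - dir_deriv a g (z + of_real s * a)
        = t * dir_deriv b (dir_deriv a g) (z + of_real s * a + of_real r * b)" by auto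
    show ?thesis
    proof (intro exI conjI)
      show "dist (z + of_real s * a + of_real r * b) z \<le> t * (norm a + norm b)"
        using dst s r by simp
      have "\<phi> t - \<phi> 0 = t * t * dir_deriv b (dir_deriv a g) (z + of_real s * a + of_real r * b)"
        using e1 e2 by (simp add: ac_simps)
      thus "g (z + of_real t * a + of_real t * b) - g (z + of_real t * a) - g (z + of_real t * b) + g z
        = t * t * dir_deriv b (dir_deriv a g) (z + of_real s * a + of_real r * b)"
        by (simp add: \<phi>_def ac_simps)
    qed
  qed
  have cont: "isCont (dir_deriv a (dir_deriv b g)) z" for a b
    using smooth_continuous_on[OF smooth_dir_deriv[OF smooth_dir_deriv[OF g]]] z U
    by (simp add: continuous_on_eq_continuous_at)
  show ?thesis
  proof (rule ccontr)
    let ?A = "dir_deriv a (dir_deriv b g)" and ?B = "dir_deriv b (dir_deriv a g)"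
    assume ne: "?A z \<noteq> ?B z"
    define e where "e = \<bar>?A z - ?B z\<bar> / 2"
    have e: "e > 0" using ne by (simp add: e_def)
    obtain d1 where d1: "d1 > 0" "\<And>p. dist p z < d1 \<Longrightarrow> \<bar>?A p - ?A z\<bar> < e"
      using cont[of a b] e unfolding continuous_at_eps_delta dist_real_def by metis
    obtain d2 where d2: "d2 > 0" "\<And>p. dist p z < d2 \<Longrightarrow> \<bar>?B p - ?B z\<bar> < e"
      using cont[of b a] e unfolding continuous_at_eps_delta dist_real_def by metis
    obtain d3 where d3: "d3 > 0" "cball z d3 \<subseteq> U"
      using U z open_contains_cball by blast
    define d where "d = min (min d1 d2) d3"
    \<comment> \<open>The summand 1 keeps \<open>N\<close> positive when \<open>a\<close> and
      \<open>b\<close> are both 0. With \<open>t = d / (2 * N)\<close> the parallelogram stays at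
      distance less than \<open>d\<close> from \<open>z\<close>.\<close>
    define N where "N = norm a + norm b + 1"
    have pos: "N > 0" by (simp add: N_def add_nonneg_pos)
    define t where "t = d / (2 * N)"
    have "d > 0" using d1 d2 d3 by (simp add: d_def)
    hence t: "t > 0" using pos by (simp add: t_def)
    have "t * (norm a + norm b) \<le> t * N" using t by (simp add: N_def)
    also have "\<dots> = d / 2" using pos by (simp add: t_def)
    finally have small: "t * (norm a + norm b) < d" using \<open>d > 0\<close> by simp
    hence ball: "cball z (t * (norm a + norm b)) \<subseteq> U"
      using d3(2) by (auto simp: d_def)
    obtain p where p: "dist p z \<le> t * (norm a + norm b)"
      and ep: "g (z + of_real t * a + of_real t * b) - g (z + of_real t * a) - g (z + of_real t * b) + g z
        = t * t * ?B p" using key[OF t ball] by blast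
    obtain q where q: "dist q z \<le> t * (norm b + norm a)"
      and eq: "g (z + of_real t * b + of_real t * a) - g (z + of_real t * b) - g (z + of_real t * a) + g z
        = t * t * ?A q" using key[OF t, of b a] ball by (auto simp: add.commute)
    have "g (z + of_real t * b + of_real t * a) = g (z + of_real t * a + of_real t * b)"
      by (simp add: add.commute add.left_commute)
    hence "t * t * ?A q = t * t * ?B p" by (simp only: ep[symmetric] eq[symmetric])
    hence "?A q = ?B p" using t by simp
    moreover have "\<bar>?B p - ?B z\<bar> < e" using p small by (intro d2) (auto simp: d_def)
    moreover have "\<bar>?A q - ?A z\<bar> < e" using q small by (intro d1) (auto simp: d_def add.commute)
    moreover have "\<bar>?A z - ?B z\<bar> \<le> \<bar>?A q - ?A z\<bar> + \<bar>?A q - ?B z\<bar>" by linarith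
    ultimately show False by (simp add: e_def)
  qed
qed

lemma dir_deriv_bounded_linear:
  assumes "bounded_linear L" "f differentiable at z"
  shows "dir_deriv a (\<lambda>w. L (f w)) z = L (dir_deriv a f z)"
  by (rule dir_deriv_eq[OF bounded_linear.has_derivative[OF assms(1) has_derivative_dir_deriv[OF assms(2)]]])

lemma dir_deriv_commute:
  fixes f :: "complex \<Rightarrow> 'v::euclidean_space"
  assumes U: "open U" and f: "smooth_fun_on U f" and z: "z \<in> U"
  shows "dir_deriv a (dir_deriv b f) z = dir_deriv b (dir_deriv a f) z"
proof (rule euclidean_eqI)
  fix e :: 'v
  have L: "bounded_linear (\<lambda>v. v \<bullet> e)" by (rule bounded_linear_inner_left)
  have 1: "dir_deriv c (\<lambda>w. f w \<bullet> e) w = dir_deriv c f w \<bullet> e" if "w \<in> U" for c w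
    by (rule dir_deriv_bounded_linear[OF L smooth_differentiable[OF f that]])
  have 2: "dir_deriv d (dir_deriv c (\<lambda>w. f w \<bullet> e)) z = dir_deriv d (dir_deriv c f) z \<bullet> e" for c d
    by (rule trans[OF dir_deriv_cong[OF U z 1] dir_deriv_bounded_linear[OF L smooth_differentiable[OF smooth_dir_deriv[OF f] z]]])
  show "dir_deriv a (dir_deriv b f) z \<bullet> e = dir_deriv b (dir_deriv a f) z \<bullet> e"
    using dir_deriv_commute_real[OF U smooth_bounded_linear[OF U L f] z] unfolding 2 .
qed

section \<open>Smooth families of subspaces\<close>

text \<open>Bilinear and not Hermitian: linear functionals and complexified forms are represented by
  vectors and matrices, and conjugation is always written explicitly by \<open>vcnj\<close>.\<close>

definition cdot :: "complex ^ 'n \<Rightarrow> complex ^ 'n \<Rightarrow> complex"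
  where "cdot x y = (\<Sum>k\<in>UNIV. x $ k * y $ k)"

lemma cdot_add_right: "cdot x (y + z) = cdot x y + cdot x z"
  by (simp add: cdot_def sum.distrib algebra_simps)

lemma cdot_scale_right: "cdot x (a *s y) = a * cdot x y"
  by (simp add: cdot_def sum_distrib_left algebra_simps)

lemma cdot_diff_right: "cdot x (y - z) = cdot x y - cdot x z"
  by (simp add: cdot_def sum_subtractf algebra_simps)

lemma cdot_zero_right [simp]: "cdot x 0 = 0"
  by (simp add: cdot_def)

lemma cdot_sum_right: "cdot x (sum f S) = (\<Sum>i\<in>S. cdot x (f i))"
  by (induction S rule: infinite_finite_induct) (auto simp: cdot_add_right)

lemma smooth_cdot:
  assumes "open U" "smooth_fun_on U f" "smooth_fun_on U g"
  shows "smooth_fun_on U (\<lambda>z. cdot (f z) (g z))"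
  unfolding cdot_def using assms by (intro smooth_sum smooth_mult) (auto simp: smooth_vec_iff)

lemma smooth_vec_scale:
  fixes g :: "complex \<Rightarrow> complex ^ 'n"
  shows "open U \<Longrightarrow> smooth_fun_on U f \<Longrightarrow> smooth_fun_on U g \<Longrightarrow> smooth_fun_on U (\<lambda>z. f z *s g z)"
  by (rule smooth_bounded_bilinear[OF _ bounded_bilinear_vec_scale])

lemma smooth_matrix_vector:
  fixes M :: "complex \<Rightarrow> complex ^ 'n ^ 'm"
  shows "open U \<Longrightarrow> smooth_fun_on U M \<Longrightarrow> smooth_fun_on U g \<Longrightarrow> smooth_fun_on U (\<lambda>z. M z *v g z)"
  by (rule smooth_bounded_bilinear[OF _ bounded_bilinear_matrix_vector])

lemma smooth_matrix_matrix:
  fixes M :: "complex \<Rightarrow> complex ^ 'n ^ 'm" and N :: "complex \<Rightarrow> complex ^ 'k ^ 'n"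
  shows "open U \<Longrightarrow> smooth_fun_on U M \<Longrightarrow> smooth_fun_on U N \<Longrightarrow> smooth_fun_on U (\<lambda>z. M z ** N z)"
  by (rule smooth_bounded_bilinear[OF _ bounded_bilinear_matrix_matrix])

text \<open>Independence of a family rather than of a set: a frame is a family of sections, and a
  set of values would not see that two of them coincide at a point.\<close>

definition indexed_independent :: "'i set \<Rightarrow> ('i \<Rightarrow> complex ^ 'n) \<Rightarrow> bool"
  where "indexed_independent J c \<longleftrightarrow> (\<forall>x. (\<Sum>i\<in>J. x i *s c i) = 0 \<longrightarrow> (\<forall>i\<in>J. x i = 0))"

lemma indexed_independent_imp:
  assumes J: "finite J" and ind: "indexed_independent J c"
  shows "inj_on c J" "vec.independent (c ` J)"
proof -
  show inj: "inj_on c J"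
  proof (rule inj_onI, rule ccontr)
    fix i j assume ij: "i \<in> J" "j \<in> J" "c i = c j" "i \<noteq> j"
    let ?x = "\<lambda>k. if k = i then 1 else if k = j then - 1 else 0 :: complex"
    have "(\<Sum>k\<in>J. ?x k *s c k) = (\<Sum>k\<in>{i, j}. ?x k *s c k)"
      by (rule sum.mono_neutral_right) (use J ij in auto)
    hence "(\<Sum>k\<in>J. ?x k *s c k) = 0" using ij by simp
    hence "?x i = 0" using ind[unfolded indexed_independent_def, rule_format, of ?x i] ij by blast
    thus False by simp
  qed
  show "vec.independent (c ` J)"
  proof (rule vec.independent_if_scalars_zero)
    fix f x assume *: "(\<Sum>x\<in>c ` J. f x *s x) = 0" "x \<in> c ` J"
    have "(\<Sum>i\<in>J. f (c i) *s c i) = 0"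
      using * by (simp add: sum.reindex[OF inj])
    hence "\<forall>i\<in>J. f (c i) = 0" 
      using ind[unfolded indexed_independent_def, THEN spec, of "\<lambda>i. f (c i)"] by blast
    thus "f x = 0" using *(2) by blast
  qed (use J in simp)
qed

lemma independent_indexed:
  assumes "finite B" "vec.independent B" shows "indexed_independent B (\<lambda>x. x)"
  unfolding indexed_independent_def
  using assms vec.independentD by blast

text \<open>The functionals are the coordinates with respect to an extension of the family to a
  basis.\<close>

lemma dual_functionals:
  assumes J: "finite J" and ind: "indexed_independent J c"
  obtains l where "\<And>i j. i \<in> J \<Longrightarrow> j \<in> J \<Longrightarrow> cdot (l i) (c j) = (if i = j then 1 else 0)"
proof
  let ?B = "vec.extend_basis (c ` J)"
  have inj: "inj_on c J" and indB: "vec.independent (c ` J)" using indexed_independent_imp[OF assms] .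
  have B: "vec.independent ?B" "vec.span ?B = UNIV" "c ` J \<subseteq> ?B"
    using vec.independent_extend_basis[OF indB] vec.span_extend_basis[OF indB]
      vec.extend_basis_superset[OF indB] by auto
  define l where "l = (\<lambda>i. \<chi> k. vec.representation ?B (axis k 1) (c i))"
  fix i j assume ij: "i \<in> J" "j \<in> J"
  have "cdot (l i) (c j) = (\<Sum>k\<in>UNIV. c j $ k * vec.representation ?B (axis k 1) (c i))"
    by (simp add: cdot_def l_def mult.commute)
  also have "\<dots> = (\<Sum>k\<in>UNIV. vec.representation ?B (c j $ k *s axis k 1) (c i))"
    using B by (simp add: vec.representation_scale)
  also have "\<dots> = vec.representation ?B (\<Sum>k\<in>UNIV. c j $ k *s axis k 1) (c i)"
    using B by (subst vec.representation_sum) auto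
  also have "\<dots> = vec.representation ?B (c j) (c i)" by (simp add: basis_expansion)
  also have "\<dots> = (if i = j then 1 else 0)"
    using B ij inj by (subst vec.representation_basis) (auto dest: inj_onD)
  finally show "cdot (l i) (c j) = (if i = j then 1 else 0)" .
qed

text \<open>The matrix \<open>T z\<close> is a perturbation of the identity sending
  \<open>c i s\<close> to \<open>c i z\<close>; it is invertible where its determinant does not
  vanish, an open set containing \<open>s\<close>. The functionals dual to the \<open>c i s\<close>,
  composed with the inverse of \<open>T z\<close>, are dual to the \<open>c i z\<close> and vary
  smoothly. Hence the sections stay independent, and the constant dimension makes them span.\<close>

lemma smooth_frame_coordinates:
  fixes E :: "complex \<Rightarrow> (complex ^ 'n) set"
  assumes U: "open U" "s \<in> U" and J: "finite J"
    and E: "\<And>z. z \<in> U \<Longrightarrow> vec.subspace (E z)" "\<And>z. z \<in> U \<Longrightarrow> vec.dim (E z) = card J"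
    and c: "\<And>i. i \<in> J \<Longrightarrow> smooth_section E U (c i)"
    and ind: "indexed_independent J (\<lambda>i. c i s)"
  obtains V \<phi> where "open V" "s \<in> V" "V \<subseteq> U" "\<And>i. i \<in> J \<Longrightarrow> smooth_fun_on V (\<phi> i)"
    "\<And>z d. z \<in> V \<Longrightarrow> d \<in> E z \<Longrightarrow> d = (\<Sum>i\<in>J. cdot (\<phi> i z) d *s c i z)"
    "\<And>z i j. z \<in> V \<Longrightarrow> i \<in> J \<Longrightarrow> j \<in> J \<Longrightarrow> cdot (\<phi> i z) (c j z) = (if i = j then 1 else 0)"
proof -
  obtain l where l: "\<And>i j. i \<in> J \<Longrightarrow> j \<in> J \<Longrightarrow> cdot (l i) (c j s) = (if i = j then 1 else 0)"
    by (rule dual_functionals[OF J ind]) (rule that)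
  define T :: "complex \<Rightarrow> complex ^ 'n ^ 'n"
    where "T z = (\<chi> r k. (if r = k then 1 else 0) + (\<Sum>i\<in>J. (c i z $ r - c i s $ r) * l i $ k))" for z
  have Tv: "T z *v x = x + (\<Sum>i\<in>J. cdot (l i) x *s (c i z - c i s))" for z x
  proof -
    have "(T z *v x) $ r = x $ r + (\<Sum>i\<in>J. cdot (l i) x * (c i z $ r - c i s $ r))" for r
    proof -
      have "(T z *v x) $ r = (\<Sum>k\<in>UNIV. (if r = k then 1 else 0) * x $ k)
          + (\<Sum>k\<in>UNIV. (\<Sum>i\<in>J. (c i z $ r - c i s $ r) * l i $ k) * x $ k)"
        by (simp add: matrix_vector_mult_def T_def distrib_right sum.distrib)
      also have "(\<Sum>k\<in>UNIV. (if r = k then 1 else 0) * x $ k) = x $ r"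
        by (simp add: if_distrib[of "\<lambda>c. c * _"] cong: if_cong)
      also have "(\<Sum>k\<in>UNIV. (\<Sum>i\<in>J. (c i z $ r - c i s $ r) * l i $ k) * x $ k)
          = (\<Sum>i\<in>J. cdot (l i) x * (c i z $ r - c i s $ r))"
        by (simp add: cdot_def sum_distrib_right sum_distrib_left mult.commute mult.left_commute mult.assoc
            sum.swap[of _ UNIV J])
      finally show ?thesis .
    qed
    thus ?thesis by (simp add: vec_eq_iff right_diff_distrib)
  qed
  have Tc: "T z *v c j s = c j z" if "j \<in> J" for z j
  proof -
    have "(\<Sum>i\<in>J. cdot (l i) (c j s) *s (c i z - c i s)) = (\<Sum>i\<in>J. if i = j then c j z - c j s else 0)"
      by (rule sum.cong) (use that l in auto)
    also have "\<dots> = c j z - c j s" using J that by simp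
    finally show ?thesis by (simp add: Tv)
  qed
  have sm: "smooth_fun_on U (\<lambda>z. T z $ r $ k)" for r k
  proof -
    have "smooth_fun_on U (\<lambda>z. c i z $ r)" if "i \<in> J" for i
      using c[OF that] by (simp add: smooth_section_def smooth_vec_iff[OF U(1)])
    hence "smooth_fun_on U (\<lambda>z. (if r = k then 1 else 0) + (\<Sum>i\<in>J. (c i z $ r - c i s $ r) * l i $ k))"
      by (intro smooth_add smooth_const smooth_sum smooth_mult smooth_diff U(1)) auto
    thus ?thesis by (simp add: T_def)
  qed
  have smT: "smooth_fun_on U T" by (simp add: smooth_vec_iff[OF U(1)] sm)
  define V where "V = U \<inter> (\<lambda>z. det (T z)) -` (- {0})"
  have "continuous_on U (\<lambda>z. det (T z))"
    by (rule smooth_continuous_on[OF smooth_det[OF U(1) sm]])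
  hence V: "open V" "V \<subseteq> U"
    using continuous_open_preimage[of U "\<lambda>z. det (T z)" "- {0}"] U(1) by (auto simp: V_def)
  have "T s = mat 1" by (simp add: T_def mat_def)
  hence sV: "s \<in> V" using U(2) by (simp add: V_def det_I)
  have inv: "invertible (T z)" if "z \<in> V" for z
    using that by (simp add: V_def invertible_det_nz)
  define \<phi> where "\<phi> i z = (\<chi> k. cdot (l i) (matrix_inv (T z) *v axis k 1))" for i z
  have \<phi>: "cdot (\<phi> i z) x = cdot (l i) (matrix_inv (T z) *v x)" for i z x
  proof -
    let ?M = "matrix_inv (T z)"
    have "(?M *v x) $ r = (\<Sum>k\<in>UNIV. x $ k *s (?M *v axis k 1)) $ r" for r
      by (simp add: matrix_vector_axis) (simp add: matrix_vector_mult_def mult.commute)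
    hence "?M *v x = (\<Sum>k\<in>UNIV. x $ k *s (?M *v axis k 1))" by (simp only: vec_eq_iff) blast
    hence "cdot (l i) (?M *v x) = (\<Sum>k\<in>UNIV. x $ k * cdot (l i) (?M *v axis k 1))"
      by (simp only: cdot_sum_right cdot_scale_right)
    thus ?thesis unfolding \<phi>_def cdot_def[of "vec_lambda _"] by (simp add: mult.commute)
  qed
  have dual: "cdot (\<phi> i z) (c j z) = (if i = j then 1 else 0)" if "z \<in> V" "i \<in> J" "j \<in> J" for z i j
  proof -
    have "matrix_inv (T z) *v c j z = matrix_inv (T z) *v (T z *v c j s)" using Tc[OF that(3)] by simp
    also have "\<dots> = c j s" by (simp add: matrix_vector_mul_assoc matrix_inv_left[OF inv[OF that(1)]])
    finally show ?thesis using l that by (simp add: \<phi>)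
  qed
  show thesis
  proof (rule that[OF V(1) sV V(2) _ _ dual])
    fix i assume "i \<in> J"
    have "smooth_fun_on V (\<lambda>z. cdot (l i) (matrix_inv (T z) *v axis k 1))" for k
      by (intro smooth_cdot smooth_matrix_vector smooth_matrix_inv smooth_const V(1)
          smooth_subset[OF smT V(2)] inv)
    thus "smooth_fun_on V (\<phi> i)" by (simp add: smooth_vec_iff[OF V(1)] \<phi>_def)
  next
    fix z d assume z: "z \<in> V" and d: "d \<in> E z"
    have ind_z: "indexed_independent J (\<lambda>i. c i z)"
      unfolding indexed_independent_def
    proof (intro allI impI ballI)
      fix x j assume *: "(\<Sum>i\<in>J. x i *s c i z) = 0" and j: "j \<in> J"
      have "cdot (\<phi> j z) (\<Sum>i\<in>J. x i *s c i z) = (\<Sum>i\<in>J. if i = j then x j else 0)"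
        unfolding cdot_sum_right cdot_scale_right
        by (rule sum.cong) (use dual z j in auto)
      thus "x j = 0" using * j J by simp
    qed
    have sub: "(\<lambda>i. c i z) ` J \<subseteq> E z"
      using c z V(2) unfolding smooth_section_def by blast
    have "card ((\<lambda>i. c i z) ` J) = vec.dim (E z)"
      using indexed_independent_imp(1)[OF J ind_z] E(2) z V(2) by (auto simp: card_image)
    hence "E z \<subseteq> vec.span ((\<lambda>i. c i z) ` J)"
      using vec.card_ge_dim_independent[OF sub indexed_independent_imp(2)[OF J ind_z]] by simp
    hence "d \<in> vec.span ((\<lambda>i. c i z) ` J)" using d by blast
    then obtain y where "d = (\<Sum>v\<in>(\<lambda>i. c i z) ` J. y v *s v)"
      unfolding vec.span_finite[OF finite_imageI[OF J]] by blast
    hence dy: "d = (\<Sum>i\<in>J. y (c i z) *s c i z)"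
      by (simp add: sum.reindex[OF indexed_independent_imp(1)[OF J ind_z]])
    have "cdot (\<phi> j z) d = y (c j z)" if j: "j \<in> J" for j
    proof -
      have "cdot (\<phi> j z) d = (\<Sum>i\<in>J. if i = j then y (c j z) else 0)"
        unfolding dy cdot_sum_right cdot_scale_right
        by (rule sum.cong) (use dual z j in auto)
      thus ?thesis using J j by simp
    qed
    thus "d = (\<Sum>i\<in>J. cdot (\<phi> i z) d *s c i z)" using dy by simp
  qed
qed

text \<open>Local extension of every single vector, used in place of local frames: it passes to sums
  without any condition on dimensions, which matters for the spaces \<open>R\<close>, and to
  intersections when the dimensions are constant.\<close>

definition smooth_ext :: "complex set \<Rightarrow> (complex \<Rightarrow> (complex ^ 'n) set) \<Rightarrow> bool"
  where "smooth_ext S E \<longleftrightarrow> (\<forall>s\<in>S. \<forall>v\<in>E s. \<exists>U \<sigma>. open U \<and> s \<in> U \<and> U \<subseteq> S \<and>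
    smooth_section E U \<sigma> \<and> \<sigma> s = v)"

lemma smooth_extE:
  assumes "smooth_ext S E" "s \<in> S" "v \<in> E s"
  obtains U \<sigma> where "open U" "s \<in> U" "U \<subseteq> S" "smooth_section E U \<sigma>" "\<sigma> s = v"
  using assms unfolding smooth_ext_def by blast

lemma smooth_section_subset: "smooth_section E U \<sigma> \<Longrightarrow> V \<subseteq> U \<Longrightarrow> smooth_section E V \<sigma>"
  unfolding smooth_section_def using smooth_subset by blast

lemma smooth_ext_family:
  assumes J: "finite J" and s: "open S" "s \<in> S"
    and c: "\<And>i. i \<in> J \<Longrightarrow> smooth_ext S (E i) \<and> v i \<in> E i s"
  obtains U \<sigma> where "open U" "s \<in> U" "U \<subseteq> S"
    "\<And>i. i \<in> J \<Longrightarrow> smooth_section (E i) U (\<sigma> i) \<and> \<sigma> i s = v i"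
proof -
  have "\<forall>i\<in>J. \<exists>U \<sigma>. open U \<and> s \<in> U \<and> U \<subseteq> S \<and> smooth_section (E i) U \<sigma> \<and> \<sigma> s = v i"
    using c s unfolding smooth_ext_def by blast
  then obtain U \<sigma> where *: "\<And>i. i \<in> J \<Longrightarrow> open (U i) \<and> s \<in> U i \<and> U i \<subseteq> S \<and>
      smooth_section (E i) (U i) (\<sigma> i) \<and> \<sigma> i s = v i" by metis
  show thesis
  proof (rule that[of "S \<inter> (\<Inter>i\<in>J. U i)" \<sigma>])
    show "open (S \<inter> (\<Inter>i\<in>J. U i))" using J s * by (intro open_Int open_INT) auto
    fix i assume i: "i \<in> J"
    have "smooth_section (E i) (S \<inter> (\<Inter>i\<in>J. U i)) (\<sigma> i)"
      by (rule smooth_section_subset[of _ "U i"]) (use * i in auto)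
    thus "smooth_section (E i) (S \<inter> (\<Inter>i\<in>J. U i)) (\<sigma> i) \<and> \<sigma> i s = v i" using * i by blast
  qed (use s * in auto)
qed

lemma smooth_ext_const: "open S \<Longrightarrow> smooth_ext S (\<lambda>_. A)"
  unfolding smooth_ext_def smooth_section_def by (blast intro: smooth_const)

lemma smooth_ext_vcnj:
  assumes "smooth_ext S E" shows "smooth_ext S (\<lambda>z. vcnj ` E z)"
  unfolding smooth_ext_def
proof (intro ballI)
  fix s v assume s: "s \<in> S" "v \<in> vcnj ` E s"
  hence "vcnj v \<in> E s" by (simp add: mem_vcnj_image)
  then obtain U \<sigma> where U: "open U" "s \<in> U" "U \<subseteq> S" "smooth_section E U \<sigma>" "\<sigma> s = vcnj v"
    using smooth_extE[OF assms s(1)] by metis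
  have "smooth_section (\<lambda>z. vcnj ` E z) U (\<lambda>z. vcnj (\<sigma> z))"
    using U(1,4) smooth_bounded_linear[OF U(1) bounded_linear_vcnj] by (auto simp: smooth_section_def)
  thus "\<exists>U \<sigma>. open U \<and> s \<in> U \<and> U \<subseteq> S \<and> smooth_section (\<lambda>z. vcnj ` E z) U \<sigma> \<and> \<sigma> s = v"
    using U by (intro exI[of _ U] exI[of _ "\<lambda>z. vcnj (\<sigma> z)"]) auto
qed

lemma smooth_ext_span_Union:
  assumes S: "open S" and E: "\<And>j. j \<in> J \<Longrightarrow> smooth_ext S (E j)"
  shows "smooth_ext S (\<lambda>z. vec.span (\<Union>j\<in>J. E j z))"
  unfolding smooth_ext_def
proof (intro ballI)
  fix s v assume s: "s \<in> S" and v: "v \<in> vec.span (\<Union>j\<in>J. E j s)"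
  let ?G = "\<lambda>z. vec.span (\<Union>j\<in>J. E j z)"
  show "\<exists>U \<sigma>. open U \<and> s \<in> U \<and> U \<subseteq> S \<and> smooth_section ?G U \<sigma> \<and> \<sigma> s = v"
    using v
  proof (induction v rule: vec.span_induct_alt)
    case base
    show ?case using S s
      by (intro exI[of _ S] exI[of _ "\<lambda>_. 0"]) (auto simp: smooth_section_def vec.span_zero intro: smooth_const)
  next
    case (step a x y)
    obtain j where j: "j \<in> J" "x \<in> E j s" using step by blast
    obtain U \<sigma> where U: "open U" "s \<in> U" "U \<subseteq> S" "smooth_section (E j) U \<sigma>" "\<sigma> s = x"
      using smooth_extE[OF E[OF j(1)] s j(2)] by metis
    obtain U' \<sigma>' where U': "open U'" "s \<in> U'" "U' \<subseteq> S" "smooth_section ?G U' \<sigma>'" "\<sigma>' s = y"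
      using step by blast
    have o: "open (U \<inter> U')" using U U' by blast
    have "smooth_fun_on (U \<inter> U') \<sigma>" "smooth_fun_on (U \<inter> U') \<sigma>'"
      using smooth_section_subset[OF U(4), of "U \<inter> U'"] smooth_section_subset[OF U'(4), of "U \<inter> U'"]
      by (auto simp: smooth_section_def)
    hence "smooth_fun_on (U \<inter> U') (\<lambda>z. a *s \<sigma> z + \<sigma>' z)"
      by (intro smooth_add smooth_vec_scale smooth_const o)
    moreover have "a *s \<sigma> z + \<sigma>' z \<in> ?G z" if "z \<in> U \<inter> U'" for z
    proof (rule vec.span_add[OF vec.span_scale[OF vec.span_base]])
      show "\<sigma> z \<in> (\<Union>j\<in>J. E j z)" "\<sigma>' z \<in> ?G z"
        using that U(4) U'(4) j(1) unfolding smooth_section_def by auto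
    qed
    ultimately have "smooth_section ?G (U \<inter> U') (\<lambda>z. a *s \<sigma> z + \<sigma>' z)"
      by (simp add: smooth_section_def)
    thus ?case using U U' o
      by (intro exI[of _ "U \<inter> U'"] exI[of _ "\<lambda>z. a *s \<sigma> z + \<sigma>' z"]) auto
  qed
qed

lemma smooth_ext_span_Un:
  assumes "open S" "smooth_ext S A" "smooth_ext S B"
  shows "smooth_ext S (\<lambda>z. vec.span (A z \<union> B z))"
  using smooth_ext_span_Union[OF assms(1), of UNIV "\<lambda>b. if b then A else B"] assms(2,3)
  by (simp add: UNIV_bool Un_commute)

text \<open>Extend \<open>v\<close> to sections \<open>a\<close> of \<open>A\<close> and
  \<open>b\<close> of \<open>B\<close>. By constancy of its dimension the sum \<open>A + B\<close>
  has a frame near \<open>s\<close> consisting of sections of \<open>A\<close> and sections of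
  \<open>B\<close>. The difference \<open>a - b\<close> is expanded in it, and its
  \<open>A\<close>-part is moved to the side of \<open>a\<close>: the result is a section of
  \<open>A\<close> and also equals \<open>b\<close> plus a section of \<open>B\<close>. It still
  passes through \<open>v\<close>, since \<open>a - b\<close> vanishes at \<open>s\<close>.\<close>

lemma smooth_ext_inter:
  fixes A B :: "complex \<Rightarrow> (complex ^ 'n) set"
  assumes S: "open S" and A: "smooth_ext S A" and B: "smooth_ext S B"
    and sub: "\<And>z. z \<in> S \<Longrightarrow> vec.subspace (A z)" "\<And>z. z \<in> S \<Longrightarrow> vec.subspace (B z)"
    and dim: "\<And>z. z \<in> S \<Longrightarrow> vec.dim (A z) = dA" "\<And>z. z \<in> S \<Longrightarrow> vec.dim (B z) = dB"
      "\<And>z. z \<in> S \<Longrightarrow> vec.dim (A z \<inter> B z) = dI"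
  shows "smooth_ext S (\<lambda>z. A z \<inter> B z)"
  unfolding smooth_ext_def
proof (intro ballI)
  fix s v assume s: "s \<in> S" and v: "v \<in> A s \<inter> B s"
  let ?E = "\<lambda>z. vec.span (A z \<union> B z)"
  have dimE: "vec.dim (?E z) = dA + dB - dI" if z: "z \<in> S" for z
  proof -
    have "?E z = {x + y |x y. x \<in> A z \<and> y \<in> B z}"
      unfolding vec.span_Un using sub[OF z] by (simp add: vec.span_eq_iff[THEN iffD2])
    thus ?thesis using vec.dim_sums_Int[OF sub[OF z]] dim[OF z] by simp
  qed
  obtain C where C: "C \<subseteq> A s \<union> B s" "vec.independent C" "A s \<union> B s \<subseteq> vec.span C"
    "card C = vec.dim (A s \<union> B s)" using vec.basis_exists by blast
  have fC: "finite C" using C(2) vec.independent_bound_general by blast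
  have cC: "card C = dA + dB - dI" using C(4) dimE[OF s] by simp
  \<comment> \<open>Each basis vector of the sum is extended inside one of the two bundles; a vector
    lying in both fibres is extended inside \<open>A\<close>.\<close>
  define E' where "E' x = (if x \<in> A s then A else B)" for x
  have "smooth_ext S (E' x) \<and> x \<in> E' x s" if "x \<in> C" for x
    using that C(1) A B by (auto simp: E'_def)
  then obtain U1 c where U1: "open U1" "s \<in> U1" "U1 \<subseteq> S"
    and c: "\<And>x. x \<in> C \<Longrightarrow> smooth_section (E' x) U1 (c x) \<and> c x s = x"
    by (rule smooth_ext_family[OF fC S s, where E = E' and v = "\<lambda>x. x"]) (blast, rule that)
  obtain Ua a where Ua: "open Ua" "s \<in> Ua" "Ua \<subseteq> S" "smooth_section A Ua a" "a s = v"
    using smooth_extE[OF A s, of v] v by blast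
  obtain Ub b where Ub: "open Ub" "s \<in> Ub" "Ub \<subseteq> S" "smooth_section B Ub b" "b s = v"
    using smooth_extE[OF B s, of v] v by blast
  define U where "U = U1 \<inter> Ua \<inter> Ub"
  have U: "open U" "s \<in> U" "U \<subseteq> S" "U \<subseteq> U1" "U \<subseteq> Ua" "U \<subseteq> Ub" using U1 Ua Ub by (auto simp: U_def)
  have cU: "smooth_section (E' x) U (c x)" "c x s = x" if "x \<in> C" for x
    using c[OF that] smooth_section_subset U by blast+
  have cE: "smooth_section ?E U (c x)" if "x \<in> C" for x
    using cU(1)[OF that] unfolding smooth_section_def E'_def by (auto intro: vec.span_base split: if_splits)
  have indC: "indexed_independent C (\<lambda>x. c x s)"
  proof -
    have "(\<Sum>x\<in>C. f x *s c x s) = (\<Sum>x\<in>C. f x *s x)" for f using cU(2) by (intro sum.cong) auto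
    thus ?thesis using independent_indexed[OF fC C(2)] unfolding indexed_independent_def by simp
  qed
  have E1: "vec.subspace (?E z)" and E2: "vec.dim (?E z) = card C" if "z \<in> U" for z
    using dimE[of z] U(3) cC that by auto
  obtain V \<phi> where V: "open V" "s \<in> V" "V \<subseteq> U" and \<phi>: "\<And>x. x \<in> C \<Longrightarrow> smooth_fun_on V (\<phi> x)"
    and coord: "\<And>z d. z \<in> V \<Longrightarrow> d \<in> ?E z \<Longrightarrow> d = (\<Sum>x\<in>C. cdot (\<phi> x z) d *s c x z)"
    and "\<And>z i j. z \<in> V \<Longrightarrow> i \<in> C \<Longrightarrow> j \<in> C \<Longrightarrow> cdot (\<phi> i z) (c j z) = (if i = j then 1 else 0)"
    by (rule smooth_frame_coordinates[OF U(1,2) fC E1 E2 cE indC]) (assumption+, rule that)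
  have sm: "smooth_fun_on V a" "smooth_fun_on V b" "\<And>x. x \<in> C \<Longrightarrow> smooth_fun_on V (c x)"
    using smooth_section_subset[OF Ua(4), of V] smooth_section_subset[OF Ub(4), of V]
      smooth_section_subset[OF cE, of _ V] U V(3) by (auto simp: smooth_section_def)
  define d where "d z = a z - b z" for z
  define t where "t K z = (\<Sum>x\<in>K. cdot (\<phi> x z) (d z) *s c x z)" for K z
  have smt: "smooth_fun_on V (t K)" if "K \<subseteq> C" for K
    unfolding t_def d_def using that \<phi> sm
    by (intro smooth_sum smooth_vec_scale smooth_cdot smooth_diff V(1)) auto
  define \<sigma> where "\<sigma> z = a z - t (C \<inter> A s) z" for z
  have "smooth_fun_on V \<sigma>"
    unfolding \<sigma>_def by (intro smooth_diff V(1) sm smt) auto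
  moreover have "\<sigma> z \<in> A z \<inter> B z" if z: "z \<in> V" for z
  proof
    have zS: "z \<in> S" "z \<in> U" using z V U by auto
    have az: "a z \<in> A z" and bz: "b z \<in> B z"
      using Ua(4) Ub(4) U zS unfolding smooth_section_def by auto
    have cA: "c x z \<in> A z" if "x \<in> C \<inter> A s" for x
      using cU(1)[of x] that zS(2) by (auto simp: smooth_section_def E'_def)
    have cB: "c x z \<in> B z" if "x \<in> C - A s" for x
      using cU(1)[of x] that zS(2) by (auto simp: smooth_section_def E'_def)
    show "\<sigma> z \<in> A z"
      unfolding \<sigma>_def t_def
      by (intro vec.subspace_diff[OF sub(1)[OF zS(1)]] vec.subspace_sum[OF sub(1)[OF zS(1)]]
          vec.subspace_scale[OF sub(1)[OF zS(1)]] az cA)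
    have "d z \<in> ?E z" unfolding d_def
      by (intro vec.span_diff vec.span_base) (use az bz in auto)
    hence "d z = t C z" unfolding t_def by (rule coord[OF z])
    also have "\<dots> = t (C \<inter> A s) z + t (C - A s) z"
      unfolding t_def using fC by (subst sum.union_disjoint[symmetric]) (auto intro: sum.cong)
    finally have "\<sigma> z = b z + t (C - A s) z" by (simp add: \<sigma>_def d_def algebra_simps)
    also have "\<dots> \<in> B z"
      unfolding t_def
      by (intro vec.subspace_add[OF sub(2)[OF zS(1)]] vec.subspace_sum[OF sub(2)[OF zS(1)]]
          vec.subspace_scale[OF sub(2)[OF zS(1)]] bz cB)
    finally show "\<sigma> z \<in> B z" .
  qed
  moreover have "\<sigma> s = v" by (simp add: \<sigma>_def t_def d_def Ua(5) Ub(5))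
  ultimately show "\<exists>U \<sigma>. open U \<and> s \<in> U \<and> U \<subseteq> S \<and> smooth_section (\<lambda>z. A z \<inter> B z) U \<sigma> \<and> \<sigma> s = v"
    using V U by (intro exI[of _ V] exI[of _ \<sigma>]) (auto simp: smooth_section_def)
qed

text \<open>Bases of the summands at \<open>s\<close> extend to sections of the summands, which
  together form a frame of the whole space near \<open>s\<close>. The pairs in \<open>J\<close>
  record the summand of each section, so a component is the part of the smooth expansion whose first
  index is \<open>i\<close>.\<close>

lemma smooth_component:
  fixes I :: "complex \<Rightarrow> 'i \<Rightarrow> (complex ^ 'n) set"
  assumes S: "open S" and I: "\<And>z. z \<in> S \<Longrightarrow> direct_family (I z)"
    and ext: "\<And>i. smooth_ext S (\<lambda>z. I z i)" and dim: "\<And>z i. z \<in> S \<Longrightarrow> vec.dim (I z i) = d i"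
  shows "smooth_fun_on S (\<lambda>z. component (I z) i v)"
proof (rule smooth_local)
  fix s assume s: "s \<in> S"
  interpret Is: direct_family "I s" by (rule I[OF s])
  let ?N = "{i. I s i \<noteq> {0}}"
  have "\<forall>i. \<exists>B. B \<subseteq> I s i \<and> vec.independent B \<and> vec.span B = I s i \<and> card B = d i"
  proof
    fix i
    obtain B where B: "B \<subseteq> I s i" "vec.independent B" "I s i \<subseteq> vec.span B" "card B = vec.dim (I s i)"
      using vec.basis_exists by blast
    have "vec.span B = I s i" using B(1,3) vec.span_minimal[OF _ Is.subspace] by blast
    thus "\<exists>B. B \<subseteq> I s i \<and> vec.independent B \<and> vec.span B = I s i \<and> card B = d i"
      using B dim[OF s] by auto
  qed
  then obtain B where B: "\<And>i. B i \<subseteq> I s i" "\<And>i. vec.independent (B i)" "\<And>i. card (B i) = d i" by metis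
  have fB: "finite (B i)" for i using B(2) vec.independent_bound_general by blast
  define J where "J = Sigma ?N B"
  have fJ: "finite J" unfolding J_def using Is.finite_support fB by (rule finite_SigmaI)
  have fst_J: "fst ` J \<subseteq> ?N" unfolding J_def by (rule image_subsetI) (erule SigmaE, simp)
  have cJ: "card J = CARD('n)"
  proof -
    have "vec.span (\<Union>i. I s i) = UNIV" unfolding Is.span_eq by auto
    hence "(\<Sum>i\<in>?N. vec.dim (I s i)) = vec.dim (UNIV :: (complex ^ 'n) set)"
      using Is.dim_span[of UNIV] by simp
    thus ?thesis unfolding J_def using Is.finite_support fB B(3) dim[OF s]
      by (simp add: card_cart_basis)
  qed
  have "smooth_ext S (\<lambda>z. I z (fst j)) \<and> snd j \<in> I s (fst j)" if "j \<in> J" for j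
    using that ext B(1)[of "fst j"] by (auto simp: J_def)
  then obtain U c where U: "open U" "s \<in> U" "U \<subseteq> S"
    and c: "\<And>j. j \<in> J \<Longrightarrow> smooth_section (\<lambda>z. I z (fst j)) U (c j) \<and> c j s = snd j"
    by (rule smooth_ext_family[OF fJ S s, where E = "\<lambda>j z. I z (fst j)" and v = snd]) (blast, rule that)
  have ind: "indexed_independent J (\<lambda>j. c j s)"
    unfolding indexed_independent_def
  proof (intro allI impI ballI)
    fix x j assume *: "(\<Sum>j\<in>J. x j *s c j s) = 0" and j: "j \<in> J"
    obtain i b where ib: "j = (i, b)" "i \<in> ?N" "b \<in> B i" using j by (auto simp: J_def)
    have "(\<Sum>j\<in>J. x j *s c j s) = (\<Sum>j\<in>J. x j *s snd j)" using c by (intro sum.cong) auto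
    also have "\<dots> = (\<Sum>i\<in>?N. \<Sum>b\<in>B i. x (i, b) *s b)"
      unfolding J_def using Is.finite_support fB by (subst sum.Sigma) (auto simp: case_prod_unfold)
    finally have "0 = Is.comp i (\<Sum>i\<in>?N. \<Sum>b\<in>B i. x (i, b) *s b)" using * Is.comp_zero by simp
    also have "\<dots> = (\<Sum>i'\<in>?N. if i' = i then \<Sum>b\<in>B i. x (i, b) *s b else 0)"
      unfolding Is.comp_sum[of i _ ?N]
    proof (rule sum.cong[OF refl])
      fix i'
      have "(\<Sum>b\<in>B i'. x (i', b) *s b) \<in> I s i'"
        by (intro vec.subspace_sum[OF Is.subspace] vec.subspace_scale[OF Is.subspace]) (use B(1) in auto)
      thus "Is.comp i (\<Sum>b\<in>B i'. x (i', b) *s b) = (if i' = i then \<Sum>b\<in>B i. x (i, b) *s b else 0)"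
        using Is.comp_same by auto
    qed
    also have "\<dots> = (\<Sum>b\<in>B i. x (i, b) *s b)" using ib(2) Is.finite_support by simp
    finally have "x (i, b) = 0"
      using independent_indexed[OF fB B(2), of i] ib(3) unfolding indexed_independent_def by metis
    thus "x j = 0" using ib by simp
  qed
  have cU: "smooth_section (\<lambda>_. UNIV) U (c j)" if "j \<in> J" for j
    using c[OF that] by (simp add: smooth_section_def)
  obtain V \<phi> where V: "open V" "s \<in> V" "V \<subseteq> U" and \<phi>: "\<And>x. x \<in> J \<Longrightarrow> smooth_fun_on V (\<phi> x)"
    and coord: "\<And>z d. z \<in> V \<Longrightarrow> d \<in> UNIV \<Longrightarrow> d = (\<Sum>x\<in>J. cdot (\<phi> x z) d *s c x z)"
    and "\<And>z i j. z \<in> V \<Longrightarrow> i \<in> J \<Longrightarrow> j \<in> J \<Longrightarrow> cdot (\<phi> i z) (c j z) = (if i = j then 1 else 0)"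
    by (rule smooth_frame_coordinates[OF U(1,2) fJ _ _ cU ind])
      (rule vec.subspace_UNIV, simp only: vec_dim_card cJ, assumption, rule that)
  have smc: "smooth_fun_on V (c j)" if "j \<in> J" for j
    using smooth_section_subset[OF cU[OF that] V(3)] by (simp add: smooth_section_def)
  have comp: "component (I z) i v = (\<Sum>j\<in>{j\<in>J. fst j = i}. cdot (\<phi> j z) v *s c j z)" if z: "z \<in> V" for z
  proof -
    interpret Iz: direct_family "I z" using I z V U by blast
    show ?thesis
    proof (rule Iz.comp_eq[OF is_decompositionI[where J = ?N]])
      fix i
      show "(\<Sum>j\<in>{j\<in>J. fst j = i}. cdot (\<phi> j z) v *s c j z) \<in> I z i"
      proof (intro vec.subspace_sum[OF Iz.subspace] vec.subspace_scale[OF Iz.subspace])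
        fix j assume "j \<in> {j \<in> J. fst j = i}"
        thus "c j z \<in> I z i" using c[of j] z V by (auto simp: smooth_section_def)
      qed
    next
      fix i assume "i \<notin> ?N"
      hence "{j\<in>J. fst j = i} = {}" by (auto simp: J_def)
      thus "(\<Sum>j\<in>{j\<in>J. fst j = i}. cdot (\<phi> j z) v *s c j z) = 0" by (simp only: sum.empty)
    next
      have "v = (\<Sum>j\<in>J. cdot (\<phi> j z) v *s c j z)" by (rule coord[OF z]) simp
      also have "\<dots> = (\<Sum>i\<in>?N. \<Sum>j\<in>{j\<in>J. fst j = i}. cdot (\<phi> j z) v *s c j z)"
        by (rule sum.group[OF fJ Is.finite_support fst_J, symmetric])
      finally show "v = (\<Sum>i\<in>?N. \<Sum>j\<in>{j\<in>J. fst j = i}. cdot (\<phi> j z) v *s c j z)" .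
    qed (rule Is.finite_support)
  qed
  have "smooth_fun_on V (\<lambda>z. \<Sum>j\<in>{j\<in>J. fst j = i}. cdot (\<phi> j z) v *s c j z)"
    by (intro smooth_sum smooth_vec_scale smooth_cdot smooth_const V(1)) (use \<phi> smc in auto)
  moreover have "smooth_fun_on V (\<lambda>z. component (I z) i v) \<longleftrightarrow>
      smooth_fun_on V (\<lambda>z. \<Sum>j\<in>{j\<in>J. fst j = i}. cdot (\<phi> j z) v *s c j z)"
    by (rule smooth_cong[OF V(1)]) (rule comp)
  ultimately have "smooth_fun_on V (\<lambda>z. component (I z) i v)" by blast
  thus "\<exists>U. open U \<and> s \<in> U \<and> smooth_fun_on U (\<lambda>z. component (I z) i v)" using V by blast
qed

section \<open>The mixed Hodge metric\<close>

locale polarized_hodge = weight_hodge W F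
  for W :: "int \<Rightarrow> (real ^ 'n) set" and F :: "'n filtration" +
  fixes Q :: "int \<Rightarrow> real ^ 'n \<Rightarrow> real ^ 'n \<Rightarrow> real"
  assumes Q: "graded_forms W Q" and polarized: "graded_polarized W Q F"
begin

section \<open>The complexified forms on the weight filtration\<close>

abbreviation Qc :: "int \<Rightarrow> complex ^ 'n \<Rightarrow> complex ^ 'n \<Rightarrow> complex" where "Qc k \<equiv> complexify_form (Q k)"

lemma Q_add: "x \<in> W k \<Longrightarrow> x' \<in> W k \<Longrightarrow> y \<in> W k \<Longrightarrow> Q k (x + x') y = Q k x y + Q k x' y"
  and Q_scale: "x \<in> W k \<Longrightarrow> y \<in> W k \<Longrightarrow> Q k (c *\<^sub>R x) y = c * Q k x y"
  and Q_sym: "x \<in> W k \<Longrightarrow> y \<in> W k \<Longrightarrow> Q k y x = (- 1) powi k * Q k x y"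
  and Q_radical: "x \<in> W k \<Longrightarrow> (\<forall>y\<in>W k. Q k x y = 0) \<longleftrightarrow> x \<in> W (k - 1)"
  using Q unfolding graded_forms_def by blast+

lemma W_subspace: "real_vector.subspace (W k)"
  using W by (simp add: weight_filtration_def)

lemma W_pred: "x \<in> W (k - 1) \<Longrightarrow> x \<in> W k"
  using W monoD[of W "k - 1" k] by (auto simp: weight_filtration_def)

lemma Q_zero_left: "x \<in> W (k - 1) \<Longrightarrow> y \<in> W k \<Longrightarrow> Q k x y = 0"
  using Q_radical[OF W_pred] by blast

lemma Q_diff: "x \<in> W k \<Longrightarrow> x' \<in> W k \<Longrightarrow> y \<in> W k \<Longrightarrow> Q k (x - x') y = Q k x y - Q k x' y"
  using Q_add[of x k "(- 1) *\<^sub>R x'" y] Q_scale[of x' k y "- 1"]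
    real_vector.subspace_scale[OF W_subspace, of x' k "- 1"] by simp

lemma vRe_Wc: "x \<in> Wc k \<Longrightarrow> vRe x \<in> W k" and vIm_Wc: "x \<in> Wc k \<Longrightarrow> vIm x \<in> W k"
  by (simp_all add: complexify_def)

lemma vRe_add: "vRe (x + y) = vRe x + vRe y" and vIm_add: "vIm (x + y) = vIm x + vIm y"
  and vRe_scale: "vRe (c *s x) = Re c *\<^sub>R vRe x - Im c *\<^sub>R vIm x"
  and vIm_scale: "vIm (c *s x) = Re c *\<^sub>R vIm x + Im c *\<^sub>R vRe x"
  and vRe_vcnj: "vRe (vcnj x) = vRe x" and vIm_vcnj: "vIm (vcnj x) = (- 1) *\<^sub>R vIm x"
  for x y :: "complex ^ 'n"
  by (simp_all add: vRe_def vIm_def vec_eq_iff)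

lemmas W_scale = real_vector.subspace_scale[OF W_subspace]

lemma Qc_add_left:
  "x \<in> Wc k \<Longrightarrow> x' \<in> Wc k \<Longrightarrow> y \<in> Wc k \<Longrightarrow> Qc k (x + x') y = Qc k x y + Qc k x' y"
  by (simp add: complexify_form_def vRe_add vIm_add Q_add vRe_Wc vIm_Wc complex_eq_iff)

lemma Qc_scale_left: "x \<in> Wc k \<Longrightarrow> y \<in> Wc k \<Longrightarrow> Qc k (c *s x) y = c * Qc k x y"
  by (simp add: complexify_form_def vRe_scale vIm_scale Q_add Q_diff Q_scale W_scale vRe_Wc vIm_Wc
      complex_eq_iff algebra_simps)

lemma Qc_sym: "x \<in> Wc k \<Longrightarrow> y \<in> Wc k \<Longrightarrow> Qc k y x = (- 1) powi k * Qc k x y"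
proof -
  assume *: "x \<in> Wc k" "y \<in> Wc k"
  define r :: real where "r = (- 1) powi k"
  have "Qc k y x = of_real r * Qc k x y"
    unfolding complexify_form_def
    using * by (simp add: vRe_Wc vIm_Wc complex_eq_iff Q_sym[of "vRe x" k "vRe y", folded r_def]
        Q_sym[of "vIm x" k "vIm y", folded r_def] Q_sym[of "vRe x" k "vIm y", folded r_def]
        Q_sym[of "vIm x" k "vRe y", folded r_def] algebra_simps)
  thus ?thesis by (simp add: r_def of_real_power_int)
qed

lemma powi_minus_one_square: "(- 1 :: complex) powi k * (- 1) powi k = 1"
  by (simp flip: power_int_mult_distrib)

lemma Qc_add_right:
  assumes "x \<in> Wc k" "y \<in> Wc k" "y' \<in> Wc k" shows "Qc k x (y + y') = Qc k x y + Qc k x y'"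
  using assms W_intros(1)[of y k y']
  by (simp add: Qc_sym[of _ k x] Qc_add_left algebra_simps)

lemma Qc_scale_right:
  assumes "x \<in> Wc k" "y \<in> Wc k" shows "Qc k x (c *s y) = c * Qc k x y"
  using assms W_intros(3)[of y k c] by (simp add: Qc_sym[of _ k x] Qc_scale_left)

lemma Qc_vcnj: 
  assumes "x \<in> Wc k" "y \<in> Wc k" shows "Qc k (vcnj x) (vcnj y) = cnj (Qc k x y)"
proof -
  have R: "Q k a ((- 1) *\<^sub>R b) = - Q k a b" if "a \<in> W k" "b \<in> W k" for a b
    using that Q_sym[of "(- 1) *\<^sub>R b" k a] Q_sym[of b k a] Q_scale[of b k a "- 1"] W_scale[of b k "- 1"]
    by simp
  have L: "Q k ((- 1) *\<^sub>R a) b = - Q k a b" if "a \<in> W k" "b \<in> W k" for a b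
    using that Q_scale[of a k b "- 1"] by simp
  have "vRe x \<in> W k" "vIm x \<in> W k" "vRe y \<in> W k" "vIm y \<in> W k" "(- 1) *\<^sub>R vIm y \<in> W k"
    using assms vRe_Wc vIm_Wc W_scale by blast+
  thus ?thesis
    by (simp only: complexify_form_def vRe_vcnj vIm_vcnj L R) (simp add: complex_eq_iff)
qed

lemma Qc_zero_left: "x \<in> Wc (k - 1) \<Longrightarrow> y \<in> Wc k \<Longrightarrow> Qc k x y = 0"
  by (simp add: complexify_form_def Q_zero_left vRe_Wc vIm_Wc complex_eq_iff)

lemma Qc_zero_right: "x \<in> Wc k \<Longrightarrow> y \<in> Wc (k - 1) \<Longrightarrow> Qc k x y = 0"
  using Qc_sym[of y k x] Qc_zero_left[of y k x] Wc_pred[of y k] by simp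

lemma Qc_sum_left:
  assumes "y \<in> Wc k" "\<And>i. i \<in> S \<Longrightarrow> f i \<in> Wc k" shows "Qc k (sum f S) y = (\<Sum>i\<in>S. Qc k (f i) y)"
  using assms
proof (induction S rule: infinite_finite_induct)
  case (insert i S)
  thus ?case using vec.subspace_sum[OF subspace_Wc, of S f k] by (simp add: Qc_add_left)
qed (use Qc_scale_left[of 0 k y 0] W_intros(4)[of k] in auto)

lemma Qc_sum_right:
  assumes "x \<in> Wc k" "\<And>i. i \<in> S \<Longrightarrow> f i \<in> Wc k" shows "Qc k x (sum f S) = (\<Sum>i\<in>S. Qc k x (f i))"
  using assms
proof (induction S rule: infinite_finite_induct)
  case (insert i S)
  thus ?case using vec.subspace_sum[OF subspace_Wc, of S f k] by (simp add: Qc_add_right)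
qed (use Qc_scale_right[of x k 0 0] W_intros(4)[of k] in auto)

lemma comp_Wc_zero: "x \<in> Wc k \<Longrightarrow> k < a + b \<Longrightarrow> comp (a, b) x = 0"
  unfolding Wc_eq by (erule in_spanD) simp

lemma comp_in_Wc: "comp (p, q) x \<in> Wc (p + q)"
  using I_Wc comp_in by blast

text \<open>The form \<open>Q k\<close> only makes sense on \<open>W k\<close>; replacing it by a matrix makes it bilinear
  everywhere, with a matrix that does not depend on \<open>F\<close>.\<close>

lemma Qc_matrix: "\<exists>M. \<forall>x\<in>Wc k. \<forall>y\<in>Wc k. Qc k x y = cdot x (M *v y)"
proof -
  let ?N = "support \<inter> {(a, b). a + b \<le> k}"
  define \<pi> where "\<pi> x = (\<Sum>i\<in>?N. comp i x)" for x
  have \<pi>_Wc: "\<pi> x \<in> Wc k" for x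
    unfolding \<pi>_def
  proof (rule vec.subspace_sum[OF subspace_Wc])
    fix i assume "i \<in> ?N"
    then obtain a b where "i = (a, b)" "a + b \<le> k" by blast
    thus "comp i x \<in> Wc k" using comp_in_Wc[of a b x] Wc_mono[of "a + b" k] by auto
  qed
  have \<pi>_id: "\<pi> x = x" if "x \<in> Wc k" for x
    unfolding \<pi>_def
  proof (rule sum_comp)
    show "finite ?N" using finite_support by blast
    fix i assume "i \<notin> ?N"
    thus "comp i x = 0" using comp_Wc_zero[OF that] comp_zero_outside[of i x] by (cases i) force
  qed
  have \<pi>_exp: "\<pi> x = (\<Sum>i\<in>UNIV. x $ i *s \<pi> (axis i 1))" for x
  proof -
    have "\<pi> (\<Sum>i\<in>UNIV. x $ i *s axis i 1) = (\<Sum>i\<in>UNIV. x $ i *s \<pi> (axis i 1))"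
      unfolding \<pi>_def comp_sum comp_scale vec.scale_sum_right by (rule sum.swap)
    thus ?thesis by (simp add: basis_expansion)
  qed
  define M where "M = (\<chi> i j. Qc k (\<pi> (axis i 1)) (\<pi> (axis j 1)))"
  have "Qc k x y = cdot x (M *v y)" if x: "x \<in> Wc k" and y: "y \<in> Wc k" for x y
  proof -
    have "Qc k x y = Qc k (\<Sum>i\<in>UNIV. x $ i *s \<pi> (axis i 1)) (\<Sum>j\<in>UNIV. y $ j *s \<pi> (axis j 1))"
      using \<pi>_id[OF x] \<pi>_id[OF y] \<pi>_exp[of x] \<pi>_exp[of y] by simp
    also have "\<dots> = (\<Sum>i\<in>UNIV. Qc k (x $ i *s \<pi> (axis i 1)) (\<Sum>j\<in>UNIV. y $ j *s \<pi> (axis j 1)))"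
      by (intro Qc_sum_left vec.subspace_sum[OF subspace_Wc] W_intros \<pi>_Wc)
    also have "\<dots> = (\<Sum>i\<in>UNIV. \<Sum>j\<in>UNIV. x $ i * (y $ j * M $ i $ j))"
      by (simp add: Qc_sum_right sum_distrib_left Qc_scale_left Qc_scale_right \<pi>_Wc W_intros
          vec.subspace_sum[OF subspace_Wc] M_def mult.left_commute)
    also have "\<dots> = cdot x (M *v y)"
      by (simp add: cdot_def matrix_vector_mult_def sum_distrib_left mult.commute)
    finally show ?thesis .
  qed
  thus ?thesis by blast
qed

lemma I_gr: "x \<in> I (p, q) \<Longrightarrow> k = p + q \<Longrightarrow> x \<in> gr_filtration W F k p"
  unfolding gr_filtration_iff using I_F I_Wc W_intros(4) by (intro exI[of _ x] exI[of _ 0]) auto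

lemma I_vcnj_gr:
  assumes "x \<in> I (p, q)" "k = p + q" shows "x \<in> vcnj ` gr_filtration W F k q"
proof -
  obtain y z where yz: "y \<in> cF q" "y \<in> Wc (p + q)" "z \<in> R (q - 1) (p + q - 2)" "x = y + z"
    using I_cF[OF assms(1)] .
  moreover have "z \<in> Wc (k - 1)"
    using yz(3) R_Wc[of "q - 1" "p + q - 2"] Wc_mono[of "p + q - 2" "k - 1"] assms(2) by auto
  ultimately show ?thesis unfolding vcnj_gr_filtration_iff assms(2) by blast
qed

lemma gr_filtration_anti: "p \<le> p' \<Longrightarrow> gr_filtration W F k p' \<subseteq> gr_filtration W F k p"
  using F_anti[of p p'] by (force simp: gr_filtration_iff)

text \<open>For \<open>p < a\<close> this is the first bilinear relation with index
  \<open>p + 1\<close>: \<open>x\<close> lies in \<open>F (p + 1)\<close> and, modulo lower weight,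
  \<open>vcnj y\<close> lies in \<open>F q\<close>, where \<open>(p + 1) + q = k + 1\<close>. The
  case \<open>a < p\<close> follows by conjugation and symmetry.\<close>

lemma Qc_I_orth:
  assumes x: "x \<in> I (a, b)" and y: "y \<in> I (p, q)" and k: "a + b = k" "p + q = k" and ne: "(a, b) \<noteq> (p, q)"
  shows "Qc k x (vcnj y) = 0"
proof -
  have first: "Qc k u v = 0" if "u \<in> gr_filtration W F k p'" "v \<in> gr_filtration W F k (k + 1 - p')" for u v p'
    using polarized that unfolding graded_polarized_def by blast
  have main: "Qc k x (vcnj y) = 0" if x: "x \<in> I (a, b)" and y: "y \<in> I (p, q)"
    and k: "a + b = k" "p + q = k" and "p < a" for x y a b p q
  proof (rule first)
    show "x \<in> gr_filtration W F k (p + 1)"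
      using I_gr[OF x k(1)[symmetric]] gr_filtration_anti[of "p + 1" a k] that by auto
    have eq: "k + 1 - (p + 1) = q" using k by simp
    show "vcnj y \<in> gr_filtration W F k (k + 1 - (p + 1))"
      unfolding eq using I_vcnj_gr[OF y k(2)[symmetric]] unfolding mem_vcnj_image .
  qed
  show ?thesis
  proof (cases "p < a")
    case True
    thus ?thesis by (rule main[OF x y k])
  next
    case False
    hence "a < p" using k ne by auto
    hence "Qc k y (vcnj x) = 0" by (rule main[OF y x k(2,1)])
    moreover have "x \<in> Wc k" "y \<in> Wc k" using I_Wc[OF x] I_Wc[OF y] k by auto
    ultimately show ?thesis
      using Qc_vcnj[of y k "vcnj x"] Qc_sym[of "vcnj y" k x] by (simp add: vcnj_Wc)
  qed
qed

section \<open>Symmetry, orthogonality and positivity of the metric\<close>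

definition h :: "complex ^ 'n \<Rightarrow> complex ^ 'n \<Rightarrow> complex" where "h = mixed_hodge_metric W Q F"

lemma h_eq: "h u v = (\<Sum>i\<in>support. \<i> powi (fst i - snd i) *
    Qc (fst i + snd i) (comp i u) (vcnj (comp i v)))"
  by (simp add: h_def mixed_hodge_metric_def deligne_eq case_prod_unfold)

lemma comp_in_Wc': "comp i x \<in> Wc (fst i + snd i)"
  using comp_in_Wc by (cases i) simp

lemma h_add_left: "h (u + u') v = h u v + h u' v"
  by (simp add: h_eq comp_add Qc_add_left comp_in_Wc' vcnj_Wc sum.distrib algebra_simps)

lemma h_add_right: "h u (v + v') = h u v + h u v'"
  by (simp add: h_eq comp_add Qc_add_right comp_in_Wc' vcnj_Wc sum.distrib algebra_simps)

lemma h_scale_left: "h (c *s u) v = c * h u v"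
  by (simp add: h_eq comp_scale Qc_scale_left comp_in_Wc' vcnj_Wc sum_distrib_left algebra_simps)

lemma h_scale_right: "h u (c *s v) = cnj c * h u v"
  by (simp add: h_eq comp_scale Qc_scale_right comp_in_Wc' vcnj_Wc sum_distrib_left algebra_simps)

text \<open>The power of \<open>i\<close> in the metric is made for this: conjugating it costs the
  sign \<open>(-1)^(p - q)\<close>, and the symmetry of \<open>Q (p + q)\<close> costs
  \<open>(-1)^(p + q)\<close>, which is the same sign.\<close>

lemma hQ_hermitian:
  assumes "x \<in> Wc (p + q)" "y \<in> Wc (p + q)"
  shows "cnj (\<i> powi (p - q) * Qc (p + q) x (vcnj y)) = \<i> powi (p - q) * Qc (p + q) y (vcnj x)"
proof -
  have "cnj (Qc (p + q) x (vcnj y)) = (- 1) powi (p + q) * Qc (p + q) y (vcnj x)"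
    using Qc_vcnj[of x "p + q" "vcnj y"] Qc_sym[of y "p + q" "vcnj x"] assms by (simp add: vcnj_Wc)
  moreover have "(- \<i>) powi (p - q) * (- 1) powi (p + q) = \<i> powi (p - q)"
  proof -
    have "(- 1 :: complex) powi (p + q) = (- 1) powi (p - q) * ((- 1) powi q * (- 1) powi q)"
      using power_int_add[of "- 1 :: complex" "p - q" "q + q"] power_int_add[of "- 1 :: complex" q q]
      by (simp add: add.commute)
    hence "(- 1 :: complex) powi (p + q) = (- 1) powi (p - q)"
      by (simp only: powi_minus_one_square mult_1_right)
    thus ?thesis by (simp flip: power_int_mult_distrib)
  qed
  ultimately show ?thesis by (simp flip: mult.assoc)
qed

lemma h_hermitian: "h v u = cnj (h u v)"
  unfolding h_eq cnj_sum
  by (intro sum.cong refl hQ_hermitian[OF comp_in_Wc' comp_in_Wc', symmetric])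

lemma h_diff_left: "h (u - u') v = h u v - h u' v"
  using h_add_left[of "u - u'" u' v] by simp

lemma h_sum_left: "h (sum f S) v = (\<Sum>i\<in>S. h (f i) v)"
proof (induction S rule: infinite_finite_induct)
  case (insert i S)
  thus ?case by (simp add: h_add_left)
qed (use h_scale_left[of 0 0 v] in auto)

lemma h_I: "y \<in> I (p, q) \<Longrightarrow> h x y = \<i> powi (p - q) * Qc (p + q) (comp (p, q) x) (vcnj y)"
proof -
  assume y: "y \<in> I (p, q)"
  have "h x y = (\<Sum>i\<in>support. if i = (p, q) then
      \<i> powi (p - q) * Qc (p + q) (comp (p, q) x) (vcnj y) else 0)"
    unfolding h_eq
  proof (rule sum.cong[OF refl])
    fix i
    show "\<i> powi (fst i - snd i) * Qc (fst i + snd i) (comp i x) (vcnj (comp i y)) =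
        (if i = (p, q) then \<i> powi (p - q) * Qc (p + q) (comp (p, q) x) (vcnj y) else 0)"
      using comp_same[OF y, of i] Qc_scale_right[of "comp i x" "fst i + snd i" 0 0]
        W_intros(4) comp_in_Wc' by auto
  qed
  also have "\<dots> = \<i> powi (p - q) * Qc (p + q) (comp (p, q) x) (vcnj y)"
  proof (cases "(p, q) \<in> support")
    case False
    hence "comp (p, q) x = 0" by (rule comp_zero_outside)
    hence "Qc (p + q) (comp (p, q) x) (vcnj y) = 0"
      using Qc_scale_left[of 0 "p + q" "vcnj y" 0] I_Wc[OF y] W_intros(4) by (simp add: vcnj_Wc)
    thus ?thesis using False finite_support by simp
  qed (use finite_support in simp)
  finally show ?thesis .
qed

lemma h_Q:
  assumes x: "x \<in> Wc (p + q)" and y: "y \<in> I (p, q)"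
  shows "h x y = \<i> powi (p - q) * Qc (p + q) x (vcnj y)"
proof -
  have yW: "vcnj y \<in> Wc (p + q)" using I_Wc[OF y] by (simp add: vcnj_Wc)
  have z: "Qc (p + q) 0 (vcnj y) = 0"
    using Qc_scale_left[of 0 "p + q" "vcnj y" 0] yW W_intros(4) by simp
  have inW: "comp i x \<in> Wc (p + q)" for i
  proof (cases i)
    case (Pair a b)
    thus ?thesis
      using comp_in_Wc[of a b x] Wc_mono[of "a + b" "p + q"] comp_Wc_zero[OF x, of a b] W_intros(4)
      by (cases "a + b \<le> p + q") auto
  qed
  have "Qc (p + q) x (vcnj y) = Qc (p + q) (\<Sum>i\<in>support. comp i x) (vcnj y)"
    by (simp only: sum_comp_support)
  also have "\<dots> = (\<Sum>i\<in>support. Qc (p + q) (comp i x) (vcnj y))"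
    by (rule Qc_sum_left[OF yW inW])
  also have "\<dots> = (\<Sum>i\<in>support. if i = (p, q) then Qc (p + q) (comp (p, q) x) (vcnj y) else 0)"
  proof (rule sum.cong[OF refl])
    fix i :: "int \<times> int"
    obtain a b where i: "i = (a, b)" by (cases i)
    have "Qc (p + q) (comp i x) (vcnj y) = 0" if ne: "i \<noteq> (p, q)"
    proof (cases "a + b = p + q")
      case True
      thus ?thesis using Qc_I_orth[OF comp_in y] ne i by auto
    next
      case False
      show ?thesis
      proof (cases "a + b < p + q")
        case True
        hence "comp i x \<in> Wc (p + q - 1)"
          using comp_in_Wc[of a b x] Wc_mono[of "a + b" "p + q - 1"] i by auto
        thus ?thesis by (rule Qc_zero_left[OF _ yW])
      qed (use comp_Wc_zero[OF x, of a b] i z False in auto)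
    qed
    thus "Qc (p + q) (comp i x) (vcnj y)
        = (if i = (p, q) then Qc (p + q) (comp (p, q) x) (vcnj y) else 0)" by auto
  qed
  also have "\<dots> = Qc (p + q) (comp (p, q) x) (vcnj y)"
    using finite_support comp_zero_outside[of "(p, q)" x] z by auto
  finally show ?thesis unfolding h_I[OF y] by simp
qed

lemma h_orth: "x \<in> I i \<Longrightarrow> y \<in> I j \<Longrightarrow> i \<noteq> j \<Longrightarrow> h x y = 0"
proof -
  assume *: "x \<in> I i" "y \<in> I j" "i \<noteq> j"
  obtain p q where j: "j = (p, q)" by (cases j)
  have "comp (p, q) x = 0" using comp_same[OF *(1), of j] * j by simp
  thus ?thesis using h_I[of y p q x] h_I[of y p q 0] h_scale_left[of 0 0 y] * j comp_zero by simp
qed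

lemma h_comp_left: "y \<in> I i \<Longrightarrow> h (comp i x) y = h x y"
  using h_I[of y "fst i" "snd i"] comp_comp[of i i] by simp

lemma h_pos_I:
  assumes "u \<in> I (p, q)" "u \<noteq> 0" shows "\<exists>r>0. h u u = complex_of_real r"
proof -
  have "u \<in> gr_hodge W F p q"
    unfolding gr_hodge_def using I_gr[OF assms(1)] I_vcnj_gr[OF assms(1)] by auto
  moreover have "u \<notin> Wc (p + q - 1)" using I_zero assms by blast
  ultimately have "\<exists>r>0. \<i> powi (p - q) * Qc (p + q) u (vcnj u) = complex_of_real r"
    using polarized unfolding graded_polarized_def by blast
  thus ?thesis using h_Q[OF I_Wc[OF assms(1)] assms(1)] by simp
qed

lemma h_sum_comp: "h u v = (\<Sum>i\<in>support. h (comp i u) (comp i v))"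
  unfolding h_eq[of u v]
proof (rule sum.cong[OF refl])
  fix i
  show "\<i> powi (fst i - snd i) * Qc (fst i + snd i) (comp i u) (vcnj (comp i v)) = h (comp i u) (comp i v)"
    using h_I[of "comp i v" "fst i" "snd i" "comp i u"] comp_in[of i v] by (simp add: comp_comp)
qed

lemma h_pos: assumes "u \<noteq> 0" shows "\<exists>r>0. h u u = complex_of_real r"
proof -
  have "\<exists>r\<ge>0. h (comp i u) (comp i u) = complex_of_real r \<and> (comp i u \<noteq> 0 \<longrightarrow> r > 0)" for i
  proof (cases "comp i u = 0")
    case True
    thus ?thesis using h_scale_left[of 0 0 0] by (intro exI[of _ 0]) auto
  next
    case False
    thus ?thesis using h_pos_I[of "comp i u" "fst i" "snd i"] comp_in[of i u] by force
  qed
  then obtain r where r: "\<And>i. r i \<ge> 0" "\<And>i. h (comp i u) (comp i u) = complex_of_real (r i)"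
    "\<And>i. comp i u \<noteq> 0 \<Longrightarrow> r i > 0" by metis
  obtain i where i: "comp i u \<noteq> 0" using eq_zeroI assms by blast
  hence "i \<in> support" using comp_zero_outside by blast
  hence "(\<Sum>i\<in>support. r i) > 0"
    using r i finite_support by (intro sum_pos2[of _ i]) auto
  moreover have "h u u = complex_of_real (\<Sum>i\<in>support. r i)"
    by (subst h_sum_comp) (simp add: r(2))
  ultimately show ?thesis by blast
qed

text \<open>By \<open>I_lift\<close> and \<open>I_zero\<close>, \<open>I (p, q)\<close> is
  isomorphic to the Hodge component of the graded piece. On the classifying space the summands thus
  have the prescribed Hodge numbers as dimensions.\<close>

lemma dim_I: "vec.dim (gr_hodge W F p q) = vec.dim (I (p, q)) + vec.dim (Wc (p + q - 1))"
proof -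
  have "gr_hodge W F p q = {x + y |x y. x \<in> I (p, q) \<and> y \<in> Wc (p + q - 1)}"
  proof (intro equalityI subsetI)
    fix v assume "v \<in> gr_hodge W F p q"
    then obtain f w g w' where fw: "f \<in> F p" "f \<in> Wc (p + q)" "w \<in> Wc (p + q - 1)" "v = f + w"
      and gw: "g \<in> cF q" "g \<in> Wc (p + q)" "w' \<in> Wc (p + q - 1)" "v = g + w'"
      unfolding gr_hodge_def vcnj_gr_filtration_iff gr_filtration_iff Int_iff by blast
    have "f - g = w' - w" using fw(4) gw(4) by (simp add: algebra_simps)
    hence "f - g \<in> Wc (p + q - 1)" using W_intros(2)[OF gw(3) fw(3)] by simp
    then obtain x where x: "x \<in> I (p, q)" "x - f \<in> Wc (p + q - 1)"
      using I_lift[OF fw(1,2) gw(1,2)] by blast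
    have "v = x + (w - (x - f))" using fw(4) by simp
    thus "v \<in> {x + y |x y. x \<in> I (p, q) \<and> y \<in> Wc (p + q - 1)}"
      using x W_intros(2)[OF fw(3) x(2)] by blast
  next
    fix v assume "v \<in> {x + y |x y. x \<in> I (p, q) \<and> y \<in> Wc (p + q - 1)}"
    then obtain x y where xy: "x \<in> I (p, q)" "y \<in> Wc (p + q - 1)" "v = x + y" by blast
    have "y \<in> gr_filtration W F (p + q) p" "y \<in> vcnj ` gr_filtration W F (p + q) q"
      unfolding gr_filtration_iff vcnj_gr_filtration_iff
      using xy(2) W_intros(4) F_intros(4) cF_intros(4) by (metis add_0)+
    thus "v \<in> gr_hodge W F p q"
      unfolding gr_hodge_def xy(3) using I_gr[OF xy(1)] I_vcnj_gr[OF xy(1)]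
      by (auto intro!: vec.subspace_add[OF subspace_gr_filtration]
          vec.subspace_add[OF subspace_vcnj_image[OF subspace_gr_filtration]])
  qed
  moreover have "I (p, q) \<inter> Wc (p + q - 1) = {0}"
    using I_zero zero_in W_intros(4) by blast
  ultimately show ?thesis
    using vec.dim_sums_Int[OF subspace_I subspace_Wc, of "(p, q)" "p + q - 1"] by simp
qed

end

section \<open>Chern connections of split Hermitian bundles\<close>

interpretation mv: bounded_bilinear "(*v) :: complex ^ 'n ^ 'm \<Rightarrow> complex ^ 'n \<Rightarrow> complex ^ 'm"
  by (rule bounded_bilinear_matrix_vector)

interpretation mm: bounded_bilinear "(**) :: complex ^ 'n ^ 'm \<Rightarrow> complex ^ 'k ^ 'n \<Rightarrow> complex ^ 'k ^ 'm"
  by (rule bounded_bilinear_matrix_matrix)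

interpretation vs: bounded_bilinear "(*s) :: complex \<Rightarrow> complex ^ 'n \<Rightarrow> complex ^ 'n"
  by (rule bounded_bilinear_vec_scale)

lemma mv_scale_right: "M *v (a *s x) = a *s (M *v x)" for M :: "complex ^ 'n ^ 'm"
  by (simp add: vec_eq_iff matrix_vector_mult_def sum_distrib_left algebra_simps)

lemma mat_v: "mat c *v x = c *s x" for x :: "complex ^ 'n"
  by (simp add: vec_eq_iff matrix_vector_mult_def mat_def if_distrib[of "\<lambda>c. c * _"] cong: if_cong)

lemma scaleR_vec_eq: "r *\<^sub>R x = of_real r *s x" for x :: "complex ^ 'n"
proof -
  have "r *\<^sub>R c = of_real r * c" for c :: complex by (rule scaleR_conv_of_real)
  thus ?thesis by (simp add: vec_eq_iff)
qed

lemma mat_mv: "(mat c ** M) *v x = c *s (M *v x)" for M :: "complex ^ 'n ^ 'n"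
  by (simp add: mat_v flip: matrix_vector_mul_assoc)

lemma dir_deriv_bounded_bilinear:
  assumes "bounded_bilinear pr" "f differentiable at z" "g differentiable at z"
  shows "dir_deriv a (\<lambda>w. pr (f w) (g w)) z = pr (dir_deriv a f z) (g z) + pr (f z) (dir_deriv a g z)"
  using dir_deriv_eq[OF bounded_bilinear.FDERIV[OF assms(1)
      has_derivative_dir_deriv[OF assms(2)] has_derivative_dir_deriv[OF assms(3)]]]
  by (simp add: add.commute)

lemmas dir_deriv_mv = dir_deriv_bounded_bilinear[OF bounded_bilinear_matrix_vector]
lemmas dir_deriv_mm = dir_deriv_bounded_bilinear[OF bounded_bilinear_matrix_matrix]
lemmas dir_deriv_vs = dir_deriv_bounded_bilinear[OF bounded_bilinear_vec_scale]

lemma dir_deriv_const: "dir_deriv a (\<lambda>_. c) z = 0"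
  by (rule dir_deriv_eq[OF has_derivative_const])

lemma dir_deriv_add:
  "f differentiable at z \<Longrightarrow> g differentiable at z \<Longrightarrow>
    dir_deriv a (\<lambda>w. f w + g w) z = dir_deriv a f z + dir_deriv a g z"
  by (rule dir_deriv_eq[OF has_derivative_add[OF has_derivative_dir_deriv has_derivative_dir_deriv]])

lemma dir_deriv_sum:
  "(\<And>i. i \<in> J \<Longrightarrow> f i differentiable at z) \<Longrightarrow>
    dir_deriv a (\<lambda>w. \<Sum>i\<in>J. f i w) z = (\<Sum>i\<in>J. dir_deriv a (f i) z)"
  by (rule dir_deriv_eq[OF has_derivative_sum[OF has_derivative_dir_deriv]])

lemma dir_deriv_real_linear:
  assumes "f differentiable at z"
  shows "dir_deriv (complex_of_real x * a + complex_of_real y * b) f z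
    = x *\<^sub>R dir_deriv a f z + y *\<^sub>R dir_deriv b f z"
proof -
  have l: "linear (\<lambda>a. dir_deriv a f z)"
    using has_derivative_linear[OF has_derivative_dir_deriv[OF assms]] .
  show ?thesis
    using linear_add[OF l, of "x *\<^sub>R a" "y *\<^sub>R b"] linear_cmul[OF l, of x a] linear_cmul[OF l, of y b]
    by (simp add: scaleR_conv_of_real)
qed

lemma dir_deriv_uminus_dir:
  assumes "f differentiable at z" shows "dir_deriv (- a) f z = - dir_deriv a f z"
  using dir_deriv_real_linear[OF assms, of "- 1" a 0 0] by simp

lemma cdot_transpose: "cdot (A *v x) y = cdot x (transpose A *v y)"
  by (simp add: cdot_def matrix_vector_mult_def transpose_def sum_distrib_left sum_distrib_right
      algebra_simps) (rule sum.swap)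

lemma bounded_bilinear_cdot: "bounded_bilinear (cdot :: complex ^ 'n \<Rightarrow> complex ^ 'n \<Rightarrow> complex)"
  unfolding bilinear_conv_bounded_bilinear[symmetric] bilinear_def
  by (auto intro!: linearI simp: cdot_def sum.distrib algebra_simps scaleR_sum_right)

lemma bounded_linear_transpose: "bounded_linear (transpose :: complex ^ 'n ^ 'm \<Rightarrow> complex ^ 'm ^ 'n)"
  unfolding linear_conv_bounded_linear[symmetric]
  by (auto intro!: linearI simp: transpose_def vec_eq_iff)

lemma bounded_linear_trace: "bounded_linear (trace :: complex ^ 'n ^ 'n \<Rightarrow> complex)"
  unfolding linear_conv_bounded_linear[symmetric]
  by (auto intro!: linearI simp: trace_def sum.distrib scaleR_sum_right)

lemma trace_on_basis:
  assumes "vec.subspace A"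
  obtains B where "vec.independent B" "vec.span B = A" "finite B" "B \<subseteq> A"
    "\<And>L. trace_on A L = (\<Sum>b\<in>B. vec.representation B (L b) b)"
proof -
  obtain C where "C \<subseteq> A" "vec.independent C" "A \<subseteq> vec.span C" "card C = vec.dim A"
    using vec.basis_exists by blast
  hence "vec.independent C \<and> vec.span C = A" using vec.span_minimal[OF _ assms] by blast
  hence "\<exists>B. vec.independent B \<and> vec.span B = A" by blast
  note B = someI_ex[OF this]
  show thesis
  proof (rule that)
    show "finite (SOME B. vec.independent B \<and> vec.span B = A)"
      using B vec.independent_bound_general by blast
    show "(SOME B. vec.independent B \<and> vec.span B = A) \<subseteq> A"
      using B vec.span_superset by metis
    show "trace_on A L = (\<Sum>b\<in>(SOME B. vec.independent B \<and> vec.span B = A).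
        vec.representation (SOME B. vec.independent B \<and> vec.span B = A) (L b) b)" for L
      by (simp add: trace_on_def Let_def)
  qed (use B in blast)+
qed

text \<open>\<open>trace_on\<close> refers to a chosen basis of the subspace. Composition with a
  projection \<open>P\<close> onto the subspace extends the endomorphism to the whole space, where
  the matrix trace involves no choice.\<close>

lemma trace_eq_sum_representation:
  fixes M P :: "complex ^ 'n ^ 'n"
  assumes B: "vec.independent B" "finite B"
    and M: "\<And>v. v \<in> vec.span B \<Longrightarrow> M *v v \<in> vec.span B"
    and P: "\<And>x. P *v x \<in> vec.span B" "\<And>v. v \<in> vec.span B \<Longrightarrow> P *v v = v"
  shows "(\<Sum>b\<in>B. vec.representation B (M *v b) b) = trace (M ** P)"
proof -
  let ?K = "M ** P"
  let ?r = "vec.representation B"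
  have K: "?K *v x \<in> vec.span B" for x
    using M P by (simp flip: matrix_vector_mul_assoc)
  have "trace ?K = (\<Sum>j\<in>UNIV. (?K *v axis j 1) $ j)"
    by (simp add: trace_def matrix_vector_axis)
  also have "\<dots> = (\<Sum>j\<in>UNIV. \<Sum>b\<in>B. ?r (?K *v axis j 1) b * b $ j)"
  proof (rule sum.cong[OF refl])
    fix j
    have "(\<Sum>b\<in>B. ?r (?K *v axis j 1) b *s b) = ?K *v axis j 1"
      using vec.sum_representation_eq[OF B(1) K B(2)] by blast
    hence "(?K *v axis j 1) $ j = (\<Sum>b\<in>B. ?r (?K *v axis j 1) b *s b) $ j" by simp
    thus "(?K *v axis j 1) $ j = (\<Sum>b\<in>B. ?r (?K *v axis j 1) b * b $ j)" by simp
  qed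
  also have "\<dots> = (\<Sum>b\<in>B. \<Sum>j\<in>UNIV. b $ j * ?r (?K *v axis j 1) b)"
    by (subst sum.swap) (simp add: mult.commute)
  also have "\<dots> = (\<Sum>b\<in>B. ?r (M *v b) b)"
  proof (rule sum.cong[OF refl])
    fix b assume b: "b \<in> B"
    have "(\<Sum>j\<in>UNIV. b $ j * ?r (?K *v axis j 1) b) = (\<Sum>j\<in>UNIV. ?r (b $ j *s (?K *v axis j 1)) b)"
      using vec.representation_scale[OF B(1) K] by simp
    also have "\<dots> = ?r (\<Sum>j\<in>UNIV. b $ j *s (?K *v axis j 1)) b"
      by (subst vec.representation_sum[OF B(1)]) (auto intro: vec.span_scale K)
    also have "(\<Sum>j\<in>UNIV. b $ j *s (?K *v axis j 1)) = ?K *v (\<Sum>j\<in>UNIV. b $ j *s axis j 1)"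
      by (simp only: mv.sum_right mv_scale_right)
    also have "\<dots> = M *v b"
      using P(2)[of b] b by (simp add: basis_expansion vec.span_base flip: matrix_vector_mul_assoc)
    finally show "(\<Sum>j\<in>UNIV. b $ j * ?r (?K *v axis j 1) b) = ?r (M *v b) b" .
  qed
  finally show ?thesis ..
qed

lemma trace_on_eq_trace:
  fixes M P :: "complex ^ 'n ^ 'n"
  assumes A: "vec.subspace A" and L: "\<And>v. v \<in> A \<Longrightarrow> L v = M *v v"
    and M: "\<And>v. v \<in> A \<Longrightarrow> M *v v \<in> A"
    and P: "\<And>x. P *v x \<in> A" "\<And>v. v \<in> A \<Longrightarrow> P *v v = v"
  shows "trace_on A L = trace (M ** P)"
proof -
  obtain B where B: "vec.independent B" "vec.span B = A" "finite B" "B \<subseteq> A"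
    "\<And>L. trace_on A L = (\<Sum>b\<in>B. vec.representation B (L b) b)" by (rule trace_on_basis[OF A]) (rule that)
  have "trace_on A L = (\<Sum>b\<in>B. vec.representation B (M *v b) b)"
    unfolding B(5) using B(4) L by (intro sum.cong) auto
  also have "\<dots> = trace (M ** P)"
    by (rule trace_eq_sum_representation[OF B(1,3)]) (simp_all add: B(2) M P)
  finally show ?thesis .
qed

text \<open>Isolates what the comparison of connections takes from Hodge theory. The metric lives on
  the whole trivial bundle, and the \<open>p q\<close> are its orthogonal projections onto the
  summands of \<open>E\<close>. By \<open>metric\<close>, the metric has constant coefficients, as
  it were, along sections of a single summand; by \<open>dbar\<close>, \<open>E\<close> is stable
  under the Cauchy-Riemann operator, while nothing of the kind is required of the summands.\<close>

locale hermitian_splitting =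
  fixes S :: "complex set" and J :: "'q set" and p :: "'q \<Rightarrow> complex \<Rightarrow> complex ^ 'n ^ 'n"
    and E :: "complex \<Rightarrow> (complex ^ 'n) set" and h :: "complex \<Rightarrow> complex ^ 'n \<Rightarrow> complex ^ 'n \<Rightarrow> complex"
    and H :: "complex \<Rightarrow> complex ^ 'n ^ 'n"
  assumes open_S: "open S" and finite_J: "finite J"
    and smooth_p: "q \<in> J \<Longrightarrow> smooth_fun_on S (p q)"
    and p_mult: "z \<in> S \<Longrightarrow> q \<in> J \<Longrightarrow> r \<in> J \<Longrightarrow> p q z ** p r z = (if q = r then p q z else 0)"
    and E_def: "z \<in> S \<Longrightarrow> E z = {v. (\<Sum>q\<in>J. p q z) *v v = v}"
    and smooth_H: "smooth_fun_on S H"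
    and h_H: "z \<in> S \<Longrightarrow> h z x y = cdot x (H z *v vcnj y)"
    and h_hermitian: "z \<in> S \<Longrightarrow> h z y x = cnj (h z x y)"
    and h_pos: "z \<in> S \<Longrightarrow> x \<noteq> 0 \<Longrightarrow> \<exists>r>0. h z x x = complex_of_real r"
    and p_selfadjoint: "z \<in> S \<Longrightarrow> q \<in> J \<Longrightarrow> h z (p q z *v x) y = h z x (p q z *v y)"
    and metric: "open U \<Longrightarrow> U \<subseteq> S \<Longrightarrow> q \<in> J \<Longrightarrow> smooth_fun_on U \<sigma> \<Longrightarrow> smooth_fun_on U \<tau> \<Longrightarrow>
      (\<And>z. z \<in> U \<Longrightarrow> p q z *v \<sigma> z = \<sigma> z) \<Longrightarrow> (\<And>z. z \<in> U \<Longrightarrow> p q z *v \<tau> z = \<tau> z) \<Longrightarrow> z \<in> U \<Longrightarrow>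
      dir_deriv a (\<lambda>w. h w (\<sigma> w) (\<tau> w)) z = h z (dir_deriv a \<sigma> z) (\<tau> z) + h z (\<sigma> z) (dir_deriv a \<tau> z)"
    and dbar: "open U \<Longrightarrow> U \<subseteq> S \<Longrightarrow> smooth_section E U \<sigma> \<Longrightarrow> z \<in> U \<Longrightarrow>
      dir_deriv a \<sigma> z + \<i> *s dir_deriv (\<i> * a) \<sigma> z \<in> E z"
begin

definition P :: "complex \<Rightarrow> complex ^ 'n ^ 'n" where "P z = (\<Sum>q\<in>J. p q z)"

lemma E_iff: "z \<in> S \<Longrightarrow> v \<in> E z \<longleftrightarrow> P z *v v = v"
  by (simp add: E_def P_def)

lemma P_p: "z \<in> S \<Longrightarrow> q \<in> J \<Longrightarrow> P z ** p q z = p q z"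
proof -
  assume *: "z \<in> S" "q \<in> J"
  have "(\<Sum>r\<in>J. p r z ** p q z) = (\<Sum>r\<in>J. if r = q then p q z else 0)"
    by (rule sum.cong) (use * p_mult in auto)
  thus ?thesis unfolding P_def mm.sum_left using finite_J * by simp
qed

lemma p_P: "z \<in> S \<Longrightarrow> q \<in> J \<Longrightarrow> p q z ** P z = p q z"
  unfolding P_def mm.sum_right using finite_J p_mult[of z q] by (simp cong: if_cong)

lemma P_P: "z \<in> S \<Longrightarrow> P z ** P z = P z"
  using P_p unfolding P_def[of z] mm.sum_right by (simp add: P_def)

lemma P_in_E: "z \<in> S \<Longrightarrow> P z *v x \<in> E z"
  by (simp add: E_iff matrix_vector_mul_assoc P_P)

lemma p_in_E: "z \<in> S \<Longrightarrow> q \<in> J \<Longrightarrow> p q z *v x \<in> E z"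
  by (simp add: E_iff matrix_vector_mul_assoc P_p)

lemma subspace_E: "z \<in> S \<Longrightarrow> vec.subspace (E z)"
  by (auto simp: vec.subspace_def E_iff mv.add_right mv_scale_right mv.zero_right)

lemma smooth_P: "smooth_fun_on S P"
  unfolding P_def[abs_def] by (intro smooth_sum open_S smooth_p)

lemma smooth_section_iff:
  "U \<subseteq> S \<Longrightarrow> smooth_section E U \<sigma> \<longleftrightarrow> smooth_fun_on U \<sigma> \<and> (\<forall>z\<in>U. P z *v \<sigma> z = \<sigma> z)"
  unfolding smooth_section_def using E_iff by blast

lemma smooth_section_P: "smooth_section E S (\<lambda>z. P z *v v)"
  by (simp add: smooth_section_def P_in_E smooth_matrix_vector smooth_P smooth_const open_S)

lemma smooth_section_p: "q \<in> J \<Longrightarrow> smooth_section E S (\<lambda>z. p q z *v v)"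
  by (simp add: smooth_section_def p_in_E smooth_matrix_vector smooth_p smooth_const open_S)

lemma h_add_left: "z \<in> S \<Longrightarrow> h z (x + x') y = h z x y + h z x' y"
  by (simp add: h_H cdot_def distrib_right sum.distrib)

lemma h_scale_left: "z \<in> S \<Longrightarrow> h z (c *s x) y = c * h z x y"
  by (simp add: h_H cdot_def sum_distrib_left mult.assoc)

lemma h_add_right: "z \<in> S \<Longrightarrow> h z x (y + y') = h z x y + h z x y'"
  by (simp add: h_H mv.add_right cdot_add_right)

lemma h_scale_right: "z \<in> S \<Longrightarrow> h z x (c *s y) = cnj c * h z x y"
  by (simp add: h_H mv_scale_right cdot_scale_right)

lemma h_nondegenerate: "z \<in> S \<Longrightarrow> (\<And>y. h z x y = 0) \<Longrightarrow> x = 0"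
  using h_pos by fastforce

lemma P_selfadjoint: "z \<in> S \<Longrightarrow> h z (P z *v x) y = h z x (P z *v y)"
proof -
  assume z: "z \<in> S"
  have "h z (\<Sum>q\<in>K. p q z *v x) y = h z x (\<Sum>q\<in>K. p q z *v y)" if "finite K" "K \<subseteq> J" for K
    using that
  proof (induction K rule: finite_induct)
    case empty
    show ?case using z h_scale_left[of z 0 0 y] h_scale_right[of z x 0 0] by simp
  qed (use z p_selfadjoint in \<open>simp add: h_add_left h_add_right\<close>)
  thus ?thesis using finite_J by (simp add: P_def mv.sum_left)
qed

lemma invertible_H: assumes z: "z \<in> S" shows "invertible (H z)"
proof -
  have "y = 0" if "H z *v y = 0" for y
  proof -
    have "h z (vcnj y) (vcnj y) = 0" using that z by (simp add: h_H)
    thus ?thesis using h_pos[OF z, of "vcnj y"] by (metis less_irrefl of_real_eq_0_iff vcnj_vcnj vcnj_zero)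
  qed
  thus ?thesis unfolding invertible_left_inverse matrix_left_invertible_ker by blast
qed

lemma dir_deriv_h:
  assumes U: "open U" "U \<subseteq> S" "z \<in> U" and \<sigma>: "smooth_fun_on U \<sigma>" and \<tau>: "smooth_fun_on U \<tau>"
  shows "dir_deriv a (\<lambda>w. h w (\<sigma> w) (\<tau> w)) z = h z (dir_deriv a \<sigma> z) (\<tau> z)
    + h z (\<sigma> z) (dir_deriv a \<tau> z) + cdot (\<sigma> z) (dir_deriv a H z *v vcnj (\<tau> z))"
proof -
  have z: "z \<in> S" using U by blast
  have d: "\<sigma> differentiable at z" "\<tau> differentiable at z" "H differentiable at z"
    using smooth_differentiable[OF \<sigma> U(3)] smooth_differentiable[OF \<tau> U(3)]
      smooth_differentiable[OF smooth_H z] by auto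
  have dv: "dir_deriv a (\<lambda>w. vcnj (\<tau> w)) z = vcnj (dir_deriv a \<tau> z)"
    by (rule dir_deriv_bounded_linear[OF bounded_linear_vcnj d(2)])
  have dv': "(\<lambda>w. vcnj (\<tau> w)) differentiable at z"
    using bounded_linear.has_derivative[OF bounded_linear_vcnj has_derivative_dir_deriv[OF d(2)]]
    by (auto simp: differentiable_def)
  have dm: "(\<lambda>w. H w *v vcnj (\<tau> w)) differentiable at z"
    using bounded_bilinear.FDERIV[OF bounded_bilinear_matrix_vector
        has_derivative_dir_deriv[OF d(3)] has_derivative_dir_deriv[OF dv']] by (auto simp: differentiable_def)
  have "dir_deriv a (\<lambda>w. h w (\<sigma> w) (\<tau> w)) z = dir_deriv a (\<lambda>w. cdot (\<sigma> w) (H w *v vcnj (\<tau> w))) z"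
    by (rule dir_deriv_cong[OF U(1,3)]) (use U(2) h_H in auto)
  also have "\<dots> = cdot (dir_deriv a \<sigma> z) (H z *v vcnj (\<tau> z))
      + cdot (\<sigma> z) (dir_deriv a H z *v vcnj (\<tau> z) + H z *v vcnj (dir_deriv a \<tau> z))"
    by (simp only: dir_deriv_bounded_bilinear[OF bounded_bilinear_cdot d(1) dm]
        dir_deriv_mv[OF d(3) dv'] dv)
  finally show ?thesis using z by (simp add: h_H cdot_add_right)
qed

lemma dir_deriv_H_hermitian:
  assumes z: "z \<in> S"
  shows "cdot y (dir_deriv a H z *v vcnj x) = cnj (cdot x (dir_deriv a H z *v vcnj y))"
proof -
  have D: "dir_deriv a (\<lambda>w. h w u v) z = cdot u (dir_deriv a H z *v vcnj v)" for u v
    using dir_deriv_h[OF open_S subset_refl z smooth_const smooth_const, of a u v]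
      h_scale_left[OF z, of 0 0 v] h_scale_right[OF z, of u 0 0] by (simp add: dir_deriv_const)
  have sm: "smooth_fun_on S (\<lambda>w. h w x y)"
    using smooth_cdot[OF open_S smooth_const smooth_matrix_vector[OF open_S smooth_H smooth_const], of x "vcnj y"]
      smooth_cong[OF open_S, of "\<lambda>w. h w x y" "\<lambda>w. cdot x (H w *v vcnj y)"] h_H by blast
  have "dir_deriv a (\<lambda>w. h w y x) z = dir_deriv a (\<lambda>w. cnj (h w x y)) z"
    by (rule dir_deriv_cong[OF open_S z]) (rule h_hermitian)
  also have "\<dots> = cnj (dir_deriv a (\<lambda>w. h w x y) z)"
    by (rule dir_deriv_bounded_linear[OF bounded_linear_cnj smooth_differentiable[OF sm z]])
  finally show ?thesis unfolding D .
qed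

text \<open>\<open>dH a\<close> is the holomorphic derivative of the Gram matrix in the direction \<open>a\<close>. The Chern
  connection of the trivial bundle with the metric \<open>h\<close> is \<open>d + K\<close>, that of \<open>E\<close> its projection.\<close>

definition dH :: "complex \<Rightarrow> complex \<Rightarrow> complex ^ 'n ^ 'n"
  where "dH a z = (1 / 2) *\<^sub>R (dir_deriv a H z - mat \<i> ** dir_deriv (\<i> * a) H z)"

definition K :: "complex \<Rightarrow> complex \<Rightarrow> complex ^ 'n ^ 'n"
  where "K a z = transpose (dH a z ** matrix_inv (H z))"

definition D0 :: "complex \<Rightarrow> (complex \<Rightarrow> complex ^ 'n) \<Rightarrow> complex \<Rightarrow> complex ^ 'n"
  where "D0 a \<sigma> z = P z *v (dir_deriv a \<sigma> z + K a z *v \<sigma> z)"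

lemma h_K: "z \<in> S \<Longrightarrow> h z (K a z *v x) y = cdot x (dH a z *v vcnj y)"
  unfolding h_H K_def cdot_transpose transpose_transpose
  by (simp add: matrix_vector_mul_assoc matrix_mul_assoc[symmetric] matrix_inv_left[OF invertible_H])

lemma dH_v: "dH a z *v x = (1 / 2) *s (dir_deriv a H z *v x - \<i> *s (dir_deriv (\<i> * a) H z *v x))"
  unfolding dH_def mv.scaleR_left mv.diff_left mat_mv scaleR_vec_eq by simp

lemma smooth_K: "smooth_fun_on S (K a)"
  unfolding K_def[abs_def] dH_def
  by (intro smooth_bounded_linear[OF open_S bounded_linear_transpose] smooth_matrix_matrix open_S
      smooth_bounded_linear[OF open_S bounded_linear_scaleR_right] smooth_diff smooth_const
      smooth_dir_deriv smooth_H smooth_matrix_inv invertible_H)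

lemma D0_chern: "is_chern_connection S E h D0"
proof -
  have conn: "is_connection S E D0"
    unfolding is_connection_def
  proof (intro allI impI conjI ballI)
    fix U \<sigma> assume U: "open U \<and> U \<subseteq> S" and \<sigma>: "smooth_section E U \<sigma>"
    have sm: "smooth_fun_on U \<sigma>" and P\<sigma>: "\<And>z. z \<in> U \<Longrightarrow> P z *v \<sigma> z = \<sigma> z"
      using \<sigma> U by (auto simp: smooth_section_iff)
    have d\<sigma>: "\<sigma> differentiable at z" if "z \<in> U" for z using smooth_differentiable[OF sm that] .
    have UP: "smooth_fun_on U P" "smooth_fun_on U (K a)" for a
      using smooth_subset[OF smooth_P] smooth_subset[OF smooth_K] U by auto
    show "smooth_section E U (D0 a \<sigma>)" for a
      unfolding smooth_section_def D0_def
      using U P_in_E by (auto intro!: smooth_matrix_vector smooth_add smooth_dir_deriv UP sm)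
    {
      fix a b x y z assume z: "z \<in> U"
      have zS: "z \<in> S" using U z by blast
      have dHd: "H differentiable at z" using smooth_differentiable[OF smooth_H zS] .
      have dHl: "dH (complex_of_real x * a + complex_of_real y * b) z = x *\<^sub>R dH a z + y *\<^sub>R dH b z"
      proof -
        have "\<i> * (complex_of_real x * a + complex_of_real y * b)
            = complex_of_real x * (\<i> * a) + complex_of_real y * (\<i> * b)" by (simp add: algebra_simps)
        thus ?thesis
          unfolding dH_def by (simp only: dir_deriv_real_linear[OF dHd] mm.add_right mm.scaleR_right)
            (simp add: algebra_simps)
      qed
      have "K (complex_of_real x * a + complex_of_real y * b) z = x *\<^sub>R K a z + y *\<^sub>R K b z"
        unfolding K_def dHl mm.add_left mm.scaleR_left
        by (simp only: linear_add[OF bounded_linear.linear[OF bounded_linear_transpose]]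
            linear_cmul[OF bounded_linear.linear[OF bounded_linear_transpose]])
      thus "D0 (complex_of_real x * a + complex_of_real y * b) \<sigma> z = x *\<^sub>R D0 a \<sigma> z + y *\<^sub>R D0 b \<sigma> z"
        unfolding D0_def dir_deriv_real_linear[OF d\<sigma>[OF z]]
        by (simp add: mv.add_left mv.add_right mv.scaleR_left mv.scaleR_right algebra_simps)
    }
    {
      fix \<tau> a z assume \<tau>: "smooth_section E U \<tau>" and z: "z \<in> U"
      have "\<tau> differentiable at z" using \<tau> z smooth_differentiable by (auto simp: smooth_section_def)
      thus "D0 a (\<lambda>w. \<sigma> w + \<tau> w) z = D0 a \<sigma> z + D0 a \<tau> z"
        unfolding D0_def dir_deriv_add[OF d\<sigma>[OF z]]
        by (simp add: dir_deriv_add[OF d\<sigma>[OF z]] mv.add_right algebra_simps)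
    }
    {
      fix \<tau> a z assume "\<forall>z\<in>U. \<tau> z = \<sigma> z" and z: "z \<in> U"
      thus "D0 a \<tau> z = D0 a \<sigma> z"
        unfolding D0_def using dir_deriv_cong[of U z \<tau> \<sigma> a] U by auto
    }
    {
      fix \<phi> :: "complex \<Rightarrow> complex" and a z
      assume \<phi>: "smooth_fun_on U \<phi>" and z: "z \<in> U"
      have "dir_deriv a (\<lambda>w. \<phi> w *s \<sigma> w) z = dir_deriv a \<phi> z *s \<sigma> z + \<phi> z *s dir_deriv a \<sigma> z"
        by (rule dir_deriv_vs[OF smooth_differentiable[OF \<phi> z] d\<sigma>[OF z]])
      thus "D0 a (\<lambda>w. \<phi> w *s \<sigma> w) z = dir_deriv a \<phi> z *s \<sigma> z + \<phi> z *s D0 a \<sigma> z"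
        unfolding D0_def using P\<sigma>[OF z]
        by (simp add: mv.add_right mv_scale_right vec.scale_right_distrib)
    }
  qed
  show ?thesis
    unfolding is_chern_connection_def
  proof (intro conjI conn allI impI ballI)
    fix U \<sigma> \<tau> a z
    assume U: "open U \<and> U \<subseteq> S" and st: "smooth_section E U \<sigma> \<and> smooth_section E U \<tau>" and z: "z \<in> U"
    have zS: "z \<in> S" using U z by blast
    have sm: "smooth_fun_on U \<sigma>" "smooth_fun_on U \<tau>" and Pst: "P z *v \<sigma> z = \<sigma> z" "P z *v \<tau> z = \<tau> z"
      using st U z by (auto simp: smooth_section_iff)
    have half: "h z (D0 a \<sigma> z) y = h z (dir_deriv a \<sigma> z) y + cdot (\<sigma> z) (dH a z *v vcnj y)"
      if "P z *v y = y" for \<sigma> y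
      unfolding D0_def P_selfadjoint[OF zS] that h_add_left[OF zS] h_K[OF zS] ..
    \<comment> \<open>The derivative of \<open>H\<close> is Hermitian in every direction, so in the
      sum the terms with direction \<open>i a\<close> cancel and the two halves in direction
      \<open>a\<close> add up.\<close>
    have sum: "cdot x (dH a z *v vcnj y) + cnj (cdot y (dH a z *v vcnj x)) = cdot x (dir_deriv a H z *v vcnj y)" for x y
      unfolding dH_v cdot_scale_right cdot_diff_right complex_cnj_mult complex_cnj_diff
        dir_deriv_H_hermitian[OF zS, of x _ y, symmetric]
      by (simp add: algebra_simps)
    have "h z (\<sigma> z) (D0 a \<tau> z) = h z (\<sigma> z) (dir_deriv a \<tau> z) + cnj (cdot (\<tau> z) (dH a z *v vcnj (\<sigma> z)))"
      using half[OF Pst(1), of \<tau>] h_hermitian[OF zS, of "\<sigma> z"] by simp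
    thus "dir_deriv a (\<lambda>w. h w (\<sigma> w) (\<tau> w)) z = h z (D0 a \<sigma> z) (\<tau> z) + h z (\<sigma> z) (D0 a \<tau> z)"
      unfolding half[OF Pst(2)] dir_deriv_h[OF conjunct1[OF U] conjunct2[OF U] z sm] sum[symmetric] by simp
  next
    fix U \<sigma> a z assume U: "open U \<and> U \<subseteq> S" and \<sigma>: "smooth_section E U \<sigma>" and z: "z \<in> U"
    have zS: "z \<in> S" using U z by blast
    have dHd: "H differentiable at z" using smooth_differentiable[OF smooth_H zS] .
    \<comment> \<open>Multiplying the direction by \<open>i\<close> twice changes the sign; this
      gives \<open>dH (i a) = i dH a\<close>, the complex linearity in the direction.\<close>
    have neg: "dir_deriv (\<i> * (\<i> * a)) H z *v x = - (dir_deriv a H z *v x)" for x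
      by (simp add: dir_deriv_uminus_dir[OF dHd] mv.minus_left)
    have "dH a z *v x + \<i> *s (dH (\<i> * a) z *v x) = 0" for x
      unfolding dH_v neg by (simp add: vec_eq_iff algebra_simps)
    hence "h z (K a z *v x + \<i> *s (K (\<i> * a) z *v x)) y = 0" for x y
      unfolding h_add_left[OF zS] h_scale_left[OF zS] h_K[OF zS]
      by (simp flip: cdot_scale_right cdot_add_right)
    hence Kz: "K a z *v x + \<i> *s (K (\<i> * a) z *v x) = 0" for x by (rule h_nondegenerate[OF zS])
    have "D0 a \<sigma> z + \<i> *s D0 (\<i> * a) \<sigma> z = P z *v (dir_deriv a \<sigma> z + \<i> *s dir_deriv (\<i> * a) \<sigma> z)
        + P z *v (K a z *v \<sigma> z + \<i> *s (K (\<i> * a) z *v \<sigma> z))"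
      unfolding D0_def by (simp add: mv.add_right mv_scale_right vec.scale_right_distrib algebra_simps)
    also have "\<dots> = dir_deriv a \<sigma> z + \<i> *s dir_deriv (\<i> * a) \<sigma> z"
      unfolding Kz using dbar[OF conjunct1[OF U] conjunct2[OF U] \<sigma> z] zS by (simp add: E_iff mv.zero_right)
    finally show "D0 a \<sigma> z + \<i> *s D0 (\<i> * a) \<sigma> z = dir_deriv a \<sigma> z + \<i> *s dir_deriv (\<i> * a) \<sigma> z" .
  qed
qed


lemma D_P_section:
  assumes U: "open U" "U \<subseteq> S" and \<sigma>: "smooth_section E U \<sigma>" and z: "z \<in> U"
  shows "dir_deriv a \<sigma> z = dir_deriv a P z *v \<sigma> z + P z *v dir_deriv a \<sigma> z"
proof -
  have sm: "smooth_fun_on U \<sigma>" and P\<sigma>: "\<And>z. z \<in> U \<Longrightarrow> P z *v \<sigma> z = \<sigma> z"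
    using \<sigma> U by (auto simp: smooth_section_iff)
  have "dir_deriv a \<sigma> z = dir_deriv a (\<lambda>w. P w *v \<sigma> w) z"
    by (rule dir_deriv_cong[OF U(1) z]) (simp add: P\<sigma>)
  also have "\<dots> = dir_deriv a P z *v \<sigma> z + P z *v dir_deriv a \<sigma> z"
    using z U by (intro dir_deriv_mv smooth_differentiable[OF smooth_P] smooth_differentiable[OF sm]) auto
  finally show ?thesis .
qed

lemma diff_P: "z \<in> S \<Longrightarrow> P differentiable at z" and diff_p: "z \<in> S \<Longrightarrow> q \<in> J \<Longrightarrow> p q differentiable at z"
  using smooth_differentiable[OF smooth_P] smooth_differentiable[OF smooth_p] by auto

text \<open>Differentiate \<open>P P = P\<close> and multiply by \<open>P\<close> on both sides: the
  result is twice itself.\<close>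

lemma P_DP_P: assumes z: "z \<in> S" shows "P z ** dir_deriv a P z ** P z = 0"
proof -
  have "dir_deriv a P z = dir_deriv a (\<lambda>w. P w ** P w) z"
    by (rule dir_deriv_cong[OF open_S z]) (simp add: P_P)
  also have "\<dots> = dir_deriv a P z ** P z + P z ** dir_deriv a P z"
    by (rule dir_deriv_mm[OF diff_P diff_P]) (fact z)+
  finally have eq: "dir_deriv a P z = dir_deriv a P z ** P z + P z ** dir_deriv a P z" .
  have "P z ** dir_deriv a P z ** P z = P z ** (dir_deriv a P z ** P z + P z ** dir_deriv a P z) ** P z"
    using eq by simp
  also have "\<dots> = P z ** dir_deriv a P z ** P z + P z ** dir_deriv a P z ** P z"
    using P_P[OF z] by (simp add: mm.add_left mm.add_right matrix_mul_assoc)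
      (simp flip: matrix_mul_assoc)
  finally show ?thesis by simp
qed

lemma p_Dp_p: assumes z: "z \<in> S" and q: "q \<in> J" shows "p q z ** dir_deriv a (p q) z ** p q z = 0"
proof -
  have pp: "p q z ** p q z = p q z" if "z \<in> S" for z using p_mult[OF that q q] by simp
  have "dir_deriv a (p q) z = dir_deriv a (\<lambda>w. p q w ** p q w) z"
    by (rule dir_deriv_cong[OF open_S z]) (simp add: pp)
  also have "\<dots> = dir_deriv a (p q) z ** p q z + p q z ** dir_deriv a (p q) z"
    by (rule dir_deriv_mm[OF diff_p diff_p]) (fact z q)+
  finally have eq: "dir_deriv a (p q) z = dir_deriv a (p q) z ** p q z + p q z ** dir_deriv a (p q) z" .
  have "p q z ** dir_deriv a (p q) z ** p q z
      = p q z ** (dir_deriv a (p q) z ** p q z + p q z ** dir_deriv a (p q) z) ** p q z"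
    using eq by simp
  also have "\<dots> = p q z ** dir_deriv a (p q) z ** p q z + p q z ** dir_deriv a (p q) z ** p q z"
    using pp[OF z] by (simp add: mm.add_left mm.add_right matrix_mul_assoc)
      (simp flip: matrix_mul_assoc)
  finally show ?thesis by simp
qed

section \<open>Connections given by a matrix form relative to the projected derivative\<close>

definition conn :: "(complex \<Rightarrow> complex \<Rightarrow> complex ^ 'n ^ 'n) \<Rightarrow> complex \<Rightarrow> (complex \<Rightarrow> complex ^ 'n)
    \<Rightarrow> complex \<Rightarrow> complex ^ 'n"
  where "conn C a \<sigma> z = P z *v dir_deriv a \<sigma> z + C a z *v \<sigma> z"

text \<open>The expansion of \<open>[conn C a, conn C b]\<close> on sections of \<open>E\<close>; the derivatives of the section drop
  out because \<open>P \<sigma> = \<sigma>\<close> and \<open>P (D P) P = 0\<close>.\<close>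

definition curv :: "(complex \<Rightarrow> complex \<Rightarrow> complex ^ 'n ^ 'n) \<Rightarrow> complex \<Rightarrow> complex \<Rightarrow> complex
    \<Rightarrow> complex ^ 'n ^ 'n"
  where "curv C a b z = (P z ** dir_deriv a P z ** dir_deriv b P z - P z ** dir_deriv b P z ** dir_deriv a P z)
    + (P z ** dir_deriv a (C b) z - P z ** dir_deriv b (C a) z)
    + (C b z ** dir_deriv a P z - C a z ** dir_deriv b P z)
    + (C a z ** C b z - C b z ** C a z)"

definition connection_form :: "(complex \<Rightarrow> complex \<Rightarrow> complex ^ 'n ^ 'n) \<Rightarrow> bool"
  where "connection_form C \<longleftrightarrow> (\<forall>a. smooth_fun_on S (C a) \<and> (\<forall>z\<in>S. P z ** C a z = C a z \<and> C a z ** P z = C a z))"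

lemma curv_conn:
  assumes C: "connection_form C" and U: "open U" "U \<subseteq> S" and \<sigma>: "smooth_section E U \<sigma>" and z: "z \<in> U"
  shows "conn C a (conn C b \<sigma>) z - conn C b (conn C a \<sigma>) z = curv C a b z *v \<sigma> z"
proof -
  have zS: "z \<in> S" using z U by blast
  have sm: "smooth_fun_on U \<sigma>" and P\<sigma>: "\<And>z. z \<in> U \<Longrightarrow> P z *v \<sigma> z = \<sigma> z"
    using \<sigma> U by (auto simp: smooth_section_iff)
  have dC: "C a differentiable at z" for a
    using C smooth_differentiable zS unfolding connection_form_def by blast
  have d\<sigma>: "\<sigma> differentiable at z" "dir_deriv b \<sigma> differentiable at z" for b
    using smooth_differentiable[OF sm z] smooth_differentiable[OF smooth_dir_deriv[OF sm] z] by auto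
  have PC: "P z ** C a z = C a z" "C a z ** P z = C a z" for a
    using C zS unfolding connection_form_def by auto
  have diff1: "(\<lambda>w. P w *v dir_deriv b \<sigma> w) differentiable at z" "(\<lambda>w. C b w *v \<sigma> w) differentiable at z" for b
    using bounded_bilinear.FDERIV[OF bounded_bilinear_matrix_vector
        has_derivative_dir_deriv[OF diff_P[OF zS]] has_derivative_dir_deriv[OF d\<sigma>(2)]]
      bounded_bilinear.FDERIV[OF bounded_bilinear_matrix_vector
        has_derivative_dir_deriv[OF dC] has_derivative_dir_deriv[OF d\<sigma>(1)]]
    by (auto simp: differentiable_def)
  define s where "s = \<sigma> z"
  define x where "x = (\<lambda>a. dir_deriv a \<sigma> z)"
  define y where "y = (\<lambda>a b. dir_deriv a (dir_deriv b \<sigma>) z)"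
  define p' where "p' = P z"
  define dp where "dp = (\<lambda>a. dir_deriv a P z)"
  define c where "c = (\<lambda>a. C a z)"
  define dc where "dc = (\<lambda>a b. dir_deriv a (C b) z)"
  have D: "dir_deriv a (conn C b \<sigma>) z = (dp a *v x b + p' *v y a b) + (dc a b *v s + c b *v x a)" for a b
    unfolding conn_def[abs_def] dir_deriv_add[OF diff1] dir_deriv_mv[OF diff_P[OF zS] d\<sigma>(2)]
      dir_deriv_mv[OF dC d\<sigma>(1)] s_def x_def y_def p'_def dp_def c_def dc_def ..
  have 1: "conn C a (conn C b \<sigma>) z = p' *v ((dp a *v x b + p' *v y a b) + (dc a b *v s + c b *v x a))
      + c a *v (p' *v x b + c b *v s)" for a b
    unfolding conn_def[of C a "conn C b \<sigma>"] D unfolding conn_def s_def x_def p'_def c_def ..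
  have ysym: "y a b = y b a" unfolding y_def by (rule dir_deriv_commute[OF U(1) sm z])
  have pp: "p' *v (p' *v v) = p' *v v" for v
    unfolding p'_def by (simp add: matrix_vector_mul_assoc P_P[OF zS])
  have pc: "p' *v (c a *v v) = c a *v v" for a v
    unfolding p'_def c_def by (simp add: matrix_vector_mul_assoc PC)
  have xdec: "x a = dp a *v s + p' *v x a" for a
    unfolding x_def dp_def s_def p'_def by (rule D_P_section[OF U \<sigma> z])
  have pdpp: "p' *v (dp a *v (p' *v v)) = 0" for a v
    using P_DP_P[OF zS, of a] unfolding p'_def dp_def
    by (simp add: matrix_vector_mul_assoc matrix_mul_assoc mv.zero_left)
  have pdx: "p' *v (dp a *v x b) = p' *v (dp a *v (dp b *v s))" for a b
    using arg_cong[OF xdec[of b], of "\<lambda>v. p' *v (dp a *v v)"] by (simp only: mv.add_right pdpp add_0_right)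
  have cx: "c b *v x a = c b *v (dp a *v s) + c b *v (p' *v x a)" for a b
    using arg_cong[OF xdec[of a], of "\<lambda>v. c b *v v"] by (simp only: mv.add_right)
  have cp: "c b *v (p' *v v) = c b *v v" for b v
    unfolding p'_def c_def by (simp add: matrix_vector_mul_assoc PC)
  have 2: "conn C a (conn C b \<sigma>) z = p' *v (dp a *v (dp b *v s)) + p' *v y a b + p' *v (dc a b *v s)
      + (c b *v (dp a *v s) + c b *v (p' *v x a)) + c a *v (p' *v x b) + c a *v (c b *v s)" for a b
    unfolding 1 mv.add_right pp pc pdx cx[of b a] by (simp add: algebra_simps)
  have "curv C a b z *v s = (p' *v (dp a *v (dp b *v s)) - p' *v (dp b *v (dp a *v s)))
      + (p' *v (dc a b *v s) - p' *v (dc b a *v s))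
      + (c b *v (dp a *v s) - c a *v (dp b *v s)) + (c a *v (c b *v s) - c b *v (c a *v s))"
    unfolding curv_def p'_def[symmetric] dp_def c_def dc_def
    by (simp only: mv.add_left mv.diff_left matrix_vector_mul_assoc[symmetric])
  thus ?thesis unfolding 2 s_def[symmetric] using ysym by (simp add: algebra_simps)
qed

lemma curv_in_E: "connection_form C \<Longrightarrow> z \<in> S \<Longrightarrow> curv C a b z *v v \<in> E z"
proof -
  assume C: "connection_form C" and z: "z \<in> S"
  have "P z ** C a z = C a z" for a using C z unfolding connection_form_def by auto
  hence "P z ** curv C a b z = curv C a b z"
    unfolding curv_def by (simp add: mm.add_right mm.diff_right matrix_mul_assoc P_P[OF z])
  thus ?thesis using z by (simp add: E_iff matrix_vector_mul_assoc)
qed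

text \<open>The terms of the curvature containing \<open>C\<close> contribute nothing: the trace of
  the derivative of \<open>C\<close> is the derivative of the zero function, the mixed terms contain
  \<open>P (D P) P = 0\<close>, and the quadratic term is a commutator.\<close>

lemma trace_curv:
  assumes C: "connection_form C" and tr: "\<And>a z. z \<in> S \<Longrightarrow> trace (C a z) = 0" and z: "z \<in> S"
  shows "trace (curv C a b z ** P z)
    = trace ((P z ** dir_deriv a P z ** dir_deriv b P z - P z ** dir_deriv b P z ** dir_deriv a P z) ** P z)"
proof -
  have smC: "smooth_fun_on S (C a)" and PC: "\<And>z. z \<in> S \<Longrightarrow> P z ** C a z = C a z"
    and CP: "\<And>z. z \<in> S \<Longrightarrow> C a z ** P z = C a z" for a
    using C unfolding connection_form_def by auto
  have dC: "C a differentiable at z" for a using smooth_differentiable[OF smC z] .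
  have DPC: "trace (dir_deriv a P z ** C b z) = 0" for a b
  proof -
    have "dir_deriv a P z ** C b z = (dir_deriv a P z ** P z) ** (C b z ** P z)"
      by (simp add: CP[OF z] PC[OF z] flip: matrix_mul_assoc)
    also have "trace \<dots> = trace ((C b z ** P z) ** (dir_deriv a P z ** P z))" by (rule trace_mul_sym)
    also have "(C b z ** P z) ** (dir_deriv a P z ** P z) = C b z ** (P z ** dir_deriv a P z ** P z)"
      by (simp add: matrix_mul_assoc)
    finally show ?thesis unfolding P_DP_P[OF z] by (simp add: mm.zero_right trace_def)
  qed
  have A: "trace (P z ** dir_deriv a (C b) z ** P z) = 0" for a b
  proof -
    have "trace (dir_deriv a (C b) z) = dir_deriv a (\<lambda>w. trace (C b w)) z"
      by (rule dir_deriv_bounded_linear[OF bounded_linear_trace dC, symmetric])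
    also have "\<dots> = dir_deriv a (\<lambda>w. 0) z"
      by (rule dir_deriv_cong[OF open_S z]) (rule tr)
    finally have 0: "trace (dir_deriv a (C b) z) = 0" by (simp add: dir_deriv_const)
    have "dir_deriv a (C b) z = dir_deriv a (\<lambda>w. P w ** C b w) z"
      by (rule dir_deriv_cong[OF open_S z]) (simp add: PC)
    also have "\<dots> = dir_deriv a P z ** C b z + P z ** dir_deriv a (C b) z"
      by (rule dir_deriv_mm[OF diff_P[OF z] dC])
    finally have "trace (dir_deriv a (C b) z) = trace (dir_deriv a P z ** C b z) + trace (P z ** dir_deriv a (C b) z)"
      by (metis trace_add)
    hence "trace (P z ** dir_deriv a (C b) z) = 0" using 0 DPC by simp
    moreover have "trace (P z ** dir_deriv a (C b) z ** P z) = trace (P z ** (P z ** dir_deriv a (C b) z))"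
      by (rule trace_mul_sym)
    ultimately show ?thesis by (simp add: matrix_mul_assoc P_P[OF z])
  qed
  have B: "trace (C b z ** dir_deriv a P z ** P z) = 0" for a b
  proof -
    have "C b z ** dir_deriv a P z ** P z = C b z ** (P z ** dir_deriv a P z ** P z)"
      by (simp add: matrix_mul_assoc CP[OF z])
    thus ?thesis unfolding P_DP_P[OF z] by (simp add: mm.zero_right trace_def)
  qed
  have Cc: "trace (C a z ** C b z ** P z) = trace (C b z ** C a z ** P z)" for a b
    by (simp add: CP[OF z] trace_mul_sym[of "C a z"] flip: matrix_mul_assoc)
  show ?thesis
    unfolding curv_def mm.add_left mm.diff_left trace_add trace_sub A B Cc[of a b] by simp
qed

text \<open>The form, relative to \<open>P d\<close>, of the sum of the connections
  \<open>p_q d\<close> on the summands: \<open>p_q d (p_q s)\<close> equals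
  \<open>p_q (d s) + p_q (d p_q) s\<close>. The last factor makes the form vanish on the kernel of
  \<open>P\<close>, as \<open>connection_form\<close> demands.\<close>

definition Mform :: "complex \<Rightarrow> complex \<Rightarrow> complex ^ 'n ^ 'n"
  where "Mform a z = (\<Sum>q\<in>J. p q z ** dir_deriv a (p q) z) ** P z"

lemma trace_zeroI:
  assumes z: "z \<in> S" and X: "X ** P z = X" and diag: "\<And>q. q \<in> J \<Longrightarrow> p q z ** X ** p q z = 0"
  shows "trace X = 0"
proof -
  have "trace X = trace (\<Sum>q\<in>J. X ** p q z)" using X by (simp add: P_def mm.sum_right)
  also have "\<dots> = (\<Sum>q\<in>J. trace (X ** p q z))"
    using linear_sum[OF bounded_linear.linear[OF bounded_linear_trace]] by blast
  also have "\<dots> = (\<Sum>q\<in>J. 0)"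
  proof (rule sum.cong[OF refl])
    fix q assume q: "q \<in> J"
    have "X ** p q z = X ** p q z ** p q z" using p_mult[OF z q q] by (simp flip: matrix_mul_assoc)
    hence "trace (X ** p q z) = trace (p q z ** (X ** p q z))" using trace_mul_sym by metis
    thus "trace (X ** p q z) = 0" using diag[OF q] by (simp add: matrix_mul_assoc trace_def)
  qed
  finally show ?thesis by simp
qed

lemma Mform_diag: "z \<in> S \<Longrightarrow> q \<in> J \<Longrightarrow> p q z ** Mform a z ** p q z = 0"
proof -
  assume z: "z \<in> S" and q: "q \<in> J"
  have "p q z ** Mform a z ** p q z = p q z ** (\<Sum>r\<in>J. p r z ** dir_deriv a (p r) z) ** p q z"
    unfolding Mform_def using P_p[OF z q] by (simp flip: matrix_mul_assoc)
  also have "\<dots> = (\<Sum>r\<in>J. if r = q then p q z ** dir_deriv a (p q) z ** p q z else 0)"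
    unfolding mm.sum_right mm.sum_left
  proof (rule sum.cong[OF refl])
    fix r assume r: "r \<in> J"
    show "p q z ** (p r z ** dir_deriv a (p r) z) ** p q z
        = (if r = q then p q z ** dir_deriv a (p q) z ** p q z else 0)"
      using p_mult[OF z q r] by (auto simp: matrix_mul_assoc mm.zero_left)
  qed
  also have "\<dots> = 0" using p_Dp_p[OF z q] finite_J by simp
  finally show ?thesis .
qed

lemma Mform_form: "connection_form Mform"
  unfolding connection_form_def
proof (intro allI conjI ballI)
  fix a
  show "smooth_fun_on S (Mform a)"
    unfolding Mform_def[abs_def]
    by (intro smooth_matrix_matrix smooth_sum smooth_P smooth_p smooth_dir_deriv open_S)
  fix z assume z: "z \<in> S"
  show "Mform a z ** P z = Mform a z"
    unfolding Mform_def using P_P[OF z] by (simp flip: matrix_mul_assoc)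
  have "P z ** (\<Sum>q\<in>J. p q z ** dir_deriv a (p q) z) = (\<Sum>q\<in>J. p q z ** dir_deriv a (p q) z)"
    unfolding mm.sum_right using P_p[OF z] by (intro sum.cong) (auto simp: matrix_mul_assoc)
  thus "P z ** Mform a z = Mform a z" unfolding Mform_def by (simp add: matrix_mul_assoc)
qed

lemma trace_Mform: "z \<in> S \<Longrightarrow> trace (Mform a z) = 0"
  using Mform_form Mform_diag by (intro trace_zeroI) (auto simp: connection_form_def)

lemma conn_Mform:
  assumes U: "open U" "U \<subseteq> S" and q: "q \<in> J" and sm: "smooth_fun_on U \<sigma>"
    and \<sigma>: "\<And>z. z \<in> U \<Longrightarrow> p q z *v \<sigma> z = \<sigma> z" and z: "z \<in> U"
  shows "conn Mform a \<sigma> z = p q z *v dir_deriv a \<sigma> z"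
proof -
  have zS: "z \<in> S" using z U by blast
  have P\<sigma>: "P z *v \<sigma> z = \<sigma> z"
    using \<sigma>[OF z] P_p[OF zS q] by (metis matrix_vector_mul_assoc)
  have "conn Mform a \<sigma> z = (\<Sum>r\<in>J. p r z *v dir_deriv a \<sigma> z + p r z *v (dir_deriv a (p r) z *v \<sigma> z))"
    unfolding conn_def Mform_def using P\<sigma>
    by (simp add: P_def mv.sum_left sum.distrib flip: matrix_vector_mul_assoc)
  also have "\<dots> = (\<Sum>r\<in>J. if r = q then p q z *v dir_deriv a \<sigma> z else 0)"
  proof (rule sum.cong[OF refl])
    fix r assume r: "r \<in> J"
    have d: "dir_deriv a (\<lambda>w. p r w *v \<sigma> w) z = dir_deriv a (p r) z *v \<sigma> z + p r z *v dir_deriv a \<sigma> z"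
      by (rule dir_deriv_mv[OF diff_p[OF zS r] smooth_differentiable[OF sm z]])
    have idem: "p r z *v (p r z *v x) = p r z *v x" for x
      using p_mult[OF zS r r] by (simp add: matrix_vector_mul_assoc)
    have e: "p r z *v dir_deriv a \<sigma> z + p r z *v (dir_deriv a (p r) z *v \<sigma> z)
        = p r z *v dir_deriv a (\<lambda>w. p r w *v \<sigma> w) z"
      unfolding d mv.add_right idem by (rule add.commute)
    show "p r z *v dir_deriv a \<sigma> z + p r z *v (dir_deriv a (p r) z *v \<sigma> z)
        = (if r = q then p q z *v dir_deriv a \<sigma> z else 0)"
    proof (cases "r = q")
      case True
      have "dir_deriv a (\<lambda>w. p r w *v \<sigma> w) z = dir_deriv a \<sigma> z"
        by (rule dir_deriv_cong[OF U(1) z]) (simp add: True \<sigma>)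
      thus ?thesis unfolding e using True by simp
    next
      case False
      have "p r w *v \<sigma> w = 0" if "w \<in> U" for w
      proof -
        have "p r w *v (p q w *v \<sigma> w) = 0"
          using p_mult[of w r q] that U r q False by (auto simp: matrix_vector_mul_assoc mv.zero_left)
        thus ?thesis using \<sigma>[OF that] by simp
      qed
      hence "dir_deriv a (\<lambda>w. p r w *v \<sigma> w) z = dir_deriv a (\<lambda>w. 0) z"
        by (intro dir_deriv_cong[OF U(1) z]) simp
      thus ?thesis unfolding e using False by (simp add: dir_deriv_const mv.zero_right)
    qed
  qed
  also have "\<dots> = p q z *v dir_deriv a \<sigma> z" using finite_J q by simp
  finally show ?thesis .
qed

text \<open>Since the curvature is tensorial, it may be computed on the section \<open>p_q v\<close>
  with \<open>v\<close> constant, whose derivative is \<open>(D p_q) v\<close>; the second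
  derivatives cancel by symmetry.\<close>

lemma curv_Mform:
  assumes z: "z \<in> S" and q: "q \<in> J" and v: "p q z *v v = v"
  shows "curv Mform a b z *v v = p q z *v (dir_deriv a (p q) z *v (dir_deriv b (p q) z *v v)
    - dir_deriv b (p q) z *v (dir_deriv a (p q) z *v v))"
proof -
  let ?s = "\<lambda>w. p q w *v v"
  have sm: "smooth_fun_on S ?s" and sec: "smooth_section E S ?s"
    using smooth_section_p[OF q] by (auto simp: smooth_section_def)
  have idem: "p q w *v (p q w *v x) = p q w *v x" if "w \<in> S" for w x
    using p_mult[OF that q q] by (simp add: matrix_vector_mul_assoc)
  have D: "dir_deriv a ?s w = dir_deriv a (p q) w *v v" if "w \<in> S" for a w
    using dir_deriv_mv[OF diff_p[OF that q], of "\<lambda>_. v" a] by (simp add: dir_deriv_const mv.zero_right)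
  have C: "conn Mform a (conn Mform b ?s) z
      = p q z *v (dir_deriv a (p q) z *v dir_deriv b ?s z) + p q z *v dir_deriv a (dir_deriv b ?s) z" for a b
  proof -
    let ?t = "\<lambda>w. p q w *v dir_deriv b ?s w"
    have smt: "smooth_fun_on S ?t"
      by (intro smooth_matrix_vector open_S smooth_p q smooth_dir_deriv sm)
    have 1: "conn Mform b ?s w = ?t w" if "w \<in> S" for w
      by (rule conn_Mform[OF open_S subset_refl q sm idem that])
    have 2: "dir_deriv a (conn Mform b ?s) z = dir_deriv a ?t z"
      by (rule dir_deriv_cong[OF open_S z]) (rule 1)
    have "conn Mform a (conn Mform b ?s) z = conn Mform a ?t z"
      unfolding conn_def[of Mform a] 1[OF z] 2 ..
    also have "\<dots> = p q z *v dir_deriv a ?t z"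
      by (rule conn_Mform[OF open_S subset_refl q smt idem z])
    also have "dir_deriv a ?t z = dir_deriv a (p q) z *v dir_deriv b ?s z + p q z *v dir_deriv a (dir_deriv b ?s) z"
      by (rule dir_deriv_mv[OF diff_p[OF z q] smooth_differentiable[OF smooth_dir_deriv[OF sm] z]])
    finally show ?thesis by (simp only: mv.add_right idem[OF z])
  qed
  have "curv Mform a b z *v v = curv Mform a b z *v ?s z" using v by simp
  also have "\<dots> = conn Mform a (conn Mform b ?s) z - conn Mform b (conn Mform a ?s) z"
    by (rule curv_conn[OF Mform_form open_S subset_refl sec z, symmetric])
  also have "\<dots> = p q z *v (dir_deriv a (p q) z *v dir_deriv b ?s z) - p q z *v (dir_deriv b (p q) z *v dir_deriv a ?s z)"
    unfolding C using dir_deriv_commute[OF open_S sm z, of a b] by simp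
  finally show ?thesis unfolding D[OF z] mv.diff_right .
qed

section \<open>An arbitrary Chern connection\<close>

context
  fixes N assumes N: "is_chern_connection S E h N"
begin

text \<open>\<open>N\<close> acts only on sections of \<open>E\<close>, so it is evaluated on the
  projected standard basis vectors; their images are the columns.\<close>

definition Nform :: "complex \<Rightarrow> complex \<Rightarrow> complex ^ 'n ^ 'n"
  where "Nform a z = (\<chi> r j. N a (\<lambda>w. P w *v axis j 1) z $ r) ** P z"

lemma N_conn: "is_connection S E N"
  using N by (simp add: is_chern_connection_def)

lemmas N_conn_iff = N_conn[unfolded is_connection_def, THEN spec, THEN mp, OF conjI, THEN spec, THEN mp]

lemma N_section: "open U \<Longrightarrow> U \<subseteq> S \<Longrightarrow> smooth_section E U \<sigma> \<Longrightarrow> smooth_section E U (N a \<sigma>)"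
  by (rule N_conn_iff[THEN conjunct1, THEN spec])

lemma N_add: "open U \<Longrightarrow> U \<subseteq> S \<Longrightarrow> smooth_section E U \<sigma> \<Longrightarrow> smooth_section E U \<tau> \<Longrightarrow> z \<in> U \<Longrightarrow>
    N a (\<lambda>w. \<sigma> w + \<tau> w) z = N a \<sigma> z + N a \<tau> z"
  by (rule N_conn_iff[THEN conjunct2, THEN conjunct2, THEN conjunct1, THEN spec, THEN mp, THEN spec, THEN bspec])

lemma N_cong: "open U \<Longrightarrow> U \<subseteq> S \<Longrightarrow> smooth_section E U \<sigma> \<Longrightarrow> (\<And>z. z \<in> U \<Longrightarrow> \<tau> z = \<sigma> z) \<Longrightarrow> z \<in> U \<Longrightarrow>
    N a \<tau> z = N a \<sigma> z"
  by (rule N_conn_iff[THEN conjunct2, THEN conjunct2, THEN conjunct2, THEN conjunct1, THEN spec, THEN mp,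
        THEN spec, THEN bspec]) simp_all

lemma N_scale: "open U \<Longrightarrow> U \<subseteq> S \<Longrightarrow> smooth_section E U \<sigma> \<Longrightarrow> smooth_fun_on U \<phi> \<Longrightarrow> z \<in> U \<Longrightarrow>
    N a (\<lambda>w. \<phi> w *s \<sigma> w) z = dir_deriv a \<phi> z *s \<sigma> z + \<phi> z *s N a \<sigma> z"
  by (rule N_conn_iff[THEN conjunct2, THEN conjunct2, THEN conjunct2, THEN conjunct2, THEN spec, THEN mp,
        THEN spec, THEN bspec])

lemma N_metric: "smooth_section E S \<sigma> \<Longrightarrow> smooth_section E S \<tau> \<Longrightarrow> z \<in> S \<Longrightarrow>
    dir_deriv a (\<lambda>w. h w (\<sigma> w) (\<tau> w)) z = h z (N a \<sigma> z) (\<tau> z) + h z (\<sigma> z) (N a \<tau> z)"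
  using N[unfolded is_chern_connection_def, THEN conjunct2, THEN spec, THEN mp, OF conjI[OF open_S subset_refl],
      THEN conjunct1] by simp

lemma N_dbar: "smooth_section E S \<sigma> \<Longrightarrow> z \<in> S \<Longrightarrow>
    N a \<sigma> z + \<i> *s N (\<i> * a) \<sigma> z = dir_deriv a \<sigma> z + \<i> *s dir_deriv (\<i> * a) \<sigma> z"
  using N[unfolded is_chern_connection_def, THEN conjunct2, THEN spec, THEN mp, OF conjI[OF open_S subset_refl],
      THEN conjunct2] by simp

lemma smooth_section_sum:
  assumes U: "open U" "U \<subseteq> S" and "\<And>i. i \<in> I \<Longrightarrow> smooth_section E U (\<sigma> i)"
  shows "smooth_section E U (\<lambda>w. \<Sum>i\<in>I. \<sigma> i w)"
  using assms subspace_E unfolding smooth_section_def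
  by (auto intro!: smooth_sum vec.subspace_sum)

lemma N_sum:
  assumes U: "open U" "U \<subseteq> S" "z \<in> U" and "finite I" and "\<And>i. i \<in> I \<Longrightarrow> smooth_section E U (\<sigma> i)"
  shows "N a (\<lambda>w. \<Sum>i\<in>I. \<sigma> i w) z = (\<Sum>i\<in>I. N a (\<sigma> i) z)"
  using assms(4,5)
proof (induction I rule: finite_induct)
  case empty
  have 0: "smooth_section E U (\<lambda>_. 0)" using smooth_section_sum[OF U(1,2), of "{}"] by simp
  have "N a (\<lambda>w. 0) z = N a (\<lambda>w. 0) z + N a (\<lambda>w. 0) z"
    using N_add[OF U(1,2) 0 0 U(3), of a] by simp
  thus ?case by simp
next
  case (insert i I)
  thus ?case using N_add[OF U(1,2) _ smooth_section_sum[OF U(1,2)] U(3), of "\<sigma> i" I \<sigma> a] by simp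
qed

text \<open>A section of \<open>E\<close> is fixed by \<open>P\<close>, hence is the combination of
  the projected basis vectors with its own coordinates as coefficients. The Leibniz rule applied to
  this combination gives \<open>P d\<close> plus the matrix.\<close>

lemma N_form:
  assumes U: "open U" "U \<subseteq> S" and \<sigma>: "smooth_section E U \<sigma>" and z: "z \<in> U"
  shows "N a \<sigma> z = conn Nform a \<sigma> z"
proof -
  have zS: "z \<in> S" using z U by blast
  have sm: "smooth_fun_on U \<sigma>" and P\<sigma>: "\<And>z. z \<in> U \<Longrightarrow> P z *v \<sigma> z = \<sigma> z"
    using \<sigma> U by (auto simp: smooth_section_iff)
  let ?e = "\<lambda>j w. P w *v axis j 1"
  have e: "smooth_section E U (?e j)" for j
    by (rule smooth_section_subset[OF smooth_section_P U(2)])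
  have smj: "smooth_fun_on U (\<lambda>w. \<sigma> w $ j)" for j using sm by (simp add: smooth_vec_iff[OF U(1)])
  have es: "smooth_section E U (\<lambda>w. \<sigma> w $ j *s ?e j w)" for j
    using e[of j] smj U subspace_E unfolding smooth_section_def
    by (auto intro!: smooth_vec_scale vec.subspace_scale)
  have exp: "(\<Sum>j\<in>UNIV. x $ j *s (M *v axis j 1)) = M *v x" for x :: "complex ^ 'n" and M :: "complex ^ 'n ^ 'n"
  proof -
    have "(\<Sum>j\<in>UNIV. x $ j *s (M *v axis j 1)) = M *v (\<Sum>j\<in>UNIV. x $ j *s axis j 1)"
      by (simp only: mv.sum_right mv_scale_right)
    thus ?thesis by (simp add: basis_expansion)
  qed
  have "N a \<sigma> z = N a (\<lambda>w. \<Sum>j\<in>UNIV. \<sigma> w $ j *s ?e j w) z"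
    by (rule N_cong[OF U smooth_section_sum[OF U es]]) (use P\<sigma> z in \<open>auto simp: exp\<close>)
  also have "\<dots> = (\<Sum>j\<in>UNIV. N a (\<lambda>w. \<sigma> w $ j *s ?e j w) z)"
    by (rule N_sum[OF U z _ es]) simp
  also have "\<dots> = (\<Sum>j\<in>UNIV. dir_deriv a (\<lambda>w. \<sigma> w $ j) z *s ?e j z + \<sigma> z $ j *s N a (?e j) z)"
    by (intro sum.cong refl N_scale[OF U e smj z])
  also have "\<dots> = (\<Sum>j\<in>UNIV. dir_deriv a \<sigma> z $ j *s ?e j z) + (\<Sum>j\<in>UNIV. \<sigma> z $ j *s N a (?e j) z)"
    using dir_deriv_bounded_linear[OF bounded_linear_vec_nth smooth_differentiable[OF sm z]]
    by (simp add: sum.distrib)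
  also have "(\<Sum>j\<in>UNIV. dir_deriv a \<sigma> z $ j *s ?e j z) = P z *v dir_deriv a \<sigma> z" by (rule exp)
  also have "(\<Sum>j\<in>UNIV. \<sigma> z $ j *s N a (?e j) z) = (\<chi> r j. N a (?e j) z $ r) *v \<sigma> z"
    by (simp add: vec_eq_iff matrix_vector_mult_def mult.commute)
  also have "\<dots> = Nform a z *v \<sigma> z"
    unfolding Nform_def using P\<sigma>[OF z] by (simp flip: matrix_vector_mul_assoc)
  finally show ?thesis by (simp add: conn_def)
qed

lemma Nform_form: "connection_form Nform"
  unfolding connection_form_def
proof (intro allI conjI ballI)
  fix a
  have sec: "smooth_section E S (N a (\<lambda>w. P w *v axis j 1))" for j
    by (rule N_section[OF open_S subset_refl smooth_section_P])
  have "smooth_fun_on S (\<lambda>z. (\<chi> r j. N a (\<lambda>w. P w *v axis j 1) z $ r) :: complex ^ 'n ^ 'n)"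
    using sec by (simp add: smooth_vec_iff[OF open_S] smooth_section_def)
  thus "smooth_fun_on S (Nform a)"
    unfolding Nform_def[abs_def] by (intro smooth_matrix_matrix open_S smooth_P)
  fix z assume z: "z \<in> S"
  show "Nform a z ** P z = Nform a z"
    unfolding Nform_def using P_P[OF z] by (simp flip: matrix_mul_assoc)
  have "P z *v N a (\<lambda>w. P w *v axis j 1) z = N a (\<lambda>w. P w *v axis j 1) z" for j
    using sec z by (auto simp: smooth_section_iff)
  hence "P z ** (\<chi> r j. N a (\<lambda>w. P w *v axis j 1) z $ r) = (\<chi> r j. N a (\<lambda>w. P w *v axis j 1) z $ r)"
    by (simp add: vec_eq_iff matrix_matrix_mult_def matrix_vector_mult_def)
  thus "P z ** Nform a z = Nform a z" unfolding Nform_def by (simp add: matrix_mul_assoc)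
qed

text \<open>On each block \<open>N\<close> and \<open>conn Mform\<close> are both metric with the same (0,1)-part, so their
  difference has no diagonal part.\<close>

lemma Nform_diag:
  assumes z: "z \<in> S" and q: "q \<in> J" shows "p q z ** Nform a z ** p q z = 0"
proof -
  let ?X = "\<lambda>a. p q z ** Nform a z ** p q z"
  let ?s = "\<lambda>v w. p q w *v v"
  have idem: "p q w *v (p q w *v x) = p q w *v x" if "w \<in> S" for w x
    using p_mult[OF that q q] by (simp add: matrix_vector_mul_assoc)
  have sec: "smooth_section E S (?s v)" and sm: "smooth_fun_on S (?s v)" for v
    using smooth_section_p[OF q] by (auto simp: smooth_section_def)
  have NP: "p q z *v N a (?s v) z = p q z *v dir_deriv a (?s v) z + ?X a *v v" for a v
    unfolding N_form[OF open_S subset_refl sec z] conn_def mv.add_right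
    using p_P[OF z q] by (simp add: matrix_vector_mul_assoc matrix_mul_assoc)
  have hp: "h z x (?s v z) = h z (p q z *v x) (?s v z)" "h z (?s v z) x = h z (?s v z) (p q z *v x)" for x v
    using p_selfadjoint[OF z q] idem[OF z] by metis+
  have skew: "h z (?X a *v v) (?s v' z) + h z (?s v z) (?X a *v v') = 0" for a v v'
  proof -
    have "dir_deriv a (\<lambda>w. h w (?s v w) (?s v' w)) z = h z (N a (?s v) z) (?s v' z) + h z (?s v z) (N a (?s v') z)"
      by (rule N_metric[OF sec sec z])
    also have "\<dots> = h z (p q z *v N a (?s v) z) (?s v' z) + h z (?s v z) (p q z *v N a (?s v') z)"
      using hp by metis
    also have "\<dots> = h z (p q z *v dir_deriv a (?s v) z) (?s v' z) + h z (?X a *v v) (?s v' z)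
        + (h z (?s v z) (p q z *v dir_deriv a (?s v') z) + h z (?s v z) (?X a *v v'))"
      unfolding NP h_add_left[OF z] h_add_right[OF z] ..
    also have "h z (p q z *v dir_deriv a (?s v) z) (?s v' z) = h z (dir_deriv a (?s v) z) (?s v' z)"
      using hp by metis
    also have "h z (?s v z) (p q z *v dir_deriv a (?s v') z) = h z (?s v z) (dir_deriv a (?s v') z)"
      using hp by metis
    finally show ?thesis
      using metric[OF open_S subset_refl q sm[of v] sm[of v'] idem idem z, of a] by simp
  qed
  \<comment> \<open>The (0,1)-part of \<open>N\<close> is that of \<open>d\<close>, so the block
    \<open>?X\<close> has none: it is complex linear in the direction.\<close>
  have Xi: "?X (\<i> * a) *v v = \<i> *s (?X a *v v)" for v
  proof -
    have "N a (?s v) z + \<i> *s N (\<i> * a) (?s v) z = dir_deriv a (?s v) z + \<i> *s dir_deriv (\<i> * a) (?s v) z"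
      by (rule N_dbar[OF sec z])
    from arg_cong[OF this, of "(*v) (p q z)"]
    have "p q z *v N a (?s v) z + \<i> *s (p q z *v N (\<i> * a) (?s v) z)
        = p q z *v dir_deriv a (?s v) z + \<i> *s (p q z *v dir_deriv (\<i> * a) (?s v) z)"
      by (simp only: mv.add_right mv_scale_right)
    hence "?X a *v v + \<i> *s (?X (\<i> * a) *v v) = 0"
      unfolding NP by (simp add: vec.scale_right_distrib algebra_simps)
    from arg_cong[OF this, of "(*s) \<i>"]
    show ?thesis by (simp add: vec.scale_right_distrib)
  qed
  \<comment> \<open>The block is skew-Hermitian in every direction. For direction
    \<open>i a\<close>, complex linearity turns the sum in \<open>skew\<close> into a difference, so
    sum and difference of the same two terms vanish.\<close>
  have "h z (?X a *v v) (?s v' z) = 0" for v v'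
  proof -
    have "h z (\<i> *s (?X a *v v)) (?s v' z) + h z (?s v z) (\<i> *s (?X a *v v')) = 0"
      using skew[of "\<i> * a" v v'] unfolding Xi .
    hence "\<i> * (h z (?X a *v v) (?s v' z) - h z (?s v z) (?X a *v v')) = 0"
      unfolding h_scale_left[OF z] h_scale_right[OF z] by (simp add: algebra_simps)
    thus ?thesis using skew[of a v v'] by simp
  qed
  moreover have "?s (?X a *v v) z = ?X a *v v" for v
    using p_mult[OF z q q] by (simp add: matrix_vector_mul_assoc matrix_mul_assoc)
  ultimately have "h z (?X a *v v) (?X a *v v) = 0" for v by metis
  hence "?X a *v v = 0" for v using h_pos[OF z] by fastforce
  thus ?thesis by (simp add: matrix_eq mv.zero_left)
qed

lemma trace_Nform: "z \<in> S \<Longrightarrow> trace (Nform a z) = 0"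
  using Nform_form Nform_diag by (intro trace_zeroI) (auto simp: connection_form_def)

text \<open>The choice in \<open>curvature\<close> is harmless: by \<open>curv_conn\<close> every
  section through \<open>v\<close> gives the same value, and \<open>P v\<close> for constant
  \<open>v\<close> is such a section.\<close>

lemma curvature_N:
  assumes z: "z \<in> S" and v: "v \<in> E z"
  shows "curvature S E N z a b v = curv Nform a b z *v v"
  unfolding curvature_def
proof (rule some_equality)
  have key: "N a (N b \<sigma>) z - N b (N a \<sigma>) z = curv Nform a b z *v \<sigma> z"
    if U: "open U" "U \<subseteq> S" "z \<in> U" and \<sigma>: "smooth_section E U \<sigma>" for U \<sigma>
  proof -
    have "N a (N b \<sigma>) z = conn Nform a (conn Nform b \<sigma>) z" for a b
    proof -
      have "N a (N b \<sigma>) z = conn Nform a (N b \<sigma>) z"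
        by (rule N_form[OF U(1,2) N_section[OF U(1,2) \<sigma>] U(3)])
      also have "\<dots> = conn Nform a (conn Nform b \<sigma>) z"
      proof -
        have "dir_deriv a (N b \<sigma>) z = dir_deriv a (conn Nform b \<sigma>) z"
          by (rule dir_deriv_cong[OF U(1,3)]) (rule N_form[OF U(1,2) \<sigma>])
        thus ?thesis unfolding conn_def[of Nform a] N_form[OF U(1,2) \<sigma> U(3)] by simp
      qed
      finally show ?thesis .
    qed
    thus ?thesis using curv_conn[OF Nform_form U(1,2) \<sigma> U(3)] by simp
  qed
  have Pv: "P z *v v = v" using v z by (simp add: E_iff)
  show "\<exists>U \<sigma>. open U \<and> z \<in> U \<and> U \<subseteq> S \<and> smooth_section E U \<sigma> \<and> \<sigma> z = v \<and>
      curv Nform a b z *v v = N a (N b \<sigma>) z - N b (N a \<sigma>) z"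
    using open_S z smooth_section_P[of v] key[OF open_S subset_refl z smooth_section_P[of v]] Pv
    by (intro exI[of _ S] exI[of _ "\<lambda>w. P w *v v"]) simp
  show "w = curv Nform a b z *v v"
    if "\<exists>U \<sigma>. open U \<and> z \<in> U \<and> U \<subseteq> S \<and> smooth_section E U \<sigma> \<and> \<sigma> z = v \<and>
      w = N a (N b \<sigma>) z - N b (N a \<sigma>) z" for w
    using that key by metis
qed

end

theorem trace_chern_curvature:
  assumes z: "z \<in> S"
  shows "trace_on (E z) (curvature S E (chern_connection S E h) z a b)
    = trace_on (E z) (\<lambda>v. curv Mform a b z *v v)"
proof -
  have N: "is_chern_connection S E h (chern_connection S E h)"
    unfolding chern_connection_def by (rule someI[of _ D0]) (rule D0_chern)
  note nf = Nform_form[OF N] and tr = trace_Nform[OF N]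
  have P: "P z *v x \<in> E z" "v \<in> E z \<Longrightarrow> P z *v v = v" for x v
    using P_in_E[OF z] by (auto simp: E_iff[OF z])
  have "trace_on (E z) (curvature S E (chern_connection S E h) z a b)
      = trace (curv (Nform (chern_connection S E h)) a b z ** P z)"
    by (rule trace_on_eq_trace[OF subspace_E[OF z] curvature_N[OF N z] curv_in_E[OF nf z] P])
  also have "\<dots> = trace (curv Mform a b z ** P z)"
    by (rule trans[OF trace_curv[OF nf _ z] trace_curv[OF Mform_form _ z, symmetric]])
      (rule tr, assumption, rule trace_Mform)
  also have "\<dots> = trace_on (E z) (\<lambda>v. curv Mform a b z *v v)"
    by (rule trace_on_eq_trace[OF subspace_E[OF z] refl curv_in_E[OF Mform_form z] P, symmetric])
  finally show ?thesis .
qed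

end

section \<open>Infinitesimal automorphisms and traces\<close>

lemma (in direct_family) bounded_linear_comp: "bounded_linear (comp i)"
  unfolding linear_conv_bounded_linear[symmetric]
  by (rule linearI) (simp_all add: comp_add comp_scale scaleR_vec_eq)

context polarized_hodge begin

lemma Wc_iff: "x \<in> Wc k \<longleftrightarrow> (\<forall>a b. k < a + b \<longrightarrow> comp (a, b) x = 0)"
  unfolding Wc_eq span_eq by auto

lemma F_W_iff: "x \<in> F p \<inter> Wc k \<longleftrightarrow> (\<forall>a b. a < p \<or> k < a + b \<longrightarrow> comp (a, b) x = 0)"
  unfolding F_W_eq span_eq by (auto simp: not_le)

lemma Wc_dir_deriv:
  assumes U: "open U" "z \<in> U" and f: "f differentiable at z" "\<And>w. w \<in> U \<Longrightarrow> f w \<in> Wc k"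
  shows "dir_deriv a f z \<in> Wc k"
  unfolding Wc_iff
proof (intro allI impI)
  fix p q assume pq: "k < p + q"
  have "comp (p, q) (dir_deriv a f z) = dir_deriv a (\<lambda>w. comp (p, q) (f w)) z"
    by (rule dir_deriv_bounded_linear[OF bounded_linear_comp f(1), symmetric])
  also have "\<dots> = dir_deriv a (\<lambda>w. 0) z"
    by (rule dir_deriv_cong[OF U]) (use f(2) pq in \<open>simp add: Wc_iff\<close>)
  finally show "comp (p, q) (dir_deriv a f z) = 0" by (simp add: dir_deriv_const)
qed

lemma h_Q_right:
  assumes "x \<in> I (p, q)" "y \<in> Wc (p + q)"
  shows "h x y = \<i> powi (p - q) * Qc (p + q) x (vcnj y)"
  using h_hermitian[of x y] h_Q[OF assms(2,1)] hQ_hermitian[OF assms(2) I_Wc[OF assms(1)]] by simp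

lemma h_comp_selfadjoint: "h (comp i x) y = h x (comp i y)"
proof -
  have "h (comp i x) y = cnj (h y (comp i x))" by (rule h_hermitian)
  also have "h y (comp i x) = h (comp i y) (comp i x)" by (rule h_comp_left[OF comp_in, symmetric])
  also have "cnj \<dots> = h (comp i x) (comp i y)" by (rule h_hermitian[symmetric])
  also have "\<dots> = h x (comp i y)" by (rule h_comp_left[OF comp_in])
  finally show ?thesis .
qed

section \<open>The Lie algebra and the types of its elements\<close>

abbreviation "lie \<equiv> lie_algebra (G_C W Q)"

lemma G_C_mult:
  assumes "g \<in> G_C W Q" "g' \<in> G_C W Q" shows "g ** g' \<in> G_C W Q"
proof -
  have g: "invertible g" "\<And>k. (*v) g ` Wc k = Wc k"
    "\<And>k x y. x \<in> Wc k \<Longrightarrow> y \<in> Wc k \<Longrightarrow> Qc k (g *v x) (g *v y) = Qc k x y"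
    and g': "invertible g'" "\<And>k. (*v) g' ` Wc k = Wc k"
    "\<And>k x y. x \<in> Wc k \<Longrightarrow> y \<in> Wc k \<Longrightarrow> Qc k (g' *v x) (g' *v y) = Qc k x y"
    using assms unfolding G_C_def by auto
  have "(*v) (g ** g') ` Wc k = Wc k" for k
  proof -
    have "(*v) (g ** g') ` Wc k = (*v) g ` ((*v) g' ` Wc k)"
      by (simp add: image_image flip: matrix_vector_mul_assoc)
    thus ?thesis by (simp only: g g')
  qed
  moreover have "Qc k ((g ** g') *v x) ((g ** g') *v y) = Qc k x y" if "x \<in> Wc k" "y \<in> Wc k" for k x y
    using g(3)[of "g' *v x" k "g' *v y"] g'(2)[of k] g'(3)[OF that] that
    by (simp flip: matrix_vector_mul_assoc) blast
  ultimately show ?thesis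
    unfolding G_C_def using invertible_mult[OF g(1) g'(1)] by auto
qed

text \<open>The sum is the velocity at 0 of the product of the two curves.\<close>

lemma lie_add:
  assumes "X \<in> lie" "Y \<in> lie" shows "X + Y \<in> lie"
proof -
  obtain \<gamma> \<gamma>' :: "real \<Rightarrow> complex ^ 'n ^ 'n" where
    *: "\<And>t. \<gamma> t \<in> G_C W Q" "\<gamma> 0 = mat 1" "(\<gamma> has_vector_derivative X) (at 0)"
    "\<And>t. \<gamma>' t \<in> G_C W Q" "\<gamma>' 0 = mat 1" "(\<gamma>' has_vector_derivative Y) (at 0)"
    using assms unfolding lie_algebra_def by blast
  have "((\<lambda>t. \<gamma> t ** \<gamma>' t) has_vector_derivative (\<gamma> 0 ** Y + X ** \<gamma>' 0)) (at 0)"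
    by (rule bounded_bilinear.has_vector_derivative[OF bounded_bilinear_matrix_matrix *(3,6)])
  hence "((\<lambda>t. \<gamma> t ** \<gamma>' t) has_vector_derivative (X + Y)) (at 0)"
    using * by (simp add: add.commute)
  thus ?thesis unfolding lie_algebra_def using * G_C_mult by (auto intro!: exI[of _ "\<lambda>t. \<gamma> t ** \<gamma>' t"])
qed

lemma lie_zero: "0 \<in> lie"
proof -
  have "mat 1 \<in> G_C W Q" unfolding G_C_def by (auto simp: invertible_def)
  thus ?thesis unfolding lie_algebra_def by (auto intro!: exI[of _ "\<lambda>_. mat 1"])
qed

lemma lie_scale:
  assumes "X \<in> lie" shows "c *\<^sub>R X \<in> lie"
proof -
  obtain \<gamma> :: "real \<Rightarrow> complex ^ 'n ^ 'n" where
    *: "\<And>t. \<gamma> t \<in> G_C W Q" "\<gamma> 0 = mat 1" "(\<gamma> has_vector_derivative X) (at 0)"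
    using assms unfolding lie_algebra_def by blast
  have 1: "((\<lambda>t. c * t) has_vector_derivative c) (at 0)"
    by (auto intro!: derivative_eq_intros simp: has_real_derivative_iff_has_vector_derivative[symmetric])
  have "((\<gamma> \<circ> (\<lambda>t. c * t)) has_vector_derivative c *\<^sub>R X) (at 0)"
    by (rule vector_diff_chain_at[OF 1]) (use * in simp)
  thus ?thesis unfolding lie_algebra_def using * by (auto intro!: exI[of _ "\<gamma> \<circ> (\<lambda>t. c * t)"])
qed

lemma lie_Wc:
  assumes "X \<in> lie" "v \<in> Wc k" shows "X *v v \<in> Wc k"
proof -
  obtain \<gamma> :: "real \<Rightarrow> complex ^ 'n ^ 'n" where
    *: "\<And>t. \<gamma> t \<in> G_C W Q" "\<gamma> 0 = mat 1" "(\<gamma> has_vector_derivative X) (at 0)"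
    using assms unfolding lie_algebra_def by blast
  have inW: "\<gamma> t *v v \<in> Wc k" for t using *(1)[of t] assms(2) unfolding G_C_def by blast
  have "comp (a, b) (X *v v) = 0" if ab: "k < a + b" for a b
  proof -
    have L: "bounded_linear (\<lambda>M. comp (a, b) (M *v v))"
      by (rule bounded_linear_compose[OF bounded_linear_comp mv.bounded_linear_left])
    have "((\<lambda>t. comp (a, b) (\<gamma> t *v v)) has_vector_derivative comp (a, b) (X *v v)) (at 0)"
      by (rule bounded_linear.has_vector_derivative[OF L *(3)])
    moreover have "(\<lambda>t. comp (a, b) (\<gamma> t *v v)) = (\<lambda>t. 0)" using inW ab by (auto simp: Wc_iff)
    ultimately have "((\<lambda>t. 0) has_vector_derivative comp (a, b) (X *v v)) (at 0)" by (simp only:)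
    from vector_derivative_unique_at[OF this has_vector_derivative_const] show ?thesis .
  qed
  thus ?thesis by (simp add: Wc_iff)
qed

lemma g_type_iff: "X \<in> g_type W Q F (r, s) \<longleftrightarrow>
    X \<in> lie \<and> (\<forall>p q. \<forall>v\<in>I (p, q). X *v v \<in> I (p + r, q + s))"
  by (simp add: g_type_def deligne_eq)

lemma g_type_zero: "0 \<in> g_type W Q F i"
  by (cases i) (simp add: g_type_iff lie_zero zero_in mv.zero_left)

lemma g_type_add: "X \<in> g_type W Q F i \<Longrightarrow> Y \<in> g_type W Q F i \<Longrightarrow> X + Y \<in> g_type W Q F i"
  by (cases i) (auto simp: g_type_iff mv.add_left intro: lie_add vec.subspace_add[OF subspace_I])

lemma g_type_scale: "X \<in> g_type W Q F i \<Longrightarrow> c *\<^sub>R X \<in> g_type W Q F i"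
  by (cases i) (auto simp: g_type_iff mv.scaleR_left scaleR_vec_eq intro: lie_scale vec.subspace_scale[OF subspace_I])

text \<open>The part of type \<open>(r, s)\<close> is determined on each \<open>I (p, q)\<close> as
  the component of \<open>X v\<close> in \<open>I (p + r, q + s)\<close>. With the existence in
  \<open>horizontal_decomposition\<close> this gives \<open>component\<close>, and hence
  \<open>alpha\<close>, its meaning for horizontal vectors.\<close>

lemma g_type_decomposition_unique:
  assumes c: "is_decomposition (g_type W Q F) X c" and d: "is_decomposition (g_type W Q F) X d"
  shows "c = d"
proof
  fix i :: "int \<times> int"
  obtain r s where i: "i = (r, s)" by (cases i)
  define J where "J = insert i ({i. c i \<noteq> 0} \<union> {i. d i \<noteq> 0})"
  have J: "finite J" using c d by (simp add: J_def is_decomposition_def)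
  have X: "X = sum c J" "X = sum d J"
    by (rule is_decomposition_sum[OF c J], simp add: J_def, rule is_decomposition_sum[OF d J], simp add: J_def)
  have pick: "comp (p + r, q + s) (X *v v) = e i *v v"
    if v: "v \<in> I (p, q)" and e: "\<And>j. e j \<in> g_type W Q F j" "X = sum e J" for v p q e
  proof -
    have "comp (p + r, q + s) (X *v v) = (\<Sum>j\<in>J. comp (p + r, q + s) (e j *v v))"
      unfolding e(2) mv.sum_left comp_sum ..
    also have "\<dots> = (\<Sum>j\<in>J. if j = i then e i *v v else 0)"
    proof (rule sum.cong[OF refl])
      fix j :: "int \<times> int"
      obtain r' s' where j: "j = (r', s')" by (cases j)
      have "e j *v v \<in> I (p + r', q + s')" using e(1)[of j] v unfolding j g_type_iff by blast
      from comp_same[OF this, of "(p + r, q + s)"]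
      show "comp (p + r, q + s) (e j *v v) = (if j = i then e i *v v else 0)"
        by (auto simp: i j)
    qed
    also have "\<dots> = e i *v v" using J by (simp add: J_def)
    finally show ?thesis .
  qed
  have eq: "c i *v v = d i *v v" if "v \<in> I j" for v j
  proof -
    have v: "v \<in> I (fst j, snd j)" using that by simp
    have "c j \<in> g_type W Q F j" "d j \<in> g_type W Q F j" for j
      using c d unfolding is_decomposition_def by blast+
    thus ?thesis using pick[OF v _ X(1)] pick[OF v _ X(2)] by simp
  qed
  hence "c i *v (\<Sum>j\<in>support. comp j v) = d i *v (\<Sum>j\<in>support. comp j v)" for v
    unfolding mv.sum_right by (intro sum.cong refl eq[OF comp_in])
  thus "c i = d i" unfolding sum_comp_support by (simp add: matrix_eq)
qed

lemma horizontal_decomposition: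
  assumes "X \<in> horizontal W Q F"
  shows "\<exists>c. is_decomposition (g_type W Q F) X c \<and> (\<forall>r s. r \<noteq> - 1 \<longrightarrow> c (r, s) = 0)"
  using assms unfolding horizontal_def
proof (induction X rule: span_induct_alt)
  case base
  show ?case by (intro exI[of _ "\<lambda>_. 0"] conjI is_decompositionI[where J = "{}"]) (auto simp: g_type_zero)
next
  case (step a X Y)
  then obtain s c where X: "X \<in> g_type W Q F (- 1, s)"
    and c: "is_decomposition (g_type W Q F) Y c" "\<forall>r s. r \<noteq> - 1 \<longrightarrow> c (r, s) = 0" by blast
  have "is_decomposition (g_type W Q F) (a *\<^sub>R X) (\<lambda>i. if i = (- 1, s) then a *\<^sub>R X else 0)"
    by (rule is_decompositionI[where J = "{(- 1, s)}"]) (auto simp: g_type_zero g_type_scale X)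
  from is_decomposition_add[OF this c(1) g_type_add] c(2) show ?case
    by (intro exI[of _ "\<lambda>i. (if i = (- 1, s) then a *\<^sub>R X else 0) + c i"] conjI) auto
qed

text \<open>Only types \<open>(-1, s)\<close> occur. A part with \<open>s > 1\<close> would raise
  the weight, but elements of the Lie algebra preserve \<open>Wc (p + q)\<close>, so it vanishes on
  \<open>I (p, q)\<close>; a part with \<open>s < 1\<close> lowers the weight.\<close>

lemma alpha_I:
  assumes X: "X \<in> horizontal W Q F" and v: "v \<in> I (p, q)"
  shows "alpha W Q F X v \<in> I (p - 1, q + 1)" "X *v v - alpha W Q F X v \<in> Wc (p + q - 1)"
proof -
  obtain c where c: "is_decomposition (g_type W Q F) X c" "\<And>r s. r \<noteq> - 1 \<Longrightarrow> c (r, s) = 0"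
    using horizontal_decomposition[OF X] by blast
  have "(THE c. is_decomposition (g_type W Q F) X c) = c"
    using c(1) g_type_decomposition_unique by blast
  hence A: "alpha W Q F X v = c (- 1, 1) *v v" by (simp add: alpha_def component_def)
  have cg: "c i \<in> g_type W Q F i" for i using c(1) unfolding is_decomposition_def by blast
  have cI: "c (- 1, s) *v v \<in> I (p - 1, q + s)" and cW: "c (- 1, s) *v v \<in> Wc (p + q)" for s
    using cg[of "(- 1, s)"] v lie_Wc[of _ v "p + q"] I_Wc[OF v] unfolding g_type_iff
    by (metis diff_conv_add_uminus, blast)
  show "alpha W Q F X v \<in> I (p - 1, q + 1)" unfolding A by (rule cI)
  \<comment> \<open>The type \<open>(-1, 1)\<close> is included even if its part is zero, so that
    its term can always be split off.\<close>
  define J where "J = insert (- 1, 1) {i. c i \<noteq> 0}"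
  have J: "finite J" using c(1) by (simp add: J_def is_decomposition_def)
  have "X = sum c J" by (rule is_decomposition_sum[OF c(1) J]) (simp add: J_def)
  hence "X *v v - alpha W Q F X v = (\<Sum>i\<in>J - {(- 1, 1)}. c i *v v)"
    unfolding A using J by (simp add: mv.add_left mv.sum_left J_def sum.remove[of _ "(- 1, 1)"])
  also have "\<dots> \<in> Wc (p + q - 1)"
  proof (rule vec.subspace_sum[OF subspace_Wc])
    fix i assume i: "i \<in> J - {(- 1, 1)}"
    obtain r s where rs: "i = (r, s)" by (cases i)
    show "c i *v v \<in> Wc (p + q - 1)"
    proof (cases "r = - 1")
      case False
      thus ?thesis using c(2)[of r s] rs W_intros(4) by (simp add: mv.zero_left)
    next
      case True
      show ?thesis
      proof (cases "s > 1")
        case True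
        have "comp (p - 1, q + s) (c (- 1, s) *v v) = 0"
          using cW[of s] True by (simp add: Wc_iff)
        hence "c (- 1, s) *v v = 0" using comp_same[OF cI[of s], of "(p - 1, q + s)"] by simp
        thus ?thesis using rs \<open>r = - 1\<close> W_intros(4) by simp
      next
        case False
        hence "s < 1" using i rs \<open>r = - 1\<close> by auto
        hence "Wc (p - 1 + (q + s)) \<subseteq> Wc (p + q - 1)" by (intro Wc_mono) simp
        thus ?thesis using I_Wc[OF cI[of s]] rs \<open>r = - 1\<close> by auto
      qed
    qed
  qed
  finally show "X *v v - alpha W Q F X v \<in> Wc (p + q - 1)" .
qed

end

text \<open>Gram-Schmidt by induction over a spanning set: subtract from the new vector its
  components along the basis found so far, and normalise the rest unless it is zero.\<close>

lemma orthonormal_basis_exists: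
  fixes h :: "complex ^ 'n \<Rightarrow> complex ^ 'n \<Rightarrow> complex"
  assumes add: "\<And>x x' y. h (x + x') y = h x y + h x' y" and scale: "\<And>c x y. h (c *s x) y = c * h x y"
    and herm: "\<And>x y. h y x = cnj (h x y)" and pos: "\<And>x. x \<noteq> 0 \<Longrightarrow> \<exists>r>0. h x x = complex_of_real r"
    and C: "finite C"
  shows "\<exists>B. finite B \<and> vec.span B = vec.span C \<and> (\<forall>b\<in>B. \<forall>b'\<in>B. h b b' = (if b = b' then 1 else 0))"
  using C
proof (induction C rule: finite_induct)
  case empty
  show ?case by (intro exI[of _ "{}"]) simp
next
  case (insert c C)
  then obtain B where B: "finite B" "vec.span B = vec.span C"
    "\<And>b b'. b \<in> B \<Longrightarrow> b' \<in> B \<Longrightarrow> h b b' = (if b = b' then 1 else 0)" by blast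
  have zero: "h 0 y = 0" for y using scale[of 0 0 y] by simp
  have sum: "h (sum f S) y = (\<Sum>i\<in>S. h (f i) y)" for f :: "complex ^ 'n \<Rightarrow> complex ^ 'n" and S y
    by (induction S rule: infinite_finite_induct) (auto simp: add zero)
  have scale_right: "h y (c *s x) = cnj c * h y x" for c x y
    using scale[of c x y] herm[of y x] herm[of y "c *s x"] by simp
  define x where "x = c - (\<Sum>b\<in>B. h c b *s b)"
  have cx: "c = x + (\<Sum>b\<in>B. h c b *s b)" by (simp add: x_def)
  have sB: "(\<Sum>b\<in>B. h c b *s b) \<in> vec.span B" by (intro vec.span_sum vec.span_scale vec.span_base)
  have orth: "h x b = 0" if b: "b \<in> B" for b
  proof -
    have "h c b = h x b + (\<Sum>b'\<in>B. h c b' * h b' b)"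
      by (subst cx, subst add, subst sum) (simp add: scale)
    also have "(\<Sum>b'\<in>B. h c b' * h b' b) = (\<Sum>b'\<in>B. if b' = b then h c b else 0)"
      by (rule sum.cong) (use B(3) b in auto)
    also have "\<dots> = h c b" using B(1) b by simp
    finally show ?thesis by simp
  qed
  show ?case
  proof (cases "x = 0")
    case True
    hence "c \<in> vec.span C" using cx sB B(2) by simp
    hence "vec.span (insert c C) = vec.span C" by (rule vec.span_redundant)
    thus ?thesis using B by (intro exI[of _ B]) simp
  next
    case False
    obtain r where r: "r > 0" "h x x = complex_of_real r" using pos[OF False] by blast
    define e where "e = complex_of_real (1 / sqrt r) *s x"
    have ee: "h e e = 1"
    proof -
      have "h e e = complex_of_real (1 / sqrt r * (1 / sqrt r * r))"
        unfolding e_def scale scale_right r(2) complex_cnj_complex_of_real of_real_mult ..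
      also have "1 / sqrt r * (1 / sqrt r * r) = 1" using r(1) by (simp add: field_simps)
      finally show ?thesis by simp
    qed
    have eb: "h e b = 0" "h b e = 0" if "b \<in> B" for b
      using orth[OF that] herm[of b e] by (simp_all add: e_def scale)
    have "e \<notin> B" using eb ee by force
    have xe: "x = complex_of_real (sqrt r) *s e" using r(1) by (simp add: e_def)
    have "vec.span (insert e B) = vec.span (insert c C)"
    proof
      have "(\<Sum>b\<in>B. h c b *s b) \<in> vec.span (insert c C)"
        using sB B(2) vec.span_mono[OF subset_insertI, of C c] by blast
      moreover have "c \<in> vec.span (insert c C)" by (rule vec.span_base) simp
      ultimately have "e \<in> vec.span (insert c C)"
        unfolding e_def x_def by (intro vec.span_scale vec.span_diff)
      moreover have "B \<subseteq> vec.span (insert c C)"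
        using vec.span_superset[of B] B(2) vec.span_mono[OF subset_insertI, of C c] by blast
      ultimately show "vec.span (insert e B) \<subseteq> vec.span (insert c C)"
        by (intro vec.span_minimal) auto
      have "c \<in> vec.span (insert e B)"
      proof (subst cx, rule vec.span_add)
        show "x \<in> vec.span (insert e B)" by (subst xe, intro vec.span_scale vec.span_base) simp
        show "(\<Sum>b\<in>B. h c b *s b) \<in> vec.span (insert e B)"
          using sB vec.span_mono[OF subset_insertI, of B e] by blast
      qed
      moreover have "C \<subseteq> vec.span (insert e B)"
        using vec.span_superset[of C] B(2) vec.span_mono[OF subset_insertI, of B e] by blast
      ultimately show "vec.span (insert c C) \<subseteq> vec.span (insert e B)"
        by (intro vec.span_minimal) auto
    qed
    thus ?thesis using B(1,3) ee eb \<open>e \<notin> B\<close> by (intro exI[of _ "insert e B"]) auto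
  qed
qed

text \<open>In an orthonormal basis the coefficient of \<open>b\<close> in a vector is its product
  with \<open>b\<close>, so the trace is the sum of the numbers \<open>h (M b) b\<close>.
  \<open>trace_on_eq_trace\<close> moves from the chosen basis to this one.\<close>

lemma trace_on_nonneg:
  fixes h :: "complex ^ 'n \<Rightarrow> complex ^ 'n \<Rightarrow> complex" and M P :: "complex ^ 'n ^ 'n"
  assumes add: "\<And>x x' y. h (x + x') y = h x y + h x' y" and scale: "\<And>c x y. h (c *s x) y = c * h x y"
    and herm: "\<And>x y. h y x = cnj (h x y)" and pos: "\<And>x. x \<noteq> 0 \<Longrightarrow> \<exists>r>0. h x x = complex_of_real r"
    and A: "vec.subspace A" and M: "\<And>v. v \<in> A \<Longrightarrow> M *v v \<in> A"
    and P: "\<And>x. P *v x \<in> A" "\<And>v. v \<in> A \<Longrightarrow> P *v v = v"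
    and nonneg: "\<And>v. v \<in> A \<Longrightarrow> h (M *v v) v \<in> \<real>\<^sub>\<ge>\<^sub>0"
  shows "trace_on A (\<lambda>v. M *v v) \<in> \<real>\<^sub>\<ge>\<^sub>0"
proof -
  obtain C where C: "C \<subseteq> A" "vec.independent C" "A \<subseteq> vec.span C" "card C = vec.dim A"
    using vec.basis_exists by blast
  have fC: "finite C" using C(2) vec.independent_bound_general by blast
  have sC: "vec.span C = A" using C(1,3) vec.span_minimal[OF _ A] by blast
  obtain B where B: "finite B" "vec.span B = A"
    and on: "\<And>b b'. b \<in> B \<Longrightarrow> b' \<in> B \<Longrightarrow> h b b' = (if b = b' then 1 else 0)"
    using orthonormal_basis_exists[of h, OF add scale herm pos fC] sC by auto
  have zero: "h 0 y = 0" for y using scale[of 0 0 y] by simp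
  have sum: "h (sum f S) y = (\<Sum>i\<in>S. h (f i) y)" for f :: "complex ^ 'n \<Rightarrow> complex ^ 'n" and S y
    by (induction S rule: infinite_finite_induct) (auto simp: add zero)
  have coef: "h (\<Sum>b\<in>B. f b *s b) b = f b" if b: "b \<in> B" for f b
  proof -
    have "h (\<Sum>b\<in>B. f b *s b) b = (\<Sum>b'\<in>B. if b' = b then f b else 0)"
      unfolding sum scale by (rule sum.cong) (use on b in auto)
    thus ?thesis using B(1) b by simp
  qed
  have ind: "vec.independent B"
  proof (rule vec.independent_if_scalars_zero[OF B(1)])
    fix f x assume "(\<Sum>x\<in>B. f x *s x) = 0" "x \<in> B"
    thus "f x = 0" using coef[of x f] zero by simp
  qed
  have rep: "vec.representation B x b = h x b" if "x \<in> A" "b \<in> B" for x b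
    using coef[OF that(2), of "vec.representation B x"] vec.sum_representation_eq[OF ind _ B(1), of x] that(1) B(2)
    by simp
  have "trace_on A (\<lambda>v. M *v v) = trace (M ** P)"
    by (rule trace_on_eq_trace[OF A refl M P])
  also have "\<dots> = (\<Sum>b\<in>B. vec.representation B (M *v b) b)"
    by (rule trace_eq_sum_representation[OF ind B(1), symmetric]) (simp_all add: B(2) M P)
  also have "\<dots> = (\<Sum>b\<in>B. h (M *v b) b)"
    using rep M vec.span_base[of _ B] B(2) by (intro sum.cong) auto
  also have "\<dots> \<in> \<real>\<^sub>\<ge>\<^sub>0"
  proof -
    have sum_nonneg: "sum f S \<in> \<real>\<^sub>\<ge>\<^sub>0" if "\<And>b. b \<in> S \<Longrightarrow> f b \<in> \<real>\<^sub>\<ge>\<^sub>0" for f :: "complex ^ 'n \<Rightarrow> complex" and S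
      using that by (induction S rule: infinite_finite_induct) (auto intro: nonneg_Reals_add_I)
    show ?thesis by (rule sum_nonneg) (rule nonneg, simp add: B(2)[symmetric] vec.span_base)
  qed
  finally show ?thesis .
qed

section \<open>Horizontal maps into the classifying space\<close>

lemma smooth_ext_cong: "(\<And>z. z \<in> S \<Longrightarrow> E z = E' z) \<Longrightarrow> smooth_ext S E \<longleftrightarrow> smooth_ext S E'"
proof -
  assume eq: "\<And>z. z \<in> S \<Longrightarrow> E z = E' z"
  have "smooth_section E U \<sigma> \<longleftrightarrow> smooth_section E' U \<sigma>" if "U \<subseteq> S" for U \<sigma>
    using that eq unfolding smooth_section_def by (metis subsetD)
  thus ?thesis unfolding smooth_ext_def using eq by (metis (no_types, lifting))
qed

lemma holomorphic_frame_dim: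
  assumes "is_holomorphic_frame E U r e" "z \<in> U"
  shows "vec.dim (E z) = r" "indexed_independent {..<r} (\<lambda>i. e i z)"
proof -
  show ind: "indexed_independent {..<r} (\<lambda>i. e i z)"
    using assms unfolding is_holomorphic_frame_def indexed_independent_def by auto
  have "E z = vec.span ((\<lambda>i. e i z) ` {..<r})"
    using assms unfolding is_holomorphic_frame_def by (auto simp: image_def intro!: arg_cong[of _ _ vec.span])
  thus "vec.dim (E z) = r"
    using indexed_independent_imp[OF finite_lessThan ind]
    by (simp add: vec.dim_eq_card_independent card_image)
qed

lemma holomorphic_frame_section:
  assumes "is_holomorphic_frame E U r e" "open U" "i < r"
  shows "smooth_section E U (e i)"
proof -
  have "e i z \<in> E z" if "z \<in> U" for z
    using assms that unfolding is_holomorphic_frame_def by (auto intro: vec.span_base)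
  thus ?thesis
    using assms unfolding is_holomorphic_frame_def smooth_section_def by (auto intro: smooth_holomorphic_vec)
qed

lemma smooth_ext_holomorphic_subbundle:
  assumes "holomorphic_subbundle S E"
  shows "smooth_ext S E"
  unfolding smooth_ext_def
proof (intro ballI)
  fix s v assume s: "s \<in> S" and v: "v \<in> E s"
  obtain U r e where U: "open U" "s \<in> U" "U \<subseteq> S" and e: "is_holomorphic_frame E U r e"
    using assms s unfolding holomorphic_subbundle_def by blast
  have Es: "E z = vec.span ((\<lambda>i. e i z) ` {..<r})" if "z \<in> U" for z
    using e that unfolding is_holomorphic_frame_def by (auto simp: image_def intro!: arg_cong[of _ _ vec.span])
  have sec: "smooth_section E U (e i)" if "i < r" for i
    by (rule holomorphic_frame_section[OF e U(1) that])
  have "v \<in> vec.span ((\<lambda>i. e i s) ` {..<r})" using v Es U(2) by simp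
  then obtain y where "v = (\<Sum>x\<in>(\<lambda>i. e i s) ` {..<r}. y x *s x)"
    unfolding vec.span_finite[OF finite_imageI[OF finite_lessThan]] by blast
  hence y: "v = (\<Sum>i<r. y (e i s) *s e i s)"
    by (simp add: sum.reindex[OF indexed_independent_imp(1)[OF finite_lessThan holomorphic_frame_dim(2)[OF e U(2)]]])
  define \<sigma> where "\<sigma> z = (\<Sum>i<r. y (e i s) *s e i z)" for z
  have "smooth_section E U \<sigma>"
    unfolding smooth_section_def
  proof (intro conjI ballI)
    show "smooth_fun_on U \<sigma>"
      unfolding \<sigma>_def using sec
      by (intro smooth_sum smooth_vec_scale smooth_const U(1)) (auto simp: smooth_section_def)
    fix z assume z: "z \<in> U"
    show "\<sigma> z \<in> E z"
      unfolding \<sigma>_def Es[OF z] by (intro vec.span_sum vec.span_scale vec.span_base) auto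
  qed
  thus "\<exists>U \<sigma>. open U \<and> s \<in> U \<and> U \<subseteq> S \<and> smooth_section E U \<sigma> \<and> \<sigma> s = v"
    using U y by (intro exI[of _ U] exI[of _ \<sigma>]) (auto simp: \<sigma>_def)
qed

locale horizontal_map =
  fixes W :: "int \<Rightarrow> (real ^ 'n) set" and Q :: "int \<Rightarrow> real ^ 'n \<Rightarrow> real ^ 'n \<Rightarrow> real"
    and hn :: "int \<Rightarrow> int \<Rightarrow> nat" and S :: "complex set" and F :: "complex \<Rightarrow> 'n filtration"
    and u :: "complex \<Rightarrow> complex ^ 'n ^ 'n" and n :: int
  assumes S: "open S" "S \<noteq> {}" and weight: "weight_filtration W" and forms: "graded_forms W Q"
    and hol: "holomorphic_map_to (classifying_space W Q hn) S F"
    and pushforward: "\<And>s. s \<in> S \<Longrightarrow> is_pushforward S F s (u s)"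
    and hor: "\<And>s. s \<in> S \<Longrightarrow> u s \<in> horizontal W Q (F s)"
    and top: "\<And>p s. s \<in> S \<Longrightarrow> n < p \<Longrightarrow> F s p = {0}"
begin

section \<open>Constant dimensions and smooth variation of the bigrading\<close>

lemma F_in: "s \<in> S \<Longrightarrow> F s \<in> classifying_space W Q hn"
  using hol by (simp add: holomorphic_map_to_def)

lemma polarized: "s \<in> S \<Longrightarrow> polarized_hodge W (F s) Q"
  using F_in[of s] weight forms
  by unfold_locales (auto simp: classifying_space_def)

lemma hodge: "s \<in> S \<Longrightarrow> weight_hodge W (F s)"
  using polarized unfolding polarized_hodge_def by blast

abbreviation Wc :: "int \<Rightarrow> (complex ^ 'n) set" where "Wc k \<equiv> complexify (W k)"
abbreviation I :: "complex \<Rightarrow> int \<times> int \<Rightarrow> (complex ^ 'n) set" where "I z \<equiv> weight_hodge.I W (F z)"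
abbreviation h where "h z \<equiv> mixed_hodge_metric W Q (F z)"

lemma direct: assumes "s \<in> S" shows "direct_family (I s)"
proof -
  interpret PH: weight_hodge W "F s" by (rule hodge[OF assms])
  show ?thesis by unfold_locales
qed

lemma dim_I: "s \<in> S \<Longrightarrow> vec.dim (I s i) = case_prod hn i"
proof (cases i)
  case (Pair p q)
  assume s: "s \<in> S"
  interpret PH: polarized_hodge W "F s" Q by (rule polarized[OF s])
  have "vec.dim (gr_hodge W (F s) p q) = hn p q + vec.dim (Wc (p + q - 1))"
    using F_in[OF s] by (simp add: classifying_space_def)
  thus ?thesis using PH.dim_I[of p q] Pair by simp
qed

lemma support_I: "s \<in> S \<Longrightarrow> {i. I s i \<noteq> {0}} = {i. case_prod hn i \<noteq> 0}"
proof -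
  assume s: "s \<in> S"
  interpret PH: polarized_hodge W "F s" Q by (rule polarized[OF s])
  have "I s i = {0} \<longleftrightarrow> vec.dim (I s i) = 0" for i
    using PH.zero_in[of i] by (auto simp: vec.dim_eq_0)
  thus ?thesis using dim_I[OF s] by auto
qed

lemma dim_span_I:
  assumes "s \<in> S"
  shows "vec.dim (vec.span (\<Union>i\<in>T. I s i)) = (\<Sum>i\<in>T \<inter> {i. case_prod hn i \<noteq> 0}. case_prod hn i)"
  using direct_family.dim_span[OF direct[OF assms], of T] by (simp add: support_I[OF assms] dim_I[OF assms])

lemma ext_F: "smooth_ext S (\<lambda>z. F z p)"
  using hol by (intro smooth_ext_holomorphic_subbundle) (simp add: holomorphic_map_to_def)

lemma dim_F: "s \<in> S \<Longrightarrow> vec.dim (F s p) = (\<Sum>i\<in>{(a, b). p \<le> a} \<inter> {i. case_prod hn i \<noteq> 0}. case_prod hn i)"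
  by (simp only: weight_hodge.F_eq[OF hodge] dim_span_I)

lemma dim_F_W: "s \<in> S \<Longrightarrow> vec.dim (F s p \<inter> Wc k)
    = (\<Sum>i\<in>{(a, b). p \<le> a \<and> a + b \<le> k} \<inter> {i. case_prod hn i \<noteq> 0}. case_prod hn i)"
  by (simp only: weight_hodge.F_W_eq[OF hodge] dim_span_I)

lemma ext_F_W: "smooth_ext S (\<lambda>z. F z p \<inter> Wc k)"
  by (rule smooth_ext_inter[OF S(1) ext_F smooth_ext_const[OF S(1)] _ _ dim_F refl dim_F_W])
    (auto intro: weight_hodge.subspace_F[OF hodge] weight_hodge.subspace_Wc[OF hodge])

lemma vcnj_F_W: "z \<in> S \<Longrightarrow> vcnj ` (F z p \<inter> Wc k) = vcnj ` F z p \<inter> Wc k"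
  using weight_hodge.vcnj_Wc[OF hodge] by (auto simp: mem_vcnj_image)

lemma ext_cF_W: "smooth_ext S (\<lambda>z. vcnj ` F z p \<inter> Wc k)"
proof -
  have "smooth_ext S (\<lambda>z. vcnj ` (F z p \<inter> Wc k)) \<longleftrightarrow> smooth_ext S (\<lambda>z. vcnj ` F z p \<inter> Wc k)"
    by (rule smooth_ext_cong) (rule vcnj_F_W)
  thus ?thesis using smooth_ext_vcnj[OF ext_F_W] by simp
qed

lemma ext_R: "smooth_ext S (\<lambda>z. weight_hodge.R W (F z) r m)"
proof -
  have "smooth_ext S (\<lambda>z. vec.span (\<Union>j::nat. vcnj ` F z (r - int j) \<inter> Wc (m - int j)))"
    by (rule smooth_ext_span_Union[OF S(1) ext_cF_W])
  moreover have "smooth_ext S (\<lambda>z. weight_hodge.R W (F z) r m) \<longleftrightarrow>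
      smooth_ext S (\<lambda>z. vec.span (\<Union>j::nat. vcnj ` F z (r - int j) \<inter> Wc (m - int j)))"
    by (rule smooth_ext_cong) (rule weight_hodge.R_def[OF hodge])
  ultimately show ?thesis by simp
qed

text \<open>Deligne's formula is an intersection of two families that have the extension property.
  For the second, a sum, the missing constancy of the dimension comes from
  \<open>vcnj_correction_eq\<close>: its conjugate is the span of the summands over a fixed index
  set.\<close>

lemma ext_I: "smooth_ext S (\<lambda>z. I z i)"
proof -
  obtain p q where i: "i = (p, q)" by (cases i)
  let ?A = "\<lambda>z. F z p \<inter> Wc (p + q)"
  let ?B = "\<lambda>z. vec.span (vcnj ` F z q \<inter> Wc (p + q) \<union> weight_hodge.R W (F z) (q - 1) (p + q - 2))"
  have eq: "I z i = ?A z \<inter> ?B z" if "z \<in> S" for z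
    unfolding weight_hodge.I_def[OF hodge[OF that]] i by simp
  have dimB: "vec.dim (?B z) = (\<Sum>i\<in>{(a, b). q \<le> a \<and> a + b \<le> p + q \<or> a < q \<and> b < p} \<inter> {i. case_prod hn i \<noteq> 0}. case_prod hn i)"
    if "z \<in> S" for z
    using weight_hodge.vcnj_correction_eq[OF hodge[OF that], of q p] dim_vcnj_image[of "?B z"]
      dim_span_I[OF that] by simp
  have "smooth_ext S (\<lambda>z. ?A z \<inter> ?B z)"
  proof (rule smooth_ext_inter[OF S(1) ext_F_W _ _ _ dim_F_W dimB])
    show "smooth_ext S ?B"
      by (rule smooth_ext_span_Un[OF S(1) ext_cF_W ext_R])
    show "vec.subspace (?A z)" if "z \<in> S" for z
      using weight_hodge.subspace_F[OF hodge[OF that]] weight_hodge.subspace_Wc[OF hodge[OF that]]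
      by (rule vec.subspace_inter)
    show "vec.dim (?A z \<inter> ?B z) = case_prod hn i" if "z \<in> S" for z
      using dim_I[OF that, of i] eq[OF that] by simp
  qed auto
  moreover have "smooth_ext S (\<lambda>z. I z i) \<longleftrightarrow> smooth_ext S (\<lambda>z. ?A z \<inter> ?B z)"
    by (rule smooth_ext_cong) (rule eq)
  ultimately show ?thesis by simp
qed

lemma smooth_comp: "smooth_fun_on S (\<lambda>z. component (I z) i v)"
  by (rule smooth_component[OF S(1) direct ext_I dim_I])

section \<open>The smooth projections and the constant matrices of the forms\<close>

definition pr :: "int \<times> int \<Rightarrow> complex \<Rightarrow> complex ^ 'n ^ 'n" where "pr i z = matrix (component (I z) i)"

lemma pr_v: "z \<in> S \<Longrightarrow> pr i z *v x = component (I z) i x"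
  unfolding pr_def by (rule matrix_works[OF direct_family.comp_linear[OF direct]])

lemma smooth_pr: "smooth_fun_on S (pr i)"
  unfolding smooth_vec_iff[OF S(1)]
proof (intro allI)
  fix r k
  have "smooth_fun_on S (\<lambda>z. component (I z) i (axis k 1) $ r)"
    using smooth_comp[of i "axis k 1"] by (simp add: smooth_vec_iff[OF S(1)])
  thus "smooth_fun_on S (\<lambda>z. pr i z $ r $ k)" by (simp add: pr_def matrix_def)
qed

text \<open>The property asked for does not involve the Hodge filtration, so its solvability at one
  point of \<open>S\<close> yields a matrix valid for all fibres.\<close>

definition QM :: "int \<Rightarrow> complex ^ 'n ^ 'n"
  where "QM k = (SOME M. \<forall>x\<in>Wc k. \<forall>y\<in>Wc k. complexify_form (Q k) x y = cdot x (M *v y))"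

lemma QM: "x \<in> Wc k \<Longrightarrow> y \<in> Wc k \<Longrightarrow> complexify_form (Q k) x y = cdot x (QM k *v y)"
proof -
  obtain s where "s \<in> S" using S by blast
  from polarized_hodge.Qc_matrix[OF polarized[OF this], of k]
  have "\<forall>x\<in>Wc k. \<forall>y\<in>Wc k. complexify_form (Q k) x y = cdot x (QM k *v y)"
    unfolding QM_def by (rule someI_ex)
  thus "x \<in> Wc k \<Longrightarrow> y \<in> Wc k \<Longrightarrow> complexify_form (Q k) x y = cdot x (QM k *v y)" by blast
qed

lemma vcnj_W: "vcnj v \<in> Wc k \<longleftrightarrow> v \<in> Wc k"
  using weight by (intro vcnj_complexify) (simp add: weight_filtration_def)

lemma dir_deriv_Q:
  assumes U: "open U" "U \<subseteq> S" "z \<in> U" and sm: "smooth_fun_on U \<sigma>" "smooth_fun_on U \<tau>"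
    and W: "\<And>w. w \<in> U \<Longrightarrow> \<sigma> w \<in> Wc k" "\<And>w. w \<in> U \<Longrightarrow> \<tau> w \<in> Wc k"
  shows "dir_deriv a (\<lambda>w. complexify_form (Q k) (\<sigma> w) (vcnj (\<tau> w))) z
    = complexify_form (Q k) (dir_deriv a \<sigma> z) (vcnj (\<tau> z))
    + complexify_form (Q k) (\<sigma> z) (vcnj (dir_deriv a \<tau> z))"
proof -
  interpret PH: polarized_hodge W "F z" Q using polarized U by blast
  have d: "\<sigma> differentiable at z" "\<tau> differentiable at z"
    using smooth_differentiable[OF _ U(3)] sm by auto
  have DW: "dir_deriv a \<sigma> z \<in> Wc k" "dir_deriv a \<tau> z \<in> Wc k"
    by (rule PH.Wc_dir_deriv[OF U(1,3)], use d W in auto)+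
  have L: "bounded_linear (\<lambda>v. QM k *v vcnj v)"
    by (rule bounded_linear_compose[OF mv.bounded_linear_right bounded_linear_vcnj])
  have dL: "(\<lambda>w. QM k *v vcnj (\<tau> w)) differentiable at z"
    using bounded_linear.has_derivative[OF L has_derivative_dir_deriv[OF d(2)]] by (auto simp: differentiable_def)
  have "dir_deriv a (\<lambda>w. complexify_form (Q k) (\<sigma> w) (vcnj (\<tau> w))) z
      = dir_deriv a (\<lambda>w. cdot (\<sigma> w) (QM k *v vcnj (\<tau> w))) z"
    by (rule dir_deriv_cong[OF U(1,3)]) (use W in \<open>simp add: QM vcnj_W\<close>)
  also have "\<dots> = cdot (dir_deriv a \<sigma> z) (QM k *v vcnj (\<tau> z)) + cdot (\<sigma> z) (QM k *v vcnj (dir_deriv a \<tau> z))"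
    unfolding dir_deriv_bounded_bilinear[OF bounded_bilinear_cdot d(1) dL]
      dir_deriv_bounded_linear[OF L d(2)] ..
  finally show ?thesis using W U(3) DW by (simp add: QM vcnj_W)
qed

lemma I_W: "z \<in> S \<Longrightarrow> v \<in> I z (p, q) \<Longrightarrow> v \<in> Wc (p + q)"
  using weight_hodge.I_Wc[OF hodge] by blast

lemma U_fibre_eq: "z \<in> S \<Longrightarrow> U_fibre W (F z) n = vec.span (\<Union>i\<in>{(a, b). a = n}. I z i)"
  unfolding U_fibre_def weight_hodge.deligne_eq[OF hodge] by (rule arg_cong[of _ _ vec.span]) auto

lemma I_above: "z \<in> S \<Longrightarrow> n < a \<Longrightarrow> I z (a, b) = {0}"
  using top[of z a] weight_hodge.I_F[OF hodge, of z] direct_family.zero_in[OF direct, of z] by blast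

text \<open>A summand \<open>I (a, b)\<close> with \<open>a > n\<close> lies in
  \<open>F a = {0}\<close>, so \<open>F n\<close> consists of the summands with \<open>a = n\<close>
  alone.\<close>

lemma U_fibre_F: "z \<in> S \<Longrightarrow> U_fibre W (F z) n = F z n"
proof -
  assume z: "z \<in> S"
  interpret PH: polarized_hodge W "F z" Q by (rule polarized[OF z])
  have "PH.comp (a, b) v = 0" if "n < a" for a b v
    using PH.comp_in[of "(a, b)" v] I_above[OF z that] by auto
  hence k: "PH.comp (a, b) v = 0" if "a \<noteq> n" "\<forall>a b. a < n \<longrightarrow> PH.comp (a, b) v = 0" for a b v
    using that by (cases "n < a") auto
  have iff: "(\<forall>a b. a \<noteq> n \<longrightarrow> PH.comp (a, b) v = 0) \<longleftrightarrow> (\<forall>a b. a < n \<longrightarrow> PH.comp (a, b) v = 0)" for v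
  proof (intro iffI allI impI)
    fix a b assume *: "\<forall>a b. a \<noteq> n \<longrightarrow> PH.comp (a, b) v = 0" and "a < n"
    hence "a \<noteq> n" by simp
    thus "PH.comp (a, b) v = 0" by (rule *[rule_format])
  next
    fix a b assume "\<forall>a b. a < n \<longrightarrow> PH.comp (a, b) v = 0" "a \<noteq> n"
    thus "PH.comp (a, b) v = 0" by (intro k)
  qed
  have "U_fibre W (F z) n = {v. \<forall>a b. a \<noteq> n \<longrightarrow> PH.comp (a, b) v = 0}"
    unfolding U_fibre_eq[OF z] PH.span_eq by (rule Collect_cong) simp
  also have "\<dots> = {v. \<forall>a b. a < n \<longrightarrow> PH.comp (a, b) v = 0}"
    by (rule Collect_cong) (rule iff)
  also have "\<dots> = F z n"
    unfolding PH.F_eq[of n] PH.span_eq by (rule Collect_cong) (simp add: not_le)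
  finally show ?thesis .
qed

text \<open>Given by Hodge numbers, so that one index set serves all fibres.\<close>

definition J :: "int set" where "J = {q. hn n q \<noteq> 0}"

lemma finite_J: "finite J"
proof -
  obtain s where s: "s \<in> S" using S by blast
  have "finite {i. case_prod hn i \<noteq> 0}"
    using direct_family.finite_support[OF direct[OF s]] unfolding support_I[OF s] .
  hence "finite ((\<lambda>q. (n, q)) -` {i. case_prod hn i \<noteq> 0})"
    by (rule finite_vimageI) (simp add: inj_def)
  thus ?thesis by (simp add: J_def vimage_def)
qed

text \<open>\<open>is_pushforward\<close> speaks of holomorphic sections only. A smooth section is a
  combination of a holomorphic frame with smooth coefficients; derivatives of the coefficients stay
  in \<open>F n\<close>, and on the frame the derivative in direction \<open>a\<close> is
  \<open>a\<close> times the complex one.\<close>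

lemma section_derivative:
  assumes U: "open U" "U \<subseteq> S" "z \<in> U" and \<sigma>: "smooth_section (\<lambda>z. F z n) U \<sigma>"
  shows "dir_deriv a \<sigma> z - a *s (u z *v \<sigma> z) \<in> F z n"
proof -
  have zS: "z \<in> S" using U by blast
  have sub: "vec.subspace (F w n)" if "w \<in> S" for w by (rule weight_hodge.subspace_F[OF hodge[OF that]])
  have "holomorphic_subbundle S (\<lambda>s. F s n)" using hol by (simp add: holomorphic_map_to_def)
  then obtain U' r e where U': "open U'" "z \<in> U'" "U' \<subseteq> S" and e: "is_holomorphic_frame (\<lambda>s. F s n) U' r e"
    using zS unfolding holomorphic_subbundle_def by blast
  have sec: "smooth_section (\<lambda>s. F s n) U' (e i)" if "i \<in> {..<r}" for i
    using holomorphic_frame_section[OF e U'(1)] that by simp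
  obtain V \<phi> where V: "open V" "z \<in> V" "V \<subseteq> U'" and \<phi>: "\<And>i. i \<in> {..<r} \<Longrightarrow> smooth_fun_on V (\<phi> i)"
    and coord: "\<And>w d. w \<in> V \<Longrightarrow> d \<in> F w n \<Longrightarrow> d = (\<Sum>i\<in>{..<r}. cdot (\<phi> i w) d *s e i w)"
    and "\<And>w i j. w \<in> V \<Longrightarrow> i \<in> {..<r} \<Longrightarrow> j \<in> {..<r} \<Longrightarrow> cdot (\<phi> i w) (e j w) = (if i = j then 1 else 0)"
    by (rule smooth_frame_coordinates[OF U'(1,2) finite_lessThan _ _ sec holomorphic_frame_dim(2)[OF e U'(2)]])
      (rule sub, use U'(3) in blast, simp add: holomorphic_frame_dim(1)[OF e], assumption, rule that)
  define O' where "O' = V \<inter> U"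
  have O': "open O'" "z \<in> O'" "O' \<subseteq> V" "O' \<subseteq> U" using V U by (auto simp: O'_def)
  define f where "f i w = cdot (\<phi> i w) (\<sigma> w)" for i w
  have smf: "smooth_fun_on O' (f i)" if "i \<in> {..<r}" for i
    unfolding f_def using smooth_subset[OF \<phi>[OF that] O'(3)] smooth_subset[OF _ O'(4)] \<sigma>
    by (intro smooth_cdot O'(1)) (auto simp: smooth_section_def)
  have sme: "smooth_fun_on O' (e i)" if "i \<in> {..<r}" for i
    using smooth_section_subset[OF sec[OF that], of O'] O' V by (auto simp: smooth_section_def)
  have df: "f i differentiable at z" "e i differentiable at z" if "i \<in> {..<r}" for i
    using smooth_differentiable smf[OF that] sme[OF that] O'(2) by auto
  have dfe: "(\<lambda>w. f i w *s e i w) differentiable at z" if "i \<in> {..<r}" for i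
    by (rule smooth_differentiable[OF smooth_vec_scale[OF O'(1) smf[OF that] sme[OF that]] O'(2)])
  have \<sigma>_eq: "\<sigma> w = (\<Sum>i\<in>{..<r}. f i w *s e i w)" if "w \<in> O'" for w
    unfolding f_def by (rule coord) (use that O' \<sigma> in \<open>auto simp: smooth_section_def\<close>)
  have "dir_deriv a \<sigma> z = dir_deriv a (\<lambda>w. \<Sum>i\<in>{..<r}. f i w *s e i w) z"
    by (rule dir_deriv_cong[OF O'(1,2) \<sigma>_eq])
  also have "\<dots> = (\<Sum>i\<in>{..<r}. dir_deriv a (\<lambda>w. f i w *s e i w) z)"
    by (rule dir_deriv_sum[OF dfe])
  also have "\<dots> = (\<Sum>i\<in>{..<r}. dir_deriv a (f i) z *s e i z + f i z *s dir_deriv a (e i) z)"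
    by (intro sum.cong refl dir_deriv_vs df)
  finally have "dir_deriv a \<sigma> z - a *s (u z *v \<sigma> z)
      = (\<Sum>i\<in>{..<r}. dir_deriv a (f i) z *s e i z + f i z *s (dir_deriv a (e i) z - a *s (u z *v e i z)))"
    unfolding \<sigma>_eq[OF O'(2)]
    by (simp add: mv.sum_right mv_scale_right vec.scale_sum_right sum_subtractf[symmetric]
        vec.scale_right_diff_distrib mult.commute algebra_simps)
  also have "\<dots> \<in> F z n"
  proof (intro vec.subspace_sum[OF sub[OF zS]] vec.subspace_add[OF sub[OF zS]] vec.subspace_scale[OF sub[OF zS]])
    fix i assume i: "i \<in> {..<r}"
    show "e i z \<in> F z n" using sec[OF i] U'(2) by (simp add: smooth_section_def)
    have hole: "holomorphic_vec (e i) U'" using e i by (simp add: is_holomorphic_frame_def)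
    have "(\<chi> j. deriv (\<lambda>w. e i w $ j) z) - u z *v e i z \<in> F z n"
      using pushforward[OF zS] U' hole sec[OF i] unfolding is_pushforward_def smooth_section_def by blast
    hence "a *s ((\<chi> j. deriv (\<lambda>w. e i w $ j) z) - u z *v e i z) \<in> F z n"
      by (rule vec.subspace_scale[OF sub[OF zS]])
    moreover have "dir_deriv a (e i) z $ j = a * deriv (\<lambda>w. e i w $ j) z" for j
    proof -
      have "dir_deriv a (e i) z $ j = dir_deriv a (\<lambda>w. e i w $ j) z"
        by (rule dir_deriv_bounded_linear[OF bounded_linear_vec_nth df(2)[OF i], symmetric])
      also have "\<dots> = deriv (\<lambda>w. e i w $ j) z * a"
      proof (rule dir_deriv_eq)
        have "(\<lambda>w. e i w $ j) holomorphic_on U'" using hole by (simp add: holomorphic_vec_def)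
        from holomorphic_derivI[OF this U'(1,2)]
        show "((\<lambda>w. e i w $ j) has_derivative (*) (deriv (\<lambda>w. e i w $ j) z)) (at z)"
          by (simp add: has_field_derivative_def)
      qed
      finally show ?thesis by (simp add: mult.commute)
    qed
    ultimately show "dir_deriv a (e i) z - a *s (u z *v e i z) \<in> F z n"
      by (simp add: vec_eq_iff vec.scale_right_diff_distrib)
        (metis (no_types, lifting) vec_eq_iff vec_lambda_beta vector_smult_component)
  qed
  finally show ?thesis .
qed

end

section \<open>Curvature of the top Hodge bundle\<close>

lemma (in polarized_hodge) h_sum_right: "h v (sum f T) = (\<Sum>i\<in>T. h v (f i))"
proof (induction T rule: infinite_finite_induct)
  case (insert i T)
  thus ?case by (simp add: h_add_right)
qed (use h_scale_right[of v 0 0] in auto)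

context horizontal_map begin

definition H :: "complex \<Rightarrow> complex ^ 'n ^ 'n"
  where "H z = (\<chi> i j. h z (axis i 1) (axis j 1))"

lemma h_H: assumes z: "z \<in> S" shows "h z x y = cdot x (H z *v vcnj y)"
proof -
  interpret PH: polarized_hodge W "F z" Q by (rule polarized[OF z])
  have "h z x y = h z (\<Sum>i\<in>UNIV. x $ i *s axis i 1) (\<Sum>j\<in>UNIV. y $ j *s axis j 1)"
    by (simp add: basis_expansion)
  also have "\<dots> = (\<Sum>i\<in>UNIV. x $ i * (\<Sum>j\<in>UNIV. cnj (y $ j) * H z $ i $ j))"
    unfolding H_def PH.h_def[symmetric] PH.h_sum_right PH.h_sum_left PH.h_scale_left PH.h_scale_right
    by (simp add: sum_distrib_left mult.left_commute) (rule sum.swap)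
  also have "\<dots> = cdot x (H z *v vcnj y)"
    by (simp add: cdot_def matrix_vector_mult_def mult.commute)
  finally show ?thesis .
qed

lemma smooth_H: "smooth_fun_on S H"
  unfolding smooth_vec_iff[OF S(1)]
proof (intro allI)
  fix r t
  let ?T = "{i. case_prod hn i \<noteq> 0}"
  let ?g = "\<lambda>z. \<Sum>i\<in>?T. \<i> powi (fst i - snd i) * cdot (component (I z) i (axis r 1))
    (QM (fst i + snd i) *v vcnj (component (I z) i (axis t 1)))"
  have "H z $ r $ t = ?g z" if z: "z \<in> S" for z
  proof -
    interpret PH: polarized_hodge W "F z" Q by (rule polarized[OF z])
    have "H z $ r $ t = (\<Sum>i\<in>?T. \<i> powi (fst i - snd i) *
        complexify_form (Q (fst i + snd i)) (PH.comp i (axis r 1)) (vcnj (PH.comp i (axis t 1))))"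
      unfolding H_def using PH.h_eq[of "axis r 1" "axis t 1"] support_I[OF z] by (simp add: PH.h_def)
    thus ?thesis using PH.comp_in_Wc' by (simp add: QM vcnj_W)
  qed
  moreover have "smooth_fun_on S ?g"
    by (intro smooth_sum smooth_mult smooth_const smooth_cdot smooth_matrix_vector S(1) smooth_comp
        smooth_bounded_linear[OF S(1) bounded_linear_vcnj])
  ultimately show "smooth_fun_on S (\<lambda>z. H z $ r $ t)"
    using smooth_cong[OF S(1), of "\<lambda>z. H z $ r $ t" ?g] by blast
qed

lemma pr_mult: "z \<in> S \<Longrightarrow> pr i z ** pr j z = (if i = j then pr i z else 0)"
  by (simp add: matrix_eq pr_v direct_family.comp_comp[OF direct] mv.zero_left flip: matrix_vector_mul_assoc)

lemma pr_fixed_iff: "z \<in> S \<Longrightarrow> pr i z *v v = v \<longleftrightarrow> v \<in> I z i"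
  using direct_family.comp_in[OF direct] direct_family.comp_same[OF direct] by (metis pr_v)

lemma E_iff: assumes z: "z \<in> S" shows "v \<in> U_fibre W (F z) n \<longleftrightarrow> (\<Sum>q\<in>J. pr (n, q) z) *v v = v"
proof -
  interpret PH: polarized_hodge W "F z" Q by (rule polarized[OF z])
  have sum: "(\<Sum>q\<in>J. pr (n, q) z) *v v = (\<Sum>i\<in>Pair n ` J. PH.comp i v)"
    unfolding mv.sum_left by (simp add: pr_v[OF z] sum.reindex inj_on_def)
  have zero: "PH.comp i v = 0" if "i \<in> {(a, b). a = n}" "i \<notin> Pair n ` J" for i
    using PH.comp_zero_outside[of i v] that support_I[OF z] by (auto simp: J_def)
  have "v \<in> U_fibre W (F z) n \<longleftrightarrow> (\<forall>i. i \<notin> {(a, b). a = n} \<longrightarrow> PH.comp i v = 0)"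
    unfolding U_fibre_eq[OF z] PH.span_eq by (rule mem_Collect_eq)
  also have "\<dots> \<longleftrightarrow> (\<forall>i. i \<notin> Pair n ` J \<longrightarrow> PH.comp i v = 0)"
  proof (intro iffI allI impI)
    fix i :: "int \<times> int" assume *: "\<forall>i. i \<notin> {(a, b). a = n} \<longrightarrow> PH.comp i v = 0" and i: "i \<notin> Pair n ` J"
    show "PH.comp i v = 0"
      by (cases "i \<in> {(a, b). a = n}") (rule zero[OF _ i], assumption, rule *[rule_format])
  next
    fix i :: "int \<times> int" assume *: "\<forall>i. i \<notin> Pair n ` J \<longrightarrow> PH.comp i v = 0" and i: "i \<notin> {(a, b). a = n}"
    have "i \<notin> Pair n ` J" using i by blast
    thus "PH.comp i v = 0" by (rule *[rule_format])
  qed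
  also have "\<dots> \<longleftrightarrow> (\<Sum>i\<in>Pair n ` J. PH.comp i v) = v"
  proof
    assume "\<forall>i. i \<notin> Pair n ` J \<longrightarrow> PH.comp i v = 0"
    thus "(\<Sum>i\<in>Pair n ` J. PH.comp i v) = v" by (intro PH.sum_comp) (auto simp: finite_J)
  next
    assume eq: "(\<Sum>i\<in>Pair n ` J. PH.comp i v) = v"
    have "(\<Sum>i\<in>Pair n ` J. PH.comp i v) \<in> vec.span (\<Union>i\<in>Pair n ` J. I z i)"
      by (intro vec.span_sum vec.span_base) (use PH.comp_in in blast)
    thus "\<forall>i. i \<notin> Pair n ` J \<longrightarrow> PH.comp i v = 0" unfolding eq PH.span_eq by blast
  qed
  finally show ?thesis unfolding sum .
qed

lemma smooth_section_F:
  "U \<subseteq> S \<Longrightarrow> smooth_section (\<lambda>z. U_fibre W (F z) n) U \<sigma> \<longleftrightarrow> smooth_section (\<lambda>z. F z n) U \<sigma>"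
  unfolding smooth_section_def using U_fibre_F by blast

lemma subspace_F: "z \<in> S \<Longrightarrow> vec.subspace (F z p)"
  by (rule weight_hodge.subspace_F[OF hodge])

sublocale HS: hermitian_splitting S J "\<lambda>q. pr (n, q)" "\<lambda>z. U_fibre W (F z) n" h H
proof
  show "open S" by (rule S(1))
  show "finite J" by (rule finite_J)
  show "smooth_fun_on S (pr (n, q))" for q by (rule smooth_pr)
  show "smooth_fun_on S H" by (rule smooth_H)
  fix z assume z: "z \<in> S"
  interpret PH: polarized_hodge W "F z" Q by (rule polarized[OF z])
  show "pr (n, q) z ** pr (n, r) z = (if q = r then pr (n, q) z else 0)" for q r
    by (simp add: pr_mult[OF z])
  show "U_fibre W (F z) n = {v. (\<Sum>q\<in>J. pr (n, q) z) *v v = v}" using E_iff[OF z] by blast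
  show "h z x y = cdot x (H z *v vcnj y)" for x y by (rule h_H[OF z])
  show "h z y x = cnj (h z x y)" for x y unfolding PH.h_def[symmetric] by (rule PH.h_hermitian)
  show "x \<noteq> 0 \<Longrightarrow> \<exists>r>0. h z x x = complex_of_real r" for x
    unfolding PH.h_def[symmetric] by (rule PH.h_pos)
  show "h z (pr (n, q) z *v x) y = h z x (pr (n, q) z *v y)" for q x y
    unfolding PH.h_def[symmetric] pr_v[OF z] by (rule PH.h_comp_selfadjoint)
next
  fix U q \<sigma> \<tau> z a
  assume U: "open U" "U \<subseteq> S" and sm: "smooth_fun_on U \<sigma>" "smooth_fun_on U \<tau>"
    and \<sigma>: "\<And>z. z \<in> U \<Longrightarrow> pr (n, q) z *v \<sigma> z = \<sigma> z" and \<tau>: "\<And>z. z \<in> U \<Longrightarrow> pr (n, q) z *v \<tau> z = \<tau> z"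
    and z: "z \<in> U"
  have zS: "z \<in> S" using z U by blast
  interpret PH: polarized_hodge W "F z" Q by (rule polarized[OF zS])
  have I\<sigma>: "\<sigma> w \<in> I w (n, q)" and I\<tau>: "\<tau> w \<in> I w (n, q)" if "w \<in> U" for w
    using pr_fixed_iff[of w] \<sigma>[OF that] \<tau>[OF that] U that by blast+
  have W\<sigma>: "\<sigma> w \<in> Wc (n + q)" and W\<tau>: "\<tau> w \<in> Wc (n + q)" if "w \<in> U" for w
    using I_W I\<sigma>[OF that] I\<tau>[OF that] U that by blast+
  let ?c = "\<i> powi (n - q)"
  let ?f = "\<lambda>w. complexify_form (Q (n + q)) (\<sigma> w) (vcnj (\<tau> w))"
  \<comment> \<open>By \<open>h_Q\<close>, on sections of \<open>I (n, q)\<close> the metric is a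
    constant multiple of the constant form \<open>Q (n + q)\<close>.\<close>
  have hw: "h w (\<sigma> w) (\<tau> w) = ?c * ?f w" if "w \<in> U" for w
    using polarized_hodge.h_Q[OF polarized W\<sigma>[OF that] I\<tau>[OF that]] polarized_hodge.h_def[OF polarized] U that by auto
  have "?f w = cdot (\<sigma> w) (QM (n + q) *v vcnj (\<tau> w))" if "w \<in> U" for w
    using W\<sigma>[OF that] W\<tau>[OF that] by (simp add: QM vcnj_W)
  moreover have "smooth_fun_on U (\<lambda>w. cdot (\<sigma> w) (QM (n + q) *v vcnj (\<tau> w)))"
    by (intro smooth_cdot smooth_matrix_vector smooth_const smooth_bounded_linear[OF U(1) bounded_linear_vcnj] U(1) sm)
  ultimately have "smooth_fun_on U ?f"
    using smooth_cong[OF U(1), of ?f "\<lambda>w. cdot (\<sigma> w) (QM (n + q) *v vcnj (\<tau> w))"] by blast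
  hence df: "?f differentiable at z" using z by (rule smooth_differentiable)
  have DW: "dir_deriv a \<sigma> z \<in> Wc (n + q)" "dir_deriv a \<tau> z \<in> Wc (n + q)"
    by (rule PH.Wc_dir_deriv[OF U(1) z], use smooth_differentiable[OF _ z] sm W\<sigma> W\<tau> in auto)+
  have "dir_deriv a (\<lambda>w. h w (\<sigma> w) (\<tau> w)) z = dir_deriv a (\<lambda>w. ?c * ?f w) z"
    by (rule dir_deriv_cong[OF U(1) z]) (rule hw)
  also have "\<dots> = ?c * dir_deriv a ?f z"
    by (rule dir_deriv_bounded_linear[OF bounded_linear_mult_right df])
  also have "dir_deriv a ?f z = complexify_form (Q (n + q)) (dir_deriv a \<sigma> z) (vcnj (\<tau> z))
      + complexify_form (Q (n + q)) (\<sigma> z) (vcnj (dir_deriv a \<tau> z))"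
    by (rule dir_deriv_Q[OF U z sm W\<sigma> W\<tau>])
  also have "?c * \<dots> = h z (dir_deriv a \<sigma> z) (\<tau> z) + h z (\<sigma> z) (dir_deriv a \<tau> z)"
    using PH.h_Q[OF DW(1) I\<tau>[OF z]] PH.h_Q_right[OF I\<sigma>[OF z] DW(2)] by (simp add: PH.h_def distrib_left)
  finally show "dir_deriv a (\<lambda>w. h w (\<sigma> w) (\<tau> w)) z = h z (dir_deriv a \<sigma> z) (\<tau> z) + h z (\<sigma> z) (dir_deriv a \<tau> z)" .
next
  fix U \<sigma> z a
  assume U: "open U" "U \<subseteq> S" and \<sigma>: "smooth_section (\<lambda>z. U_fibre W (F z) n) U \<sigma>" and z: "z \<in> U"
  have zS: "z \<in> S" using z U by blast
  have \<sigma>': "smooth_section (\<lambda>z. F z n) U \<sigma>" using \<sigma> smooth_section_F[OF U(2)] by blast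
  \<comment> \<open>The terms with \<open>u\<close> that are inserted cancel because
    \<open>a + i (i a) = 0\<close>.\<close>
  have "dir_deriv a \<sigma> z + \<i> *s dir_deriv (\<i> * a) \<sigma> z = (dir_deriv a \<sigma> z - a *s (u z *v \<sigma> z))
      + \<i> *s (dir_deriv (\<i> * a) \<sigma> z - (\<i> * a) *s (u z *v \<sigma> z))"
    by (simp add: vec_eq_iff algebra_simps)
  also have "\<dots> \<in> F z n"
    by (intro vec.subspace_add[OF subspace_F[OF zS]] vec.subspace_scale[OF subspace_F[OF zS]]
        section_derivative[OF U z \<sigma>'])
  finally show "dir_deriv a \<sigma> z + \<i> *s dir_deriv (\<i> * a) \<sigma> z \<in> U_fibre W (F z) n"
    unfolding U_fibre_F[OF zS] .
qed

context
  fixes s assumes s: "s \<in> S"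
begin

interpretation PH: polarized_hodge W "F s" Q by (rule polarized[OF s])

section \<open>Derivatives of the projections at one point\<close>

abbreviation "al \<equiv> alpha W Q (F s) (u s)"
abbreviation "Dp a q \<equiv> dir_deriv a (pr (n, q)) s"

lemmas alpha_type = PH.alpha_I[OF hor[OF s]]

lemma dir_deriv_pr_v: "dir_deriv a (\<lambda>w. pr (n, q) w *v x) s = Dp a q *v x"
  using dir_deriv_mv[OF smooth_differentiable[OF smooth_pr s], of "\<lambda>_. x" a "(n, q)"]
  by (simp add: dir_deriv_const mv.zero_right)

lemma smooth_pr_v: "smooth_fun_on S (\<lambda>w. pr i w *v x)"
  by (intro smooth_matrix_vector smooth_pr smooth_const S(1))

lemma pr_Wc: "z \<in> S \<Longrightarrow> pr (n, q) z *v x \<in> Wc (n + q)"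
  using I_W direct_family.comp_in[OF direct] by (metis pr_v)

lemma Dp_Wc: "Dp a q *v x \<in> Wc (n + q)"
  unfolding dir_deriv_pr_v[symmetric]
  by (rule PH.Wc_dir_deriv[OF S(1) s smooth_differentiable[OF smooth_pr_v s] pr_Wc])

text \<open>At every point the projection onto \<open>I (n, q)\<close> kills
  \<open>Wc (n + q - 1)\<close>, a space that does not move.\<close>

lemma Dp_low: assumes w: "w \<in> Wc (n + q - 1)" shows "Dp a q *v w = 0"
proof -
  have "pr (n, q) z *v w = 0" if z: "z \<in> S" for z
  proof -
    interpret Z: polarized_hodge W "F z" Q by (rule polarized[OF z])
    show ?thesis using w unfolding pr_v[OF z] by (simp add: Z.Wc_iff)
  qed
  hence "dir_deriv a (\<lambda>z. pr (n, q) z *v w) s = dir_deriv a (\<lambda>z. 0) s"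
    by (intro dir_deriv_cong[OF S(1) s])
  thus ?thesis by (simp add: dir_deriv_pr_v dir_deriv_const)
qed

text \<open>\<open>Dp a q\<close> applied to \<open>v\<close> is the derivative of a section of
  \<open>F n\<close>, hence differs from \<open>a u v\<close> by some \<open>y\<close> in
  \<open>F n\<close>; all terms have weight at most \<open>n + q\<close>. As nothing lies above
  \<open>F n\<close>, the only component of \<open>y\<close> of weight \<open>n + q\<close> has type
  \<open>(n, q)\<close>. It vanishes because \<open>p (D p) p = 0\<close> and neither
  \<open>al v\<close> nor the lower weight part of \<open>u v\<close> has such a component.\<close>

lemma Dp_top:
  assumes q: "q \<in> J" and v: "v \<in> I s (n, q)"
  shows "Dp a q *v v - a *s al v \<in> Wc (n + q - 1)"
proof -
  let ?\<tau> = "\<lambda>w. pr (n, q) w *v v"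
  have \<tau>s: "?\<tau> s = v" using v pr_fixed_iff[OF s] by blast
  have sec: "smooth_section (\<lambda>z. F z n) S ?\<tau>"
    using HS.smooth_section_p[OF q] smooth_section_F by blast
  have 1: "Dp a q *v v - a *s (u s *v v) \<in> F s n"
    using section_derivative[OF S(1) subset_refl s sec, of a] unfolding dir_deriv_pr_v \<tau>s .
  have al: "al v \<in> I s (n - 1, q + 1)" and low: "u s *v v - al v \<in> Wc (n + q - 1)"
    using alpha_type[OF v] by auto
  have alW: "al v \<in> Wc (n + q)" using I_W[OF s al] by simp
  define y where "y = Dp a q *v v - a *s (u s *v v)"
  have y_eq: "Dp a q *v v - a *s al v = y + a *s (u s *v v - al v)"
    by (simp add: y_def vec.scale_right_diff_distrib)
  have "y = (Dp a q *v v - a *s al v) - a *s (u s *v v - al v)"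
    by (simp add: y_def vec.scale_right_diff_distrib)
  also have "\<dots> \<in> Wc (n + q)"
    by (rule PH.W_intros(2)[OF PH.W_intros(2)[OF Dp_Wc PH.W_intros(3)[OF alW]]
        PH.W_intros(3)[OF PH.Wc_pred[OF low]]])
  finally have yW: "y \<in> Wc (n + q)" .
  have y0: "PH.comp (a', b) y = 0" if "a' < n \<or> n + q < a' + b" for a' b
    using 1 yW that PH.F_W_iff[of y n "n + q"] unfolding y_def by blast
  have "pr (n, q) s ** Dp a q ** pr (n, q) s = 0" by (rule HS.p_Dp_p[OF s q])
  hence "pr (n, q) s *v (Dp a q *v v) = 0"
    using \<tau>s by (metis matrix_vector_mul_assoc mv.zero_left)
  hence c1: "PH.comp (n, q) (Dp a q *v v) = 0" by (simp add: pr_v[OF s])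
  have c2: "PH.comp (n, q) (al v) = 0" using PH.comp_same[OF al, of "(n, q)"] by simp
  have c3: "PH.comp (n, q) (u s *v v - al v) = 0" using low by (simp add: PH.Wc_iff)
  have "PH.comp (n, q) (Dp a q *v v - a *s al v) = 0"
    by (simp add: PH.comp_diff PH.comp_scale c1 c2)
  hence cy: "PH.comp (n, q) y = 0"
    unfolding y_eq PH.comp_add PH.comp_scale c3 by simp
  have "y \<in> Wc (n + q - 1)"
    unfolding PH.Wc_iff
  proof (intro allI impI)
    fix a' b assume ab: "n + q - 1 < a' + b"
    consider "a' < n" | "n < a'" | "a' = n" "n + q < a' + b" | "(a', b) = (n, q)" using ab by force
    thus "PH.comp (a', b) y = 0"
    proof cases
      case 2
      thus ?thesis using PH.comp_in[of "(a', b)" y] I_above[OF s 2, of b] by simp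
    qed (use y0 cy in auto)
  qed
  thus ?thesis unfolding y_eq by (rule PH.W_intros(1)[OF _ PH.W_intros(3)[OF low]])
qed

text \<open>Orthogonality of the projections gives
  \<open>Q (p x, conj (p t)) = Q (x, conj (p t))\<close> at every point, with \<open>Q\<close>
  constant. Differentiating at \<open>s\<close>, where \<open>p x = 0\<close> and
  \<open>p t = t\<close>, moves \<open>D p\<close> from \<open>x\<close> to \<open>t\<close>; there
  \<open>Dp_top\<close> replaces it by \<open>al\<close>, the remainder lying in the
  radical.\<close>

lemma h_Dp:
  assumes q: "q \<in> J" and x: "x \<in> I s (n - 1, q + 1)" and t: "t \<in> I s (n, q)"
  shows "h s (Dp a q *v x) t = - cnj a * h s x (al t)"
proof -
  let ?k = "n + q" and ?c = "\<i> powi (n - q)"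
  let ?t = "\<lambda>w. pr (n, q) w *v t" and ?x = "\<lambda>w. pr (n, q) w *v x"
  have ts: "?t s = t" using t pr_fixed_iff[OF s] by blast
  have xs: "?x s = 0" using PH.comp_same[OF x, of "(n, q)"] by (simp add: pr_v[OF s])
  have xW: "x \<in> Wc ?k" using I_W[OF s x] by simp
  have tW: "t \<in> Wc ?k" using I_W[OF s t] by simp
  have eq: "complexify_form (Q ?k) (?x w) (vcnj (?t w)) = complexify_form (Q ?k) x (vcnj (?t w))"
    if w: "w \<in> S" for w
  proof -
    interpret Z: polarized_hodge W "F w" Q by (rule polarized[OF w])
    have tI: "?t w \<in> I w (n, q)" unfolding pr_v[OF w] by (rule Z.comp_in)
    have "?c * complexify_form (Q ?k) (?x w) (vcnj (?t w)) = ?c * complexify_form (Q ?k) x (vcnj (?t w))"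
      using Z.h_Q[OF pr_Wc[OF w, of q x] tI] Z.h_Q[OF xW tI] Z.h_comp_left[OF tI, of x] by (simp add: pr_v[OF w])
    thus ?thesis by simp
  qed
  have "dir_deriv a (\<lambda>w. complexify_form (Q ?k) (?x w) (vcnj (?t w))) s
      = dir_deriv a (\<lambda>w. complexify_form (Q ?k) x (vcnj (?t w))) s"
    by (rule dir_deriv_cong[OF S(1) s eq])
  moreover have "dir_deriv a (\<lambda>w. complexify_form (Q ?k) (?x w) (vcnj (?t w))) s
      = complexify_form (Q ?k) (Dp a q *v x) (vcnj t) + complexify_form (Q ?k) 0 (vcnj (Dp a q *v t))"
    by (simp add: dir_deriv_Q[OF S(1) subset_refl s smooth_pr_v smooth_pr_v pr_Wc pr_Wc] dir_deriv_pr_v ts xs)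
  moreover have "dir_deriv a (\<lambda>w. complexify_form (Q ?k) x (vcnj (?t w))) s
      = complexify_form (Q ?k) 0 (vcnj t) + complexify_form (Q ?k) x (vcnj (Dp a q *v t))"
    by (simp add: dir_deriv_Q[OF S(1) subset_refl s smooth_const smooth_pr_v xW pr_Wc] dir_deriv_pr_v
        dir_deriv_const ts)
  moreover have z: "complexify_form (Q ?k) 0 (vcnj w) = 0" if "w \<in> Wc ?k" for w
    using PH.Qc_scale_left[of 0 ?k "vcnj w" 0] that PH.W_intros(4) by (simp add: vcnj_W)
  ultimately have main: "complexify_form (Q ?k) (Dp a q *v x) (vcnj t) = complexify_form (Q ?k) x (vcnj (Dp a q *v t))"
    using z[OF Dp_Wc] z[OF tW] by simp
  define w where "w = Dp a q *v t - a *s al t"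
  have w: "w \<in> Wc (?k - 1)" unfolding w_def by (rule Dp_top[OF q t])
  have al: "al t \<in> I s (n - 1, q + 1)" by (rule alpha_type[OF t])
  have alW: "al t \<in> Wc ?k" using I_W[OF s al] by simp
  have "complexify_form (Q ?k) x (vcnj (Dp a q *v t)) = complexify_form (Q ?k) x (cnj a *s vcnj (al t) + vcnj w)"
    by (simp add: w_def)
  also have "\<dots> = cnj a * complexify_form (Q ?k) x (vcnj (al t))"
    using PH.Qc_add_right[OF xW PH.W_intros(3)[of "vcnj (al t)"], of "vcnj w" "cnj a"]
      PH.Qc_zero_right[OF xW, of "vcnj w"] PH.Qc_scale_right[OF xW, of "vcnj (al t)" "cnj a"]
      PH.Wc_pred[OF w] w alW by (simp add: vcnj_W)
  finally have "h s (Dp a q *v x) t = cnj a * (?c * complexify_form (Q ?k) x (vcnj (al t)))"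
    using PH.h_Q[OF Dp_Wc t, of a x] main by (simp add: PH.h_def)
  also have "?c * complexify_form (Q ?k) x (vcnj (al t)) = - h s x (al t)"
  proof -
    have "?c = \<i> powi (n - 1 - (q + 1) + 2)" by simp
    also have "\<dots> = - (\<i> powi (n - 1 - (q + 1)))"
      using power_int_add[of \<i> "n - 1 - (q + 1)" 2] by (simp del: add_diff_eq)
    finally have "?c = - (\<i> powi (n - 1 - (q + 1)))" .
    thus ?thesis using PH.h_Q[of x "n - 1" "q + 1" "al t"] xW al by (simp add: PH.h_def)
  qed
  finally show ?thesis by simp
qed

lemma curv_h_I:
  assumes q: "q \<in> J" "r \<in> J" and v: "v \<in> I s (n, q)" and t: "t \<in> I s (n, r)"
  shows "h s (HS.curv HS.Mform a b s *v v) t = ds_dsbar a b * h s (al v) (al t)"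
proof -
  have pv: "pr (n, q) s *v v = v" using v pr_fixed_iff[OF s] by blast
  have al: "al v \<in> I s (n - 1, q + 1)" "al t \<in> I s (n - 1, r + 1)"
    using alpha_type(1)[OF v] alpha_type(1)[OF t] by auto
  have cv: "HS.curv HS.Mform a b s *v v = pr (n, q) s *v (Dp a q *v (Dp b q *v v) - Dp b q *v (Dp a q *v v))"
    by (rule HS.curv_Mform[OF s q(1) pv])
  show ?thesis
  proof (cases "q = r")
    case False
    have "HS.curv HS.Mform a b s *v v \<in> I s (n, q)"
      unfolding cv pr_v[OF s] by (rule PH.comp_in)
    hence "h s (HS.curv HS.Mform a b s *v v) t = 0"
      using PH.h_orth[OF _ t] False by (simp add: PH.h_def)
    moreover have "h s (al v) (al t) = 0" using PH.h_orth[OF al] False by (simp add: PH.h_def)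
    ultimately show ?thesis by simp
  next
    case True
    \<comment> \<open>The inner derivative may be replaced by \<open>b al v\<close>: the remainder
      has lower weight and is killed by the outer one.\<close>
    have DD: "Dp a q *v (Dp b q *v v) = b *s (Dp a q *v al v)" for a b
    proof -
      have "Dp a q *v (Dp b q *v v - b *s al v) = 0" by (rule Dp_low[OF Dp_top[OF q(1) v]])
      thus ?thesis by (simp add: mv.diff_right mv_scale_right)
    qed
    have "h s (pr (n, q) s *v x) t = h s x t" for x
      using PH.h_comp_left[OF t, of x] True by (simp add: PH.h_def pr_v[OF s])
    hence "h s (HS.curv HS.Mform a b s *v v) t = h s (b *s (Dp a q *v al v) - a *s (Dp b q *v al v)) t"
      unfolding cv DD by simp
    also have "\<dots> = b * h s (Dp a q *v al v) t - a * h s (Dp b q *v al v) t"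
      unfolding PH.h_def[symmetric] PH.h_diff_left PH.h_scale_left ..
    also have "\<dots> = ds_dsbar a b * h s (al v) (al t)"
      using h_Dp[OF q(1) al(1)] t True by (simp add: ds_dsbar_def algebra_simps)
    finally show ?thesis .
  qed
qed

lemma U_fibre_sum: "v \<in> U_fibre W (F s) n \<Longrightarrow> v = (\<Sum>q\<in>J. pr (n, q) s *v v)"
  using E_iff[OF s, of v] by (simp add: mv.sum_left)

lemma pr_I: "pr (n, q) s *v v \<in> I s (n, q)"
  unfolding pr_v[OF s] by (rule PH.comp_in)

lemma h_sum_right: "h s v (sum f T) = (\<Sum>i\<in>T. h s v (f i))"
  unfolding PH.h_def[symmetric] by (rule PH.h_sum_right)

lemma al_sum: "al (sum f T) = (\<Sum>i\<in>T. al (f i))"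
  by (simp add: alpha_def mv.sum_right)

lemma curv_h:
  assumes v: "v \<in> U_fibre W (F s) n" and t: "t \<in> U_fibre W (F s) n"
  shows "h s (HS.curv HS.Mform a b s *v v) t = ds_dsbar a b * h s (al v) (al t)"
proof -
  let ?v = "\<lambda>q. pr (n, q) s *v v" and ?t = "\<lambda>q. pr (n, q) s *v t"
  have "h s (HS.curv HS.Mform a b s *v (\<Sum>q\<in>J. ?v q)) (\<Sum>r\<in>J. ?t r)
      = (\<Sum>r\<in>J. \<Sum>q\<in>J. h s (HS.curv HS.Mform a b s *v ?v q) (?t r))"
    unfolding h_sum_right mv.sum_right unfolding PH.h_def[symmetric] PH.h_sum_left ..
  also have "\<dots> = (\<Sum>r\<in>J. \<Sum>q\<in>J. ds_dsbar a b * h s (al (?v q)) (al (?t r)))"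
    by (rule sum.cong[OF refl], rule sum.cong[OF refl], rule curv_h_I[OF _ _ pr_I pr_I])
  also have "\<dots> = ds_dsbar a b * h s (al (\<Sum>q\<in>J. ?v q)) (al (\<Sum>r\<in>J. ?t r))"
    unfolding al_sum h_sum_right unfolding PH.h_def[symmetric] PH.h_sum_left
    by (simp add: sum_distrib_left)
  finally show ?thesis using U_fibre_sum[OF v] U_fibre_sum[OF t] by simp
qed

abbreviation "E \<equiv> U_fibre W (F s) n"

text \<open>This is the composition of \<open>al\<close> with its adjoint, read off the curvature:
  division by the nonzero value \<open>-2 i\<close> of the 2-form on the pair \<open>(1, i)\<close>
  supplies the endomorphism without a separate construction of the adjoint.\<close>

definition adj :: "complex ^ 'n ^ 'n"
  where "adj = mat (1 / ds_dsbar 1 \<i>) ** HS.curv HS.Mform 1 \<i> s"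

lemma ds_dsbar_1_i: "ds_dsbar 1 \<i> \<noteq> 0"
  by (simp add: ds_dsbar_def complex_eq_iff)

lemma adj_E: "v \<in> E \<Longrightarrow> adj *v v \<in> E"
  unfolding adj_def mat_mv
  by (rule vec.subspace_scale[OF HS.subspace_E[OF s]]) (rule HS.curv_in_E[OF HS.Mform_form s])

lemma h_adj: "v \<in> E \<Longrightarrow> t \<in> E \<Longrightarrow> h s (adj *v v) t = h s (al v) (al t)"
  unfolding adj_def mat_mv using curv_h[of v t 1 \<i>] ds_dsbar_1_i
  by (simp add: PH.h_scale_left flip: PH.h_def)

lemma E_nondegenerate:
  assumes "x \<in> E" "y \<in> E" "\<And>t. t \<in> E \<Longrightarrow> h s x t = h s y t" shows "x = y"
proof (rule ccontr)
  assume "x \<noteq> y"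
  hence "\<exists>r>0. h s (x - y) (x - y) = complex_of_real r"
    unfolding PH.h_def[symmetric] by (intro PH.h_pos) simp
  moreover have "x - y \<in> E" by (rule vec.subspace_diff[OF HS.subspace_E[OF s] assms(1,2)])
  hence "h s (x - y) (x - y) = 0" using assms(3)[of "x - y"] by (simp add: PH.h_diff_left flip: PH.h_def)
  ultimately show False by auto
qed

lemma adjoint_alpha:
  assumes v: "v \<in> E" shows "adjoint_on (h s) E al (al v) = adj *v v"
  unfolding adjoint_on_def
proof (rule the_equality)
  have eq: "h s (al t) (al v) = h s t (adj *v v)" if "t \<in> E" for t
    using h_adj[OF v that] PH.h_hermitian[of "al v" "al t"] PH.h_hermitian[of "adj *v v" t]
    by (simp add: PH.h_def)
  show "adj *v v \<in> E \<and> (\<forall>t\<in>E. h s (al t) (al v) = h s t (adj *v v))"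
    using adj_E[OF v] eq by blast
  fix x assume x: "x \<in> E \<and> (\<forall>t\<in>E. h s (al t) (al v) = h s t x)"
  show "x = adj *v v"
  proof (rule E_nondegenerate)
    show "h s x t = h s (adj *v v) t" if "t \<in> E" for t
      using x eq[OF that] that PH.h_hermitian[of t x] PH.h_hermitian[of t "adj *v v"] by (simp add: PH.h_def)
  qed (use x adj_E[OF v] in auto)
qed

lemma curv_adj: assumes v: "v \<in> E" shows "HS.curv HS.Mform a b s *v v = ds_dsbar a b *s (adj *v v)"
proof (rule E_nondegenerate)
  show "HS.curv HS.Mform a b s *v v \<in> E" by (rule HS.curv_in_E[OF HS.Mform_form s])
  show "ds_dsbar a b *s (adj *v v) \<in> E" by (rule vec.subspace_scale[OF HS.subspace_E[OF s] adj_E[OF v]])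
  show "h s (HS.curv HS.Mform a b s *v v) t = h s (ds_dsbar a b *s (adj *v v)) t" if "t \<in> E" for t
    using curv_h[OF v that] h_adj[OF v that] by (simp add: PH.h_scale_left flip: PH.h_def)
qed

lemma alpha_norm_eq: "alpha_norm W Q (F s) (u s) n = trace_on E (\<lambda>v. adj *v v)"
proof -
  obtain B where B: "vec.independent B" "vec.span B = E" "finite B" "B \<subseteq> E"
    "\<And>L. trace_on E L = (\<Sum>b\<in>B. vec.representation B (L b) b)"
    by (rule trace_on_basis[OF HS.subspace_E[OF s]]) (rule that)
  show ?thesis unfolding alpha_norm_def B(5)
    by (rule sum.cong) (use B(4) adjoint_alpha in auto)
qed

theorem first_chern_form_eq:
  "first_chern_form S (\<lambda>z. U_fibre W (F z) n) h s a b
    = \<i> / (2 * complex_of_real pi) * alpha_norm W Q (F s) (u s) n * ds_dsbar a b"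
proof -
  obtain B where B: "vec.independent B" "vec.span B = E" "finite B" "B \<subseteq> E"
    "\<And>L. trace_on E L = (\<Sum>b\<in>B. vec.representation B (L b) b)"
    by (rule trace_on_basis[OF HS.subspace_E[OF s]]) (rule that)
  have "trace_on E (\<lambda>v. HS.curv HS.Mform a b s *v v) = ds_dsbar a b * trace_on E (\<lambda>v. adj *v v)"
    unfolding B(5) sum_distrib_left
  proof (rule sum.cong[OF refl])
    fix x assume "x \<in> B"
    hence x: "x \<in> E" using B(4) by blast
    show "vec.representation B (HS.curv HS.Mform a b s *v x) x = ds_dsbar a b * vec.representation B (adj *v x) x"
      unfolding curv_adj[OF x] using vec.representation_scale[OF B(1), of "adj *v x" "ds_dsbar a b"] adj_E[OF x] B(2)
      by simp
  qed
  thus ?thesis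
    unfolding first_chern_form_def HS.trace_chern_curvature[OF s] alpha_norm_eq by simp
qed

theorem alpha_norm_nonneg: "alpha_norm W Q (F s) (u s) n \<in> \<real>\<^sub>\<ge>\<^sub>0"
  unfolding alpha_norm_eq
proof (rule trace_on_nonneg[where h = "h s" and P = "HS.P s"])
  fix v assume v: "v \<in> E"
  show "h s (adj *v v) v \<in> \<real>\<^sub>\<ge>\<^sub>0"
    unfolding h_adj[OF v v]
  proof (cases "al v = 0")
    case True
    thus "h s (al v) (al v) \<in> \<real>\<^sub>\<ge>\<^sub>0" using PH.h_scale_left[of 0 0 0] by (simp flip: PH.h_def)
  next
    case False
    thus "h s (al v) (al v) \<in> \<real>\<^sub>\<ge>\<^sub>0" using PH.h_pos[OF False] by (auto simp: PH.h_def)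
  qed
next
  show "h s (x + x') y = h s x y + h s x' y" "h s (c *s x) y = c * h s x y" "h s y x = cnj (h s x y)" for c x x' y
    unfolding PH.h_def[symmetric] by (rule PH.h_add_left, rule PH.h_scale_left, rule PH.h_hermitian)
  show "x \<noteq> 0 \<Longrightarrow> \<exists>r>0. h s x x = complex_of_real r" for x
    unfolding PH.h_def[symmetric] by (rule PH.h_pos)
  show "vec.subspace E" by (rule HS.subspace_E[OF s])
  show "v \<in> E \<Longrightarrow> adj *v v \<in> E" for v by (rule adj_E)
  show "HS.P s *v x \<in> E" for x by (rule HS.P_in_E[OF s])
  show "v \<in> E \<Longrightarrow> HS.P s *v v = v" for v using HS.E_iff[OF s] by blast
qed

end

end

theorem corollary5p4:
  fixes W :: "int \<Rightarrow> (real ^ 'n) set"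
    and Q :: "int \<Rightarrow> real ^ 'n \<Rightarrow> real ^ 'n \<Rightarrow> real"
    and hn :: "int \<Rightarrow> int \<Rightarrow> nat"
    and F :: "complex \<Rightarrow> 'n filtration"
    and u :: "complex \<Rightarrow> complex ^ 'n ^ 'n"
    and c :: complex and \<rho> :: real and n :: int
  defines "\<Delta> \<equiv> ball c \<rho>"
    and "D \<equiv> classifying_space W Q hn"
  assumes "weight_filtration W" and "graded_forms W Q"
    and "holomorphic_map_to D \<Delta> F"
    and "\<forall>s\<in>\<Delta>. u s \<in> q_F W Q (F s) \<and> is_pushforward \<Delta> F s (u s)"
    and "\<forall>s\<in>\<Delta>. u s \<in> horizontal W Q (F s)"
    and "\<forall>F'\<in>D. F' n \<noteq> {0} \<and> (\<forall>p>n. F' p = {0})"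
  shows "\<forall>s\<in>\<Delta>.
    (\<forall>a b. first_chern_form \<Delta> (\<lambda>z. U_fibre W (F z) n) (\<lambda>z. mixed_hodge_metric W Q (F z)) s a b
             = \<i> / (2 * complex_of_real pi) * alpha_norm W Q (F s) (u s) n * ds_dsbar a b) \<and>
    (\<forall>a. first_chern_form \<Delta> (\<lambda>z. U_fibre W (F z) n) (\<lambda>z. mixed_hodge_metric W Q (F z)) s a (\<i> * a)
             \<in> \<real>\<^sub>\<ge>\<^sub>0)"
proof (intro ballI conjI allI)
  fix s a b assume s: "s \<in> \<Delta>"
  interpret horizontal_map W Q hn \<Delta> F u n
  proof
    show "open \<Delta>" by (simp add: \<Delta>_def)
    show "\<Delta> \<noteq> {}" using s by blast
    show "holomorphic_map_to (classifying_space W Q hn) \<Delta> F" using assms(5) by (simp add: D_def)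
    show "F s p = {0}" if "s \<in> \<Delta>" "n < p" for s p
      using assms(5,8) that unfolding holomorphic_map_to_def by blast
  qed (use assms in auto)
  note eq = first_chern_form_eq[OF s]
  show "first_chern_form \<Delta> (\<lambda>z. U_fibre W (F z) n) (\<lambda>z. mixed_hodge_metric W Q (F z)) s a b
      = \<i> / (2 * complex_of_real pi) * alpha_norm W Q (F s) (u s) n * ds_dsbar a b" by (rule eq)
  \<comment> \<open>The pair \<open>a\<close>, \<open>i a\<close> is positively oriented; multiplied
    by \<open>i / (2 pi)\<close>, the value of the 2-form on it becomes
    \<open>|a|^2 / pi\<close>.\<close>
  have "ds_dsbar a (\<i> * a) = - 2 * \<i> * complex_of_real ((cmod a)\<^sup>2)"
    unfolding complex_norm_square by (simp add: ds_dsbar_def algebra_simps)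
  hence "first_chern_form \<Delta> (\<lambda>z. U_fibre W (F z) n) (\<lambda>z. mixed_hodge_metric W Q (F z)) s a (\<i> * a)
      = complex_of_real ((cmod a)\<^sup>2 / pi) * alpha_norm W Q (F s) (u s) n"
    unfolding eq by (simp add: field_simps)
  also have "\<dots> \<in> \<real>\<^sub>\<ge>\<^sub>0"
    by (intro nonneg_Reals_mult_I alpha_norm_nonneg[OF s]) (simp only: nonneg_Reals_of_real_iff, simp)
  finally show "first_chern_form \<Delta> (\<lambda>z. U_fibre W (F z) n) (\<lambda>z. mixed_hodge_metric W Q (F z)) s a (\<i> * a)
      \<in> \<real>\<^sub>\<ge>\<^sub>0" .
qed

end
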